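(* Let $C_1$ and $C_2$ be two real rational knots in $S^3$, of degrees $m$ and $n$, which intersect in only one point $p$. Then it is possible to construct a real rational knot in $S^3$, with a parametrization of degree $m+n$, which is isotopic to a small perturbation at $p$ of the union of the original knots $C_1\cup C_2$ outside a small neighbourhood of the intersection.
   Context: $S^3$ denotes the real quadric $x_1^2+x_2^2+x_3^2+x_4^2=x_0^2$ in $\mathbb{RP}^4$. A real rational curve of degree $d$ in $S^3$ is given by a parametrization $k=[k_0:\dots:k_4]:\mathbb{RP}^1\to S^3\subset\mathbb{RP}^4$ with $k_i$ real homogeneous polynomials of degree $d$ without common root; the same polynomials define $\mathbb{C}k:\mathbb{CP}^1\to\mathbb{CP}^4$. It is a real rational knot if it has no singular points, real or complex, i.e. $\mathbb{C}k$ is an injective immersion. A small perturbation at $p$ of $C_1\cup C_2$ is understood as a knot obtained by modifying the union near $p$ so that the two curves are joined there into a single closed curve, while outside a small neighbourhood of $p$ it stays close to $C_1\cup C_2$. *)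

theory Defs
  imports "HOL-Analysis.Analysis" "HOL-Computational_Algebra.Polynomial"
begin

text \<open>A binary form of degree \<open>d\<close> is stored as its dehomogenisation, a real polynomial \<open>q\<close>
  of degree at most \<open>d\<close>; the monomial of degree \<open>i\<close> in \<open>q\<close> stands for
  \<open>s ^ i * t ^ (d - i)\<close>, where \<open>[s : t]\<close> is the point \<open>v\<close> of the projective line. Five forms
  \<open>k\<^sub>0, \<dots>, k\<^sub>4\<close> are a vector with index type \<open>5\<close>, whose elements are \<open>0, \<dots>, 4\<close>.
  The evaluation is used both over the reals and over the complex numbers.\<close>

definition form_eval :: "nat \<Rightarrow> real poly \<Rightarrow> 'a^2 \<Rightarrow> 'a::real_field" where
  "form_eval d q v = (\<Sum>i\<le>d. of_real (coeff q i) * (v $ 1) ^ i * (v $ 2) ^ (d - i))"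

definition curve_map :: "nat \<Rightarrow> real poly ^ 5 \<Rightarrow> 'a::real_field ^ 2 \<Rightarrow> 'a ^ 5" where
  "curve_map d k v = (\<chi> i. form_eval d (k $ i) v)"

definition same_point :: "'a::field ^ 'n \<Rightarrow> 'a ^ 'n \<Rightarrow> bool" where
  "same_point x y \<longleftrightarrow> (\<exists>c. c \<noteq> 0 \<and> x = c *s y)"

definition on_quadric :: "real ^ 5 \<Rightarrow> bool" where
  "on_quadric x \<longleftrightarrow> (x $ 1)\<^sup>2 + (x $ 2)\<^sup>2 + (x $ 3)\<^sup>2 + (x $ 4)\<^sup>2 = (x $ 0)\<^sup>2"

text \<open>The complex forms have no common zero, so that they define a map from the complex projective
  line.\<close>

definition real_rational_curve :: "nat \<Rightarrow> real poly ^ 5 \<Rightarrow> bool" where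
  "real_rational_curve d k \<longleftrightarrow>
     (\<forall>i. degree (k $ i) \<le> d) \<and>
     (\<forall>v::complex^2. v \<noteq> 0 \<longrightarrow> curve_map d k v \<noteq> 0) \<and>
     (\<forall>v::real^2. on_quadric (curve_map d k v))"

definition complex_injective :: "nat \<Rightarrow> real poly ^ 5 \<Rightarrow> bool" where
  "complex_injective d k \<longleftrightarrow>
     (\<forall>v w::complex^2. v \<noteq> 0 \<longrightarrow> w \<noteq> 0 \<longrightarrow>
        same_point (curve_map d k v) (curve_map d k w) \<longrightarrow> same_point v w)"

text \<open>The derivative is nonzero, read in the two standard charts \<open>[z : 1]\<close> and \<open>[1 : z]\<close> of the
  source and in a standard chart (quotients by the \<open>i\<close>-th coordinate) of the target.\<close>

definition complex_immersion :: "nat \<Rightarrow> real poly ^ 5 \<Rightarrow> bool" where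
  "complex_immersion d k \<longleftrightarrow>
     (\<forall>h \<in> {\<lambda>z::complex. vector [z, 1], \<lambda>z. vector [1, z]}. \<forall>z.
        \<exists>i j. curve_map d k (h z) $ i \<noteq> 0 \<and>
              deriv (\<lambda>w. curve_map d k (h w) $ j / curve_map d k (h w) $ i) z \<noteq> 0)"

definition real_rational_knot :: "nat \<Rightarrow> real poly ^ 5 \<Rightarrow> bool" where
  "real_rational_knot d k \<longleftrightarrow>
     real_rational_curve d k \<and> complex_injective d k \<and> complex_immersion d k"

text \<open>The real quadric misses the hyperplane at infinity, and the chart
  \<open>x\<^sub>0 \<noteq> 0\<close> identifies it with the unit sphere of \<open>real^4\<close>.\<close>

abbreviation S3 :: "(real ^ 4) set" where
  "S3 \<equiv> sphere 0 1"

definition affine_point :: "real ^ 5 \<Rightarrow> real ^ 4" where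
  "affine_point x = vector [x $ 1 / x $ 0, x $ 2 / x $ 0, x $ 3 / x $ 0, x $ 4 / x $ 0]"

lemma affine_point_nth:
  "affine_point x $ 1 = x $ 1 / x $ 0" "affine_point x $ 2 = x $ 2 / x $ 0"
  "affine_point x $ 3 = x $ 3 / x $ 0" "affine_point x $ 4 = x $ 4 / x $ 0"
  by (simp_all add: affine_point_def vector_def)

definition real_points :: "nat \<Rightarrow> real poly ^ 5 \<Rightarrow> (real ^ 4) set" where
  "real_points d k = (\<lambda>v. affine_point (curve_map d k v)) ` {v::real^2. v \<noteq> 0}"

text \<open>A regular \<open>1\<close>-periodic parametrisation of a knot.\<close>

definition C1_knot :: "(real \<Rightarrow> real ^ 4) \<Rightarrow> bool" where
  "C1_knot c \<longleftrightarrow>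
     (\<forall>t. c (t + 1) = c t) \<and> c C1_differentiable_on UNIV \<and>
     (\<forall>t. vector_derivative c (at t) \<noteq> 0) \<and> inj_on c {0..<1} \<and> range c \<subseteq> S3"

text \<open>\<open>L\<close> is a single closed curve that runs once along \<open>C\<^sub>1\<close> and then once along \<open>C\<^sub>2\<close>: it stays
  \<open>\<epsilon>\<close>-close to the loop \<open>c\<^sub>1 +++ c\<^sub>2\<close> based at \<open>p\<close>, also to first order outside the ball of
  radius \<open>r\<close> around \<open>p\<close>. Since \<open>L\<close> is embedded, the two passages of this loop through \<open>p\<close> become
  two disjoint arcs, each joining an end of \<open>C\<^sub>1\<close> to an end of \<open>C\<^sub>2\<close>.

  If the tangent lines at \<open>p\<close> are distinct, these arcs must moreover have no crossings when
  projected orthogonally to the plane of the two tangents, as in the usual smoothing of a node,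
  so that no knot or twist can be tied in near \<open>p\<close>. The two inner products are
  coordinates for that projection. If the tangent lines coincide there is no such plane.\<close>

definition small_perturbation ::
  "(real ^ 4) set \<Rightarrow> (real ^ 4) set \<Rightarrow> real ^ 4 \<Rightarrow> real \<Rightarrow> real \<Rightarrow> (real ^ 4) set \<Rightarrow> bool" where
  "small_perturbation C\<^sub>1 C\<^sub>2 p r \<epsilon> L \<longleftrightarrow>
     (\<exists>c\<^sub>1 c\<^sub>2 \<gamma>. C1_knot c\<^sub>1 \<and> range c\<^sub>1 = C\<^sub>1 \<and> c\<^sub>1 0 = p \<and>
        C1_knot c\<^sub>2 \<and> range c\<^sub>2 = C\<^sub>2 \<and> c\<^sub>2 0 = p \<and>
        C1_knot \<gamma> \<and> range \<gamma> = L \<and>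
        (\<forall>t\<in>{0..1}. dist (\<gamma> t) ((c\<^sub>1 +++ c\<^sub>2) t) < \<epsilon>) \<and>
        (\<forall>t\<in>{0..1}. (c\<^sub>1 +++ c\<^sub>2) t \<notin> ball p r \<longrightarrow>
           dist (vector_derivative \<gamma> (at t)) (vector_derivative (c\<^sub>1 +++ c\<^sub>2) (at t)) < \<epsilon>) \<and>
        (let v\<^sub>1 = vector_derivative c\<^sub>1 (at 0); v\<^sub>2 = vector_derivative c\<^sub>2 (at 0) in
           \<not> collinear {0, v\<^sub>1, v\<^sub>2} \<longrightarrow>
             inj_on (\<lambda>x. (x \<bullet> v\<^sub>1, x \<bullet> v\<^sub>2)) (L \<inter> ball p r)))"

text \<open>Ambient isotopy, since isotopy through topological embeddings would identify all tame knots.\<close>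

definition isotopic_in_S3 :: "(real ^ 4) set \<Rightarrow> (real ^ 4) set \<Rightarrow> bool" where
  "isotopic_in_S3 K L \<longleftrightarrow>
     (\<exists>H :: real \<times> (real ^ 4) \<Rightarrow> real ^ 4.
        continuous_on ({0..1} \<times> S3) H \<and>
        (\<forall>t\<in>{0..1}. \<exists>g. homeomorphism S3 S3 (\<lambda>x. H (t, x)) g) \<and>
        (\<forall>x\<in>S3. H (0, x) = x) \<and>
        (\<lambda>x. H (1, x)) ` K = L)"

end

theory Submission
  imports Defs
begin

text \<open>Normalise both parametrisations so that \<open>p\<close> is the value at \<open>[0 : 1]\<close>, and glue them with
  the group law of the quaternionic unit sphere with neutral element \<open>p\<close>, which is given by a real
  bilinear map \<open>B\<close> on the quadric: \<open>k\<^sub>\<delta>(s, t) = B (k\<^sub>1(s, t), k\<^sub>2(- \<delta> t, s))\<close> has degree \<open>m + n\<close>.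
  For small \<open>\<delta>\<close> it is close to \<open>k\<^sub>1\<close> away from \<open>s = 0\<close>, and close to \<open>k\<^sub>2\<close> in the coordinate
  \<open>[- \<delta> t : s]\<close>. So the real points themselves serve as the perturbed curve.

  That \<open>k\<^sub>\<delta>\<close> is a complex injective immersion for small \<open>\<delta>\<close> follows by compactness, once the
  complex curves meet only at \<open>p\<close> and their tangents there are independent: near the node
  \<open>k\<^sub>\<delta>\<close> is the restriction of the immersion \<open>(u, w) \<mapsto> B (k\<^sub>1(u), k\<^sub>2(w))\<close> to \<open>u w = - \<delta>\<close>.
  The same immersion gives the injectivity of the planar projection. Both conditions are achieved
  by a small motion of \<open>k\<^sub>2\<close> that fixes \<open>p\<close>: a rotation, and then a translation in
  stereographic coordinates from \<open>p\<close>, the bad translations being algebraic.\<close>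

text \<open>The hypothesis concerns real points only: the complexified curves may meet elsewhere,
  and the compactness argument would break down at such a meeting, which is why
  \<open>k\<^sub>2\<close> has to be moved at all. The rotation comes before the translation because
  a translation in stereographic coordinates from p acts trivially on the tangent directions at p,
  so independence of the tangents survives it.

  The delicate case of the compactness argument is that of two points running into the node
  together. The failure equations there contain the factor \<delta> / (a * a'), comparing the speeds
  on the two branches, which need not converge. It is eliminated in favour of a determinant whose
  limit is that of the two tangents.

  The sign of \<delta> selects one of the two smoothings of the node: on tan \<phi> * tan \<omega> =
  - \<delta> with \<delta> > 0 both angles increase together, so the glued curve runs along each
  knot in its own direction. Since the projection is taken along the tangents of the original knots,
  its estimate has to be uniform in the perturbation of \<open>k\<^sub>2\<close>.\<close>

lemma exhaust_5:
  fixes x :: 5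
  shows "x = 0 \<or> x = 1 \<or> x = 2 \<or> x = 3 \<or> x = 4"
proof (induct x)
  case (of_int z)
  then have "z = 0 \<or> z = 1 \<or> z = 2 \<or> z = 3 \<or> z = 4" by fastforce
  then show ?case by auto
qed

lemma UNIV_5: "UNIV = {0, 1, 2, 3, 4::5}"
  using exhaust_5 by auto

lemma sum_5: "sum f (UNIV::5 set) = f 0 + f 1 + f 2 + f 3 + f 4"
  unfolding UNIV_5 by (simp add: ac_simps)

lemma forall_5: "(\<forall>i::5. P i) \<longleftrightarrow> P 0 \<and> P 1 \<and> P 2 \<and> P 3 \<and> P 4"
  by (metis exhaust_5)

lemma vec2_eq_iff: "(v::'a^2) = w \<longleftrightarrow> v $ 1 = w $ 1 \<and> v $ 2 = w $ 2"
  by (simp add: vec_eq_iff forall_2)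

lemma vec2_neq_0_iff: "(v::'a::zero^2) \<noteq> 0 \<longleftrightarrow> v $ 1 \<noteq> 0 \<or> v $ 2 \<noteq> 0"
  by (simp add: vec_eq_iff forall_2)

subsection \<open>Binary forms\<close>

definition of_real_vec :: "real ^ 'n \<Rightarrow> 'a::real_algebra_1 ^ 'n" where
  "of_real_vec v = (\<chi> i. of_real (v $ i))"

lemma of_real_vec_nth [simp]: "of_real_vec v $ i = of_real (v $ i)"
  by (simp add: of_real_vec_def)

lemma of_real_vec_eq_0_iff [simp]: "of_real_vec v = 0 \<longleftrightarrow> v = 0"
  by (simp add: vec_eq_iff)

lemma of_real_vec_id [simp]: "(of_real_vec v :: real ^ 'n) = v"
  by (simp add: vec_eq_iff)

text \<open>The operator \<open>*v\<close> wants matrix and vector over one field, whereas here a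
  real matrix has to act on complex points as well.\<close>

definition lin :: "real ^ 'n ^ 'm \<Rightarrow> 'a::real_field ^ 'n \<Rightarrow> 'a ^ 'm" where
  "lin M v = (\<chi> i. \<Sum>j\<in>UNIV. of_real (M $ i $ j) * v $ j)"

lemma lin_real: "lin M v = M *v (v::real^'n)"
  by (simp add: lin_def matrix_vector_mult_def)

lemma lin_mult: "lin (M ** N) v = lin M (lin N v)"
  by (simp add: lin_def matrix_matrix_mult_def vec_eq_iff sum_distrib_left sum_distrib_right mult.assoc)
     (subst sum.swap, simp)

lemma lin_id [simp]: "lin (mat 1) v = v"
  by (simp add: lin_def mat_def vec_eq_iff if_distrib [of of_real] if_distrib [of "\<lambda>x. x * _"] cong: if_cong)

lemma lin_scale: "lin M (c *s v) = c *s lin M v"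
  by (simp add: lin_def vec_eq_iff sum_distrib_left mult_ac)

lemma lin_0 [simp]: "lin M 0 = 0"
  by (simp add: lin_def vec_eq_iff)

lemma lin_of_real_vec: "lin M (of_real_vec v) = of_real_vec (M *v v)"
  by (simp add: lin_def matrix_vector_mult_def vec_eq_iff)

lemma lin_eq_0_iff:
  assumes "N ** M = mat 1"
  shows "lin M v = 0 \<longleftrightarrow> v = 0"
  by (metis assms lin_0 lin_id lin_mult)

lemma form_eval_of_real: "form_eval d q (of_real_vec v :: 'a::real_field^2) = of_real (form_eval d q v)"
  by (simp add: form_eval_def)

lemma curve_map_of_real: "curve_map d k (of_real_vec v :: 'a::real_field^2) = of_real_vec (curve_map d k v)"
  by (simp add: curve_map_def vec_eq_iff form_eval_of_real)

lemma curve_map_nth: "curve_map d k v $ i = form_eval d (k $ i) v"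
  by (simp add: curve_map_def)

lemma form_eval_scale: "form_eval d q (c *s v) = c ^ d * form_eval d q v"
  by (simp add: form_eval_def sum_distrib_left power_mult_distrib)
     (rule sum.cong, auto simp: mult_ac simp flip: power_add)

lemma curve_map_scale: "curve_map d k (c *s v) = c ^ d *s curve_map d k v"
  by (simp add: curve_map_def vec_eq_iff form_eval_scale)

lemma form_eval_conv_poly:
  assumes "v $ 2 \<noteq> 0" "degree q \<le> d"
  shows "form_eval d q v = (v $ 2) ^ d * poly (map_poly of_real q) (v $ 1 / v $ 2)"
proof -
  have "poly (map_poly of_real q) (v $ 1 / v $ 2) = (\<Sum>i\<le>d. of_real (coeff q i) * (v $ 1 / v $ 2) ^ i)"
    using assms(2) unfolding poly_altdef
    by (intro sum.mono_neutral_cong_left) (auto simp: degree_map_poly coeff_map_poly coeff_eq_0)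
  then show ?thesis
    using assms(1) unfolding form_eval_def
    by (auto simp: sum_distrib_left power_divide power_diff field_simps intro!: sum.cong)
qed

lemma form_eval_at_infinity:
  assumes "v $ 2 = 0"
  shows "form_eval d q v = of_real (coeff q d) * (v $ 1) ^ d"
proof -
  have "form_eval d q v = (\<Sum>i\<le>d. if i = d then of_real (coeff q d) * (v $ 1) ^ d else 0)"
    unfolding form_eval_def by (rule sum.cong) (auto simp: assms power_0_left)
  then show ?thesis by simp
qed

lemma coeff_mult_top:
  assumes "degree f \<le> a" "degree g \<le> b"
  shows "coeff (f * g) (a + b) = coeff f a * coeff g b"
proof -
  have "coeff (f * g) (a + b) = (\<Sum>i\<le>a+b. if i = a then coeff f a * coeff g b else 0)"
    unfolding coeff_mult
  proof (rule sum.cong)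
    fix i assume "i \<in> {..a+b}"
    then show "coeff f i * coeff g (a + b - i) = (if i = a then coeff f a * coeff g b else 0)"
      using assms by (cases i a rule: linorder_cases) (auto simp: coeff_eq_0)
  qed simp
  then show ?thesis by simp
qed

lemma map_poly_of_real_mult:
  "map_poly (of_real :: real \<Rightarrow> 'a::real_field) (f * g) = map_poly of_real f * map_poly of_real g"
  by (rule poly_eqI) (simp add: coeff_map_poly coeff_mult)

text \<open>At finite points this is multiplicativity of polynomial evaluation, at infinity a
  comparison of top coefficients; the degree bounds make both readings valid.\<close>

lemma form_eval_mult:
  assumes "degree f \<le> a" "degree g \<le> b"
  shows "form_eval (a + b) (f * g) v = form_eval a f v * form_eval b g v"
proof (cases "v $ 2 = 0")
  case True
  then show ?thesis
    using assms by (simp add: form_eval_at_infinity coeff_mult_top power_add)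
next
  case False
  have "degree (f * g) \<le> a + b"
    using degree_mult_le[of f g] assms by linarith
  with False assms show ?thesis
    by (simp add: form_eval_conv_poly map_poly_of_real_mult power_add)
qed

lemma form_eval_smult: "form_eval d (smult c q) v = of_real c * form_eval d q v"
  by (simp add: form_eval_def sum_distrib_left mult.assoc)

lemma form_eval_add: "form_eval d (p + q) v = form_eval d p v + form_eval d q v"
  by (simp add: form_eval_def sum.distrib algebra_simps)

lemma form_eval_0: "form_eval d 0 v = 0"
  by (simp add: form_eval_def)

lemma form_eval_sum: "form_eval d (\<Sum>i\<in>A. f i) v = (\<Sum>i\<in>A. form_eval d (f i) v)"
  by (induction A rule: infinite_finite_induct) (auto simp: form_eval_add form_eval_0)

lemma form_eval_linear_power: "form_eval i ([:b, a:] ^ i) v = (of_real a * v $ 1 + of_real b * v $ 2) ^ i"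
proof (induction i)
  case (Suc i)
  have "degree [:b, a:] \<le> 1" "degree ([:b, a:] ^ i) \<le> i"
    by (auto intro: order.trans[OF degree_power_le])
  then show ?case
    using form_eval_mult[of "[:b, a:]" 1 "[:b, a:] ^ i" i v] Suc
    by (simp add: form_eval_def add.commute)
qed (simp add: form_eval_def)

text \<open>With \<open>v $ 1\<close> as the variable, \<open>[:M$1$2, M$1$1:]\<close> is the
  dehomogenised linear form given by the first row of \<open>M\<close>, and likewise for the second
  row.\<close>

definition form_subst :: "nat \<Rightarrow> real^2^2 \<Rightarrow> real poly \<Rightarrow> real poly" where
  "form_subst n M q = (\<Sum>i\<le>n. smult (coeff q i)
     ([:M$1$2, M$1$1:] ^ i * [:M$2$2, M$2$1:] ^ (n - i)))"

lemma degree_form_subst: "degree (form_subst n M q) \<le> n"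
proof -
  have "degree ([:M$1$2, M$1$1:] ^ i * [:M$2$2, M$2$1:] ^ (n - i)) \<le> n" if "i \<le> n" for i
  proof -
    have "degree ([:M$1$2, M$1$1:] ^ i) \<le> i" "degree ([:M$2$2, M$2$1:] ^ (n - i)) \<le> n - i"
      by (auto intro: order.trans[OF degree_power_le])
    then show ?thesis
      using that degree_mult_le[of "[:M$1$2, M$1$1:] ^ i" "[:M$2$2, M$2$1:] ^ (n - i)"] by linarith
  qed
  then show ?thesis
    unfolding form_subst_def
    by (intro degree_sum_le) (auto intro: order.trans[OF degree_smult_le])
qed

lemma form_eval_subst: "form_eval n (form_subst n M q) v = form_eval n q (lin M v)"
proof -
  have "form_eval n ([:M$1$2, M$1$1:] ^ i * [:M$2$2, M$2$1:] ^ (n - i)) v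
      = (lin M v $ 1) ^ i * (lin M v $ 2) ^ (n - i)" if "i \<le> n" for i
  proof -
    have d: "degree ([:M$1$2, M$1$1:] ^ i) \<le> i" "degree ([:M$2$2, M$2$1:] ^ (n - i)) \<le> n - i"
      by (auto intro: order.trans[OF degree_power_le])
    show ?thesis
      using form_eval_mult[OF d, of v] that
      by (simp add: form_eval_linear_power lin_def sum_2)
  qed
  then show ?thesis
    unfolding form_subst_def form_eval_sum form_eval_smult
    by (simp add: form_eval_def[of n q] mult.assoc)
qed

definition curve_subst :: "nat \<Rightarrow> real^2^2 \<Rightarrow> real poly ^ 5 \<Rightarrow> real poly ^ 5" where
  "curve_subst n M k = (\<chi> i. form_subst n M (k $ i))"

lemma curve_map_subst: "curve_map n (curve_subst n M k) v = curve_map n k (lin M v)"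
  by (simp add: curve_map_def curve_subst_def form_eval_subst)

definition curve_lin :: "real^5^5 \<Rightarrow> real poly ^ 5 \<Rightarrow> real poly ^ 5" where
  "curve_lin T k = (\<chi> i. \<Sum>j\<in>UNIV. smult (T $ i $ j) (k $ j))"

lemma curve_map_lin: "curve_map n (curve_lin T k) v = lin T (curve_map n k v)"
  by (simp add: curve_map_def curve_lin_def lin_def form_eval_sum form_eval_smult)

lemma degree_curve_lin:
  assumes "\<And>i. degree (k $ i) \<le> d"
  shows "degree (curve_lin T k $ i) \<le> d"
  unfolding curve_lin_def
  by (auto intro!: degree_sum_le order.trans[OF degree_smult_le] assms)

subsection \<open>The Bezoutian\<close>

definition brk :: "'a::comm_ring ^ 2 \<Rightarrow> 'a ^ 2 \<Rightarrow> 'a" where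
  "brk v w = v $ 1 * w $ 2 - v $ 2 * w $ 1"

definition minor :: "'a::comm_ring ^ 'n \<Rightarrow> 'a ^ 'n \<Rightarrow> 'n \<Rightarrow> 'n \<Rightarrow> 'a" where
  "minor x y i j = x $ i * y $ j - x $ j * y $ i"

text \<open>The antisymmetrised monomial divided by \<open>brk v w\<close>. After common powers are
  removed the numerator is X^r - Y^r with X = v1 w2, Y = v2 w1 and r = |p - q|, and X - Y is the
  bracket, so the quotient is a geometric sum.\<close>

definition bez_monom :: "nat \<Rightarrow> nat \<Rightarrow> nat \<Rightarrow> 'a::comm_ring_1 ^ 2 \<Rightarrow> 'a ^ 2 \<Rightarrow> 'a" where
  "bez_monom d p q v w =
     (if q \<le> p
      then (v$1 * w$1) ^ q * (v$2 * w$2) ^ (d - p) * (\<Sum>i<p-q. (v$2 * w$1) ^ (p - q - Suc i) * (v$1 * w$2) ^ i)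
      else - ((v$1 * w$1) ^ p * (v$2 * w$2) ^ (d - q) * (\<Sum>i<q-p. (v$2 * w$1) ^ (q - p - Suc i) * (v$1 * w$2) ^ i)))"

text \<open>The homogeneous Bezoutian f(v) g(w) - g(v) f(w) over \<open>brk v w\<close>. Being
  written without division, it makes sense on the diagonal and is continuous in the points and in
  the coefficients together.\<close>

definition bez :: "nat \<Rightarrow> real poly \<Rightarrow> real poly \<Rightarrow> 'a::real_field ^ 2 \<Rightarrow> 'a ^ 2 \<Rightarrow> 'a" where
  "bez d f g v w = (\<Sum>p\<le>d. \<Sum>q\<le>d. of_real (coeff f p * coeff g q) * bez_monom d p q v w)"

lemma bez_monom:
  assumes "p \<le> d" "q \<le> d"
  shows "v$1 ^ p * v$2 ^ (d - p) * (w$1 ^ q * w$2 ^ (d - q))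
    - v$1 ^ q * v$2 ^ (d - q) * (w$1 ^ p * w$2 ^ (d - p)) = brk v w * bez_monom d p q v w"
proof -
  have main: "v$1 ^ p * v$2 ^ (d - p) * (w$1 ^ q * w$2 ^ (d - q))
    - v$1 ^ q * v$2 ^ (d - q) * (w$1 ^ p * w$2 ^ (d - p)) = brk v w * 
      ((v$1 * w$1) ^ q * (v$2 * w$2) ^ (d - p) * (\<Sum>i<p-q. (v$2 * w$1) ^ (p - q - Suc i) * (v$1 * w$2) ^ i))"
    if "q \<le> p" "p \<le> d" for p q and v w :: "'a^2"
  proof -
    obtain r where r: "p = q + r" using \<open>q \<le> p\<close> le_Suc_ex by blast
    obtain s where s: "d = p + s" using \<open>p \<le> d\<close> le_Suc_ex by blast
    have "(v$1 * w$2) ^ r - (v$2 * w$1) ^ r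
        = brk v w * (\<Sum>i<r. (v$2 * w$1) ^ (r - Suc i) * (v$1 * w$2) ^ i)"
      unfolding brk_def by (rule power_diff_sumr2)
    then have "brk v w * ((v$1 * w$1) ^ q * (v$2 * w$2) ^ s * (\<Sum>i<r. (v$2 * w$1) ^ (r - Suc i) * (v$1 * w$2) ^ i))
      = (v$1 * w$1) ^ q * (v$2 * w$2) ^ s * ((v$1 * w$2) ^ r - (v$2 * w$1) ^ r)"
      by (simp add: mult_ac)
    also have "\<dots> = v$1 ^ p * v$2 ^ (d - p) * (w$1 ^ q * w$2 ^ (d - q))
    - v$1 ^ q * v$2 ^ (d - q) * (w$1 ^ p * w$2 ^ (d - p))"
      by (simp add: r s power_add power_mult_distrib algebra_simps)
    finally show ?thesis by (simp add: r s)
  qed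
  show ?thesis
  proof (cases "q \<le> p")
    case True
    then show ?thesis using main[of q p v w] assms by (simp add: bez_monom_def)
  next
    case False
    then have "p \<le> q" by simp
    from main[OF this assms(2), of v w] False show ?thesis
      by (simp add: bez_monom_def algebra_simps)
  qed
qed

lemma brk_bez:
  "form_eval d f v * form_eval d g w - form_eval d g v * form_eval d f w = brk v w * bez d f g v w"
proof -
  have 1: "form_eval d f v * form_eval d g w = (\<Sum>p\<le>d. \<Sum>q\<le>d. of_real (coeff f p * coeff g q) *
      (v$1 ^ p * v$2 ^ (d - p) * (w$1 ^ q * w$2 ^ (d - q))))"
    unfolding form_eval_def sum_product by (simp add: mult_ac)
  have "form_eval d g v * form_eval d f w = form_eval d f w * form_eval d g v"
    by simp
  also have "\<dots> = (\<Sum>p\<le>d. \<Sum>q\<le>d. of_real (coeff f p * coeff g q) *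
      (v$1 ^ q * v$2 ^ (d - q) * (w$1 ^ p * w$2 ^ (d - p))))"
    unfolding form_eval_def sum_product by (simp add: mult_ac)
  finally have 2: "form_eval d g v * form_eval d f w = (\<Sum>p\<le>d. \<Sum>q\<le>d. of_real (coeff f p * coeff g q) *
      (v$1 ^ q * v$2 ^ (d - q) * (w$1 ^ p * w$2 ^ (d - p))))" .
  show ?thesis
    unfolding 1 2 bez_def sum_distrib_left sum_subtractf[symmetric] right_diff_distrib[symmetric]
    by (intro sum.cong refl) (simp add: mult.left_commute[of "brk v w"] flip: bez_monom)
qed

lemma minor_curve_map:
  "minor (curve_map d k v) (curve_map d k w) i j = brk v w * bez d (k $ i) (k $ j) v w"
  by (simp add: minor_def curve_map_nth flip: brk_bez)

lemma bez_monom_of_real: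
  "bez_monom d p q (of_real_vec v :: 'a::real_field^2) (of_real_vec w) = of_real (bez_monom d p q v w)"
  by (simp add: bez_monom_def)

lemma bez_of_real:
  "bez d f g (of_real_vec v :: 'a::real_field^2) (of_real_vec w) = of_real (bez d f g v w)"
  by (simp add: bez_def bez_monom_of_real)

lemma tendsto_bez:
  fixes v w :: "'b \<Rightarrow> 'a::real_normed_field ^ 2"
  assumes "\<And>p. ((\<lambda>x. coeff (f x) p) \<longlongrightarrow> coeff f' p) F" "\<And>p. ((\<lambda>x. coeff (g x) p) \<longlongrightarrow> coeff g' p) F"
    and "(v \<longlongrightarrow> v') F" "(w \<longlongrightarrow> w') F"
  shows "((\<lambda>x. bez d (f x) (g x) (v x) (w x)) \<longlongrightarrow> bez d f' g' v' w') F"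
proof -
  have "((\<lambda>x. bez_monom d p q (v x) (w x)) \<longlongrightarrow> bez_monom d p q v' w') F" for p q
    unfolding bez_monom_def by (cases "q \<le> p") (auto intro!: tendsto_intros assms)
  then show ?thesis
    unfolding bez_def by (intro tendsto_intros assms)
qed

lemma continuous_on_bez:
  fixes v w :: "'b::topological_space \<Rightarrow> 'a::real_normed_field ^ 2"
  assumes "continuous_on S v" "continuous_on S w"
  shows "continuous_on S (\<lambda>x. bez d f g (v x) (w x))"
  using assms unfolding continuous_on_def by (auto intro!: tendsto_bez)

lemma continuous_on_form_eval:
  fixes v :: "'b::topological_space \<Rightarrow> 'a::real_normed_field ^ 2"
  assumes "continuous_on S v"
  shows "continuous_on S (\<lambda>x. form_eval d q (v x))"
  unfolding form_eval_def by (intro continuous_intros assms)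

lemma continuous_on_curve_map:
  fixes v :: "'b::topological_space \<Rightarrow> 'a::real_normed_field ^ 2"
  assumes "continuous_on S v"
  shows "continuous_on S (\<lambda>x. curve_map d k (v x))"
  unfolding curve_map_def by (intro continuous_on_vec_lambda continuous_on_form_eval assms)

lemma brk_nonzero_exists:
  fixes w :: "'a::real_normed_field ^ 2"
  assumes "w \<noteq> 0"
  obtains u where "brk u w \<noteq> 0"
proof (cases "w $ 1 = 0")
  case True
  then have "brk (vector [1, 0]) w \<noteq> 0" using assms by (auto simp: brk_def vec2_neq_0_iff)
  then show ?thesis using that by blast
next
  case False
  then have "brk (vector [0, 1]) w \<noteq> 0" by (auto simp: brk_def)
  then show ?thesis using that by blast
qed

text \<open>Identities between Bezoutians are obtained by cancelling \<open>brk v w\<close>, hence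
  at first only off the line spanned by \<open>w\<close>. The complement of that line is dense, and
  continuity does the rest.\<close>

lemma eq_by_brk_density:
  fixes f g :: "'a::real_normed_field ^ 2 \<Rightarrow> 'b::t2_space"
  assumes "continuous_on UNIV f" "continuous_on UNIV g" "w \<noteq> 0"
    and eq: "\<And>v. brk v w \<noteq> 0 \<Longrightarrow> f v = g v"
  shows "\<forall>v. f v = g v"
proof
  fix v
  show "f v = g v"
  proof (cases "brk v w = 0")
    case True
    obtain u where u: "brk u w \<noteq> 0" using assms(3) brk_nonzero_exists by blast
    \<comment> \<open>Moving off the line in a transversal direction \<open>u\<close> changes the
      bracket by exactly \<open>brk u w / Suc n\<close>, which is nonzero.\<close>
    define s where "s n = v + (1 / real (Suc n)) *\<^sub>R u" for n
    have "brk (s n) w = (1 / real (Suc n)) *\<^sub>R brk u w" for n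
      using True by (simp add: s_def brk_def algebra_simps)
    then have "brk (s n) w \<noteq> 0" for n using u by simp
    then have fg: "f (s n) = g (s n)" for n using eq by blast
    have "s \<longlonglongrightarrow> v + 0 *\<^sub>R u"
      unfolding s_def by (intro tendsto_intros LIMSEQ_Suc[OF lim_1_over_n])
    then have s: "s \<longlonglongrightarrow> v" by simp
    have "(\<lambda>n. f (s n)) \<longlonglongrightarrow> f v" "(\<lambda>n. g (s n)) \<longlonglongrightarrow> g v"
      using assms(1,2) s by (auto simp: continuous_on_tendsto_compose[OF _ s])
    then show ?thesis using fg LIMSEQ_unique by fastforce
  qed (use eq in blast)
qed

section \<open>Projective equality in terms of minors and brackets\<close>

lemma minor_scale: "minor (a *s x) (b *s y) i j = a * b * minor x y i j"
  by (simp add: minor_def algebra_simps)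

lemma same_point_minor: "same_point x y \<Longrightarrow> minor x y i j = 0"
  by (auto simp: same_point_def minor_def)

lemma minor_zero_same_point:
  assumes "x \<noteq> 0" "y \<noteq> 0" "\<And>i j. minor x y i j = 0"
  shows "same_point x y"
proof -
  obtain j where j: "y $ j \<noteq> 0" using assms(2) by (auto simp: vec_eq_iff)
  have x: "x = (x $ j / y $ j) *s y"
    using assms(3)[of _ j] j by (simp add: vec_eq_iff minor_def field_simps)
  moreover have "x $ j / y $ j \<noteq> 0"
    using x assms(1) by (metis vector_smult_lzero)
  ultimately show ?thesis unfolding same_point_def by blast
qed

lemma same_point_sym: "same_point x y \<Longrightarrow> same_point y x"
  unfolding same_point_def
proof (elim exE conjE)
  fix c assume "c \<noteq> 0" "x = c *s y"
  then show "\<exists>c. c \<noteq> 0 \<and> y = c *s x"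
    by (intro exI[of _ "inverse c"]) (simp add: vector_smult_assoc)
qed

lemma same_point_trans: "same_point x y \<Longrightarrow> same_point y z \<Longrightarrow> same_point x z"
  unfolding same_point_def by (metis mult_eq_0_iff vector_smult_assoc)

lemma same_point_scale: "c \<noteq> 0 \<Longrightarrow> same_point (c *s x) x"
  unfolding same_point_def by blast

lemma brk_eq_0:
  fixes v w :: "'a::field ^ 2"
  assumes "v \<noteq> 0" "w \<noteq> 0" "brk v w = 0"
  shows "same_point v w"
proof (rule minor_zero_same_point[OF assms(1,2)])
  fix i j :: 2
  show "minor v w i j = 0"
    using assms(3) exhaust_2[of i] exhaust_2[of j] by (auto simp: minor_def brk_def)
qed

lemma brk_swap: "brk w v = - brk v (w::'a::comm_ring^2)"
  by (simp add: brk_def mult.commute)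

lemma brk_scale: "brk (a *s v) (b *s w) = a * b * brk v (w::'a::comm_ring_1^2)"
  by (simp add: brk_def algebra_simps)

lemma brk_lin: "brk (lin M v) (lin M w) = of_real (det M) * brk v w"
  by (simp add: brk_def lin_def sum_2 det_2 algebra_simps)

lemma continuous_on_vector_2 [continuous_intros]:
  fixes f g :: "'b::topological_space \<Rightarrow> 'a::{topological_space,zero}"
  assumes "continuous_on S f" "continuous_on S g"
  shows "continuous_on S (\<lambda>x. vector [f x, g x] :: 'a ^ 2)"
proof -
  have "(vector [f x, g x] :: 'a ^ 2) = (\<chi> i. if i = 1 then f x else g x)" for x
    by (simp add: vec2_eq_iff)
  moreover have "continuous_on S (\<lambda>x. if i = 1 then f x else g x)" for i :: 2
    using assms by (cases "i = 1") simp_all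
  ultimately show ?thesis by (simp add: continuous_on_vec_lambda)
qed

lemma continuous_on_scale_vec [continuous_intros]:
  fixes f :: "'b::topological_space \<Rightarrow> 'a::real_normed_field ^ 'n"
  assumes "continuous_on S c" "continuous_on S f"
  shows "continuous_on S (\<lambda>x. c x *s f x)"
  unfolding vector_scalar_mult_def using assms
  by (intro continuous_on_vec_lambda continuous_intros)

lemma continuous_on_lin [continuous_intros]:
  fixes f :: "'b::topological_space \<Rightarrow> 'a::real_normed_field ^ 'n"
  assumes "continuous_on S f"
  shows "continuous_on S (\<lambda>x. lin M (f x))"
  unfolding lin_def using assms by (intro continuous_on_vec_lambda continuous_intros)

text \<open>A Bezoutian has degree d - 1 in each argument; the factor \<open>a * b\<close> on the
  left avoids that exponent, which would be truncated for d = 0.\<close>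

lemma bez_scale:
  fixes v w :: "'a::real_normed_field ^ 2"
  assumes "w \<noteq> 0"
  shows "a * b * bez d f g (a *s v) (b *s w) = (a * b) ^ d * bez d f g v w"
proof -
  have "\<forall>v. a * b * bez d f g (a *s v) (b *s w) = (a * b) ^ d * bez d f g v w"
  proof (rule eq_by_brk_density[OF _ _ assms])
    fix v assume v: "brk v w \<noteq> 0"
    have "brk v w * (a * b * bez d f g (a *s v) (b *s w)) = brk v w * ((a * b) ^ d * bez d f g v w)"
      using brk_bez[of d f "a *s v" g "b *s w"] brk_bez[of d f v g w]
      by (auto simp: form_eval_scale brk_scale power_mult_distrib algebra_simps)
    then show "a * b * bez d f g (a *s v) (b *s w) = (a * b) ^ d * bez d f g v w" using v by simp
  qed (intro continuous_intros continuous_on_bez)+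
  then show ?thesis by blast
qed

lemma bez_scale_eq_0_iff:
  fixes v w :: "'a::real_normed_field ^ 2"
  assumes "w \<noteq> 0" "a \<noteq> 0" "b \<noteq> 0"
  shows "bez d f g (a *s v) (b *s w) = 0 \<longleftrightarrow> bez d f g v w = 0"
  using bez_scale[OF assms(1), of a b d f g v] assms
  by (metis mult_eq_0_iff power_not_zero)

lemma bez_sym:
  fixes v w :: "'a::real_normed_field ^ 2"
  assumes "w \<noteq> 0"
  shows "bez d f g w v = bez d f g v w"
proof -
  have "\<forall>v. bez d f g w v = bez d f g v w"
  proof (rule eq_by_brk_density[OF _ _ assms])
    fix v assume v: "brk v w \<noteq> 0"
    have "brk v w * bez d f g w v = brk v w * bez d f g v w"
      using brk_bez[of d f v g w] brk_bez[of d f w g v] brk_swap[of w v]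
      by (auto simp: algebra_simps)
    then show "bez d f g w v = bez d f g v w" using v by simp
  qed (intro continuous_intros continuous_on_bez)+
  then show ?thesis by blast
qed

text \<open>The relation x_l (x_i y_j - x_j y_i) = x_i (x_l y_j - x_j y_l) - x_j (x_l y_i - x_i
  y_l), divided by the bracket. Where coordinate \<open>l\<close> does not vanish, Bezoutians
  involving \<open>l\<close> therefore control all others, which is what a target chart
  requires.\<close>

lemma bez_pluecker:
  fixes v w :: "'a::real_normed_field ^ 2"
  assumes "w \<noteq> 0"
  shows "form_eval d (k $ l) v * bez d (k $ i) (k $ j) v w =
    form_eval d (k $ i) v * bez d (k $ l) (k $ j) v w - form_eval d (k $ j) v * bez d (k $ l) (k $ i) v w"
proof -
  have "\<forall>v. form_eval d (k $ l) v * bez d (k $ i) (k $ j) v w =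
    form_eval d (k $ i) v * bez d (k $ l) (k $ j) v w - form_eval d (k $ j) v * bez d (k $ l) (k $ i) v w"
  proof (rule eq_by_brk_density[OF _ _ assms])
    fix v assume v: "brk v w \<noteq> 0"
    have "brk v w * (form_eval d (k $ l) v * bez d (k $ i) (k $ j) v w) = brk v w *
      (form_eval d (k $ i) v * bez d (k $ l) (k $ j) v w - form_eval d (k $ j) v * bez d (k $ l) (k $ i) v w)"
      using brk_bez[of d "k$i" v "k$j" w] brk_bez[of d "k$l" v "k$j" w] brk_bez[of d "k$l" v "k$i" w]
      by (simp add: right_diff_distrib mult.left_commute[of "brk v w"] flip: brk_bez)
    then show "form_eval d (k $ l) v * bez d (k $ i) (k $ j) v w =
      form_eval d (k $ i) v * bez d (k $ l) (k $ j) v w - form_eval d (k $ j) v * bez d (k $ l) (k $ i) v w"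
      using v by simp
  qed (intro continuous_intros continuous_on_bez continuous_on_form_eval)+
  then show ?thesis by blast
qed

text \<open>Since \<open>minor (k v) (k w) = brk v w * bez v w\<close>, the Bezoutian at \<open>v \<noteq> w\<close> detects double points,
  and on the diagonal it is the Wronskian: one condition covers injectivity and immersion.\<close>

definition separates :: "nat \<Rightarrow> real poly ^ 5 \<Rightarrow> 'a::real_field ^ 2 \<Rightarrow> 'a ^ 2 \<Rightarrow> bool" where
  "separates d k v w \<longleftrightarrow> (\<exists>i j. bez d (k $ i) (k $ j) v w \<noteq> 0)"

lemma separates_at:
  fixes v w :: "'a::real_normed_field ^ 2"
  assumes "separates d k v w" "w \<noteq> 0" "form_eval d (k $ l) v \<noteq> 0"
  shows "\<exists>j. bez d (k $ l) (k $ j) v w \<noteq> 0"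
  using assms bez_pluecker[OF assms(2), of d k l v] unfolding separates_def
  by (metis diff_zero mult_eq_0_iff)

lemma separates_scale:
  fixes v w :: "'a::real_normed_field ^ 2"
  assumes "w \<noteq> 0" "a \<noteq> 0" "b \<noteq> 0"
  shows "separates d k (a *s v) (b *s w) \<longleftrightarrow> separates d k v w"
  using bez_scale_eq_0_iff[OF assms] by (simp add: separates_def)

lemma separates_sym:
  fixes v w :: "'a::real_normed_field ^ 2"
  assumes "w \<noteq> 0"
  shows "separates d k w v \<longleftrightarrow> separates d k v w"
  using bez_sym[OF assms] by (simp add: separates_def)

text \<open>The difference quotient of g / f is the bracket over w - z, times a Bezoutian, over f(w)
  f(z). So nothing but the continuity of the Bezoutian is needed, and \<sigma> records the speed of
  the chosen path in the source: -1 and 1 in the two affine charts, -1 for the angle.\<close>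

lemma has_field_derivative_curve_quotient:
  fixes h :: "'a::real_normed_field \<Rightarrow> 'a ^ 2"
  assumes h: "continuous_on UNIV h"
    and brk: "((\<lambda>w. brk (h z) (h w) / (w - z)) \<longlongrightarrow> \<sigma>) (at z)"
    and nz: "form_eval d f (h z) \<noteq> 0"
  shows "((\<lambda>w. form_eval d g (h w) / form_eval d f (h w)) has_field_derivative
    \<sigma> * bez d f g (h z) (h z) / (form_eval d f (h z))\<^sup>2) (at z)"
  unfolding has_field_derivative_iff
proof -
  have ct: "continuous_on UNIV (\<lambda>w. form_eval d f (h w))" 
    by (intro continuous_on_form_eval h)
  then have tf: "((\<lambda>w. form_eval d f (h w)) \<longlongrightarrow> form_eval d f (h z)) (at z)"
    by (simp add: continuous_on_def)
  have tb: "((\<lambda>w. bez d f g (h z) (h w)) \<longlongrightarrow> bez d f g (h z) (h z)) (at z)"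
    using continuous_on_bez[OF continuous_on_const[of _ "h z"] h, of d f g] by (simp add: continuous_on_def)
  have "((\<lambda>w. brk (h z) (h w) / (w - z) * bez d f g (h z) (h w) / (form_eval d f (h w) * form_eval d f (h z)))
     \<longlongrightarrow> \<sigma> * bez d f g (h z) (h z) / (form_eval d f (h z) * form_eval d f (h z))) (at z)"
    by (intro tendsto_intros brk tb tf) (use nz in auto)
  moreover have "\<forall>\<^sub>F w in at z. brk (h z) (h w) / (w - z) * bez d f g (h z) (h w) / (form_eval d f (h w) * form_eval d f (h z))
     = (form_eval d g (h w) / form_eval d f (h w) - form_eval d g (h z) / form_eval d f (h z)) / (w - z)"
  proof -
    have "\<forall>\<^sub>F w in at z. form_eval d f (h w) \<noteq> 0"
      using tf nz by (rule tendsto_imp_eventually_ne)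
    moreover have "\<forall>\<^sub>F w in at z. w \<noteq> z" by (simp add: eventually_at_filter)
    ultimately show ?thesis
    proof eventually_elim
      case (elim w)
      show ?case
        using elim nz brk_bez[of d f "h z" g "h w"] by (simp add: field_simps)
    qed
  qed
  ultimately show "((\<lambda>w. (form_eval d g (h w) / form_eval d f (h w) - form_eval d g (h z) / form_eval d f (h z)) / (w - z)) \<longlongrightarrow>
     \<sigma> * bez d f g (h z) (h z) / (form_eval d f (h z))\<^sup>2) (at z)"
    by (simp add: power2_eq_square tendsto_cong)
qed

text \<open>At a common zero every minor with that point vanishes, so any second point with nonzero
  bracket would fail to be separated from it.\<close>

lemma separates_curve_map_nonzero:
  fixes v :: "'a::real_normed_field ^ 2"
  assumes "v \<noteq> 0" "\<And>w. w \<noteq> 0 \<Longrightarrow> separates d k v w"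
  shows "curve_map d k v \<noteq> 0"
proof
  assume 0: "curve_map d k v = 0"
  obtain u where u: "brk u v \<noteq> 0" using assms(1) brk_nonzero_exists by blast
  then have u': "brk v u \<noteq> 0" by (subst brk_swap) simp
  then have "u \<noteq> 0" by (auto simp: brk_def)
  then obtain i j where "bez d (k $ i) (k $ j) v u \<noteq> 0" using assms(2) separates_def by blast
  then show False using minor_curve_map[of d k v u i j] u' 0 by (simp add: minor_def)
qed

lemma immersion_at_iff:
  fixes h :: "complex \<Rightarrow> complex ^ 2"
  assumes h: "continuous_on UNIV h" "h z \<noteq> 0" and nz: "curve_map d k (h z) \<noteq> 0"
    and brk: "((\<lambda>w. brk (h z) (h w) / (w - z)) \<longlongrightarrow> \<sigma>) (at z)" and \<sigma>: "\<sigma> \<noteq> 0"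
  shows "(\<exists>i j. curve_map d k (h z) $ i \<noteq> 0 \<and>
              deriv (\<lambda>w. curve_map d k (h w) $ j / curve_map d k (h w) $ i) z \<noteq> 0)
         \<longleftrightarrow> separates d k (h z) (h z)"
proof -
  have D: "deriv (\<lambda>w. curve_map d k (h w) $ j / curve_map d k (h w) $ i) z \<noteq> 0 \<longleftrightarrow>
     bez d (k $ i) (k $ j) (h z) (h z) \<noteq> 0" if "curve_map d k (h z) $ i \<noteq> 0" for i j
    using DERIV_imp_deriv[OF has_field_derivative_curve_quotient[OF h(1) brk, of d "k $ i" "k $ j"]] that \<sigma>
    by (simp add: curve_map_nth)
  obtain l where l: "curve_map d k (h z) $ l \<noteq> 0" using nz by (auto simp: vec_eq_iff)
  show ?thesis
    using D l separates_at[OF _ h(2), of d k "h z" l] unfolding separates_def curve_map_nth by blast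
qed

lemma complex_immersion_iff:
  assumes nz: "\<And>v::complex^2. v \<noteq> 0 \<Longrightarrow> curve_map d k v \<noteq> 0"
  shows "complex_immersion d k \<longleftrightarrow> (\<forall>v::complex^2. v \<noteq> 0 \<longrightarrow> separates d k v v)"
proof -
  define h1 h2 :: "complex \<Rightarrow> complex^2" where "h1 = (\<lambda>z. vector [z, 1])" and "h2 = (\<lambda>z. vector [1, z])"
  have h: "continuous_on UNIV h1" "continuous_on UNIV h2"
    unfolding h1_def h2_def by (intro continuous_on_vector_2 continuous_intros)+
  have nzh: "h1 z \<noteq> 0" "h2 z \<noteq> 0" for z by (auto simp: h1_def h2_def vec2_neq_0_iff)
  have b1: "((\<lambda>w. brk (h1 z) (h1 w) / (w - z)) \<longlongrightarrow> -1) (at z)" for z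
    by (rule tendsto_eventually) (auto simp: brk_def h1_def eventually_at_filter divide_simps)
  have b2: "((\<lambda>w. brk (h2 z) (h2 w) / (w - z)) \<longlongrightarrow> 1) (at z)" for z
    by (rule tendsto_eventually) (auto simp: brk_def h2_def eventually_at_filter)
  have "complex_immersion d k \<longleftrightarrow> (\<forall>z. separates d k (h1 z) (h1 z)) \<and> (\<forall>z. separates d k (h2 z) (h2 z))"
    unfolding complex_immersion_def h1_def[symmetric] h2_def[symmetric] 
    using immersion_at_iff[OF h(1) nzh(1) nz[OF nzh(1)] b1] immersion_at_iff[OF h(2) nzh(2) nz[OF nzh(2)] b2]
    by simp
  also have "\<dots> \<longleftrightarrow> (\<forall>v::complex^2. v \<noteq> 0 \<longrightarrow> separates d k v v)"
  proof safe
    fix v :: "complex^2" assume a: "\<forall>z. separates d k (h1 z) (h1 z)" "\<forall>z. separates d k (h2 z) (h2 z)" "v \<noteq> 0"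
    show "separates d k v v"
    proof (cases "v $ 2 = 0")
      case True
      then have "v $ 1 \<noteq> 0" "v = (v $ 1) *s h2 0" using a(3) by (auto simp: vec2_neq_0_iff vec2_eq_iff h2_def)
      then show ?thesis using separates_scale[OF nzh(2), of "v$1" "v$1" d k "h2 0" 0] a(2) by simp
    next
      case False
      then have "v = (v $ 2) *s h1 (v $ 1 / v $ 2)" by (auto simp: vec2_eq_iff h1_def)
      then show ?thesis using separates_scale[OF nzh(1), of "v$2" "v$2" d k "h1 (v $ 1 / v $ 2)" "v $ 1 / v $ 2"] a(1) False
        by simp
    qed
  qed (use nzh in auto)
  finally show ?thesis .
qed

text \<open>Proportional pairs are moved to the diagonal by homogeneity, where separation is
  immersion; for the other pairs the bracket is nonzero, so separation is the nonvanishing of some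
  minor, that is injectivity.\<close>

lemma real_rational_knot_iff:
  "real_rational_knot d k \<longleftrightarrow> (\<forall>i. degree (k $ i) \<le> d) \<and> (\<forall>v::real^2. on_quadric (curve_map d k v)) \<and>
     (\<forall>v w::complex^2. v \<noteq> 0 \<longrightarrow> w \<noteq> 0 \<longrightarrow> separates d k v w)"
proof (intro iffI conjI)
  assume k: "real_rational_knot d k"
  show "\<forall>i. degree (k $ i) \<le> d" "\<forall>v::real^2. on_quadric (curve_map d k v)"
    using k by (auto simp: real_rational_knot_def real_rational_curve_def)
  have nz: "\<And>v::complex^2. v \<noteq> 0 \<Longrightarrow> curve_map d k v \<noteq> 0"
    using k by (auto simp: real_rational_knot_def real_rational_curve_def)
  show "\<forall>v w::complex^2. v \<noteq> 0 \<longrightarrow> w \<noteq> 0 \<longrightarrow> separates d k v w"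
  proof (intro allI impI)
    fix v w :: "complex^2" assume vw: "v \<noteq> 0" "w \<noteq> 0"
    show "separates d k v w"
    proof (cases "same_point v w")
      case True
      then obtain c where c: "c \<noteq> 0" "v = c *s w" by (auto simp: same_point_def)
      have "separates d k w w"
        using k complex_immersion_iff[OF nz] vw by (auto simp: real_rational_knot_def)
      then show ?thesis using separates_scale[OF vw(2) c(1), of 1 d k w] c(2) by simp
    next
      case False
      then have "\<not> same_point (curve_map d k v) (curve_map d k w)"
        using k vw by (auto simp: real_rational_knot_def complex_injective_def)
      then obtain i j where "minor (curve_map d k v) (curve_map d k w) i j \<noteq> 0"
        using minor_zero_same_point nz vw by blast
      then show ?thesis by (auto simp: minor_curve_map separates_def)
    qed
  qed
next
  assume k: "(\<forall>i. degree (k $ i) \<le> d) \<and> (\<forall>v::real^2. on_quadric (curve_map d k v)) \<and>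
     (\<forall>v w::complex^2. v \<noteq> 0 \<longrightarrow> w \<noteq> 0 \<longrightarrow> separates d k v w)"
  then have nz: "\<And>v::complex^2. v \<noteq> 0 \<Longrightarrow> curve_map d k v \<noteq> 0"
    using separates_curve_map_nonzero by blast
  have "complex_injective d k"
    unfolding complex_injective_def
  proof (intro allI impI)
    fix v w :: "complex^2"
    assume vw: "v \<noteq> 0" "w \<noteq> 0" "same_point (curve_map d k v) (curve_map d k w)"
    then have "brk v w * bez d (k $ i) (k $ j) v w = 0" for i j
      using same_point_minor minor_curve_map by metis
    then have "brk v w = 0" using k vw unfolding separates_def by (metis mult_eq_0_iff)
    then show "same_point v w" using brk_eq_0 vw by blast
  qed
  moreover have "complex_immersion d k" using k complex_immersion_iff[OF nz] by blast
  ultimately show "real_rational_knot d k"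
    using k nz by (auto simp: real_rational_knot_def real_rational_curve_def)
qed

lemma minor_lin:
  "minor (lin T x) (lin T y) i j = (\<Sum>l\<in>UNIV. \<Sum>m\<in>UNIV. of_real (T $ i $ l * T $ j $ m) * minor x y l m)"
proof -
  have "lin T x $ i * lin T y $ j = (\<Sum>l\<in>UNIV. \<Sum>m\<in>UNIV. of_real (T $ i $ l * T $ j $ m) * (x $ l * y $ m))"
    by (simp add: lin_def sum_product mult_ac)
  moreover have "lin T x $ j * lin T y $ i = (\<Sum>l\<in>UNIV. \<Sum>m\<in>UNIV. of_real (T $ i $ l * T $ j $ m) * (x $ m * y $ l))"
    by (subst sum.swap) (simp add: lin_def sum_product mult_ac)
  ultimately show ?thesis
    by (simp add: minor_def sum_subtractf right_diff_distrib)
qed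

text \<open>The left inverse of \<open>T\<close> expresses the old Bezoutians linearly through the
  new ones, so a pair not separated by the new curve would have its image under \<open>M\<close> not
  separated by the old one.\<close>

lemma real_rational_knot_transform:
  assumes k: "real_rational_knot d k" and T: "T' ** T = mat 1" and M: "M' ** M = mat 1"
    and Q: "\<And>x. on_quadric x \<Longrightarrow> on_quadric (T *v x)"
  shows "real_rational_knot d (curve_lin T (curve_subst d M k))"
proof -
  define k' where "k' = curve_lin T (curve_subst d M k)"
  have cm: "curve_map d k' v = lin T (curve_map d k (lin M v))" for v :: "'a::real_field^2"
    by (simp add: k'_def curve_map_lin curve_map_subst)
  have detM: "det M \<noteq> 0"
    using det_mul[of M' M] M by auto
  have "degree (k' $ i) \<le> d" for i
    unfolding k'_def by (rule degree_curve_lin) (simp add: curve_subst_def degree_form_subst)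
  moreover have "on_quadric (curve_map d k' v)" for v :: "real^2"
    using k Q by (simp add: cm lin_real real_rational_knot_iff)
  moreover have "separates d k' v w" if vw: "v \<noteq> 0" "w \<noteq> 0" for v w :: "complex^2"
  proof (rule ccontr)
    assume neg: "\<not> separates d k' v w"
    have eq: "\<forall>v. of_real (det M) * bez d (k $ i) (k $ j) (lin M v) (lin M w) =
       (\<Sum>l\<in>UNIV. \<Sum>m\<in>UNIV. of_real (T' $ i $ l * T' $ j $ m) * bez d (k' $ l) (k' $ m) v w)" for i j
    proof (rule eq_by_brk_density[OF _ _ vw(2)])
      fix v :: "complex^2" assume v: "brk v w \<noteq> 0"
      have pull: "lin T' (curve_map d k' v) = curve_map d k (lin M v)" for v :: "complex^2"
        by (simp add: cm T flip: lin_mult)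
      have "brk v w * (of_real (det M) * bez d (k $ i) (k $ j) (lin M v) (lin M w))
          = minor (curve_map d k (lin M v)) (curve_map d k (lin M w)) i j"
        by (simp add: minor_curve_map brk_lin)
      also have "\<dots> = (\<Sum>l\<in>UNIV. \<Sum>m\<in>UNIV. of_real (T' $ i $ l * T' $ j $ m) * (brk v w * bez d (k' $ l) (k' $ m) v w))"
        unfolding pull[symmetric] minor_lin minor_curve_map by simp
      also have "\<dots> = brk v w * (\<Sum>l\<in>UNIV. \<Sum>m\<in>UNIV. of_real (T' $ i $ l * T' $ j $ m) * bez d (k' $ l) (k' $ m) v w)"
        by (simp add: sum_distrib_left mult_ac)
      finally show "of_real (det M) * bez d (k $ i) (k $ j) (lin M v) (lin M w) =
       (\<Sum>l\<in>UNIV. \<Sum>m\<in>UNIV. of_real (T' $ i $ l * T' $ j $ m) * bez d (k' $ l) (k' $ m) v w)"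
        using v by simp
    qed (intro continuous_intros continuous_on_bez)+
    have "bez d (k $ i) (k $ j) (lin M v) (lin M w) = 0" for i j
      using eq[of i j, THEN spec[of _ v]] neg detM by (simp add: separates_def)
    moreover have "lin M v \<noteq> 0" "lin M w \<noteq> 0" using vw lin_eq_0_iff[OF M] by auto
    ultimately show False using k unfolding real_rational_knot_iff separates_def by blast
  qed
  ultimately show ?thesis unfolding k'_def[symmetric] real_rational_knot_iff by blast
qed

subsection \<open>Products of curves\<close>

text \<open>The product is stored by real structure constants, so that one table defines it on real
  points, on complex points and, in \<open>curve_bil\<close>, on polynomials.\<close>

definition bil :: "(5 \<Rightarrow> 5 \<Rightarrow> 5 \<Rightarrow> real) \<Rightarrow> 'a::real_field ^ 5 \<Rightarrow> 'a ^ 5 \<Rightarrow> 'a ^ 5" where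
  "bil c x y = (\<chi> i. \<Sum>j\<in>UNIV. \<Sum>l\<in>UNIV. of_real (c i j l) * (x $ j * y $ l))"

definition curve_bil :: "(5 \<Rightarrow> 5 \<Rightarrow> 5 \<Rightarrow> real) \<Rightarrow> real poly ^ 5 \<Rightarrow> real poly ^ 5 \<Rightarrow> real poly ^ 5" where
  "curve_bil c k l = (\<chi> i. \<Sum>j\<in>UNIV. \<Sum>h\<in>UNIV. smult (c i j h) (k $ j * l $ h))"

lemma curve_map_bil:
  assumes "\<And>i. degree (k $ i) \<le> a" "\<And>i. degree (l $ i) \<le> b"
  shows "curve_map (a + b) (curve_bil c k l) v = bil c (curve_map a k v) (curve_map b l v)"
  by (simp add: curve_map_def curve_bil_def bil_def vec_eq_iff form_eval_sum form_eval_smult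
      form_eval_mult assms)

lemma degree_curve_bil:
  assumes "\<And>i. degree (k $ i) \<le> a" "\<And>i. degree (l $ i) \<le> b"
  shows "degree (curve_bil c k l $ i) \<le> a + b"
proof -
  have "degree (smult (c i j h) (k $ j * l $ h)) \<le> a + b" for j h
    using degree_smult_le[of "c i j h" "k $ j * l $ h"] degree_mult_le[of "k $ j" "l $ h"]
      assms(1)[of j] assms(2)[of h] by linarith
  then show ?thesis
    by (auto simp: curve_bil_def intro!: degree_sum_le)
qed

lemma bil_scale: "bil c (a *s x) (b *s y) = (a * b) *s bil c x y"
  by (simp add: bil_def vec_eq_iff sum_distrib_left mult_ac)

lemma bil_diff_left: "bil c (x - x') y = bil c x y - bil c x' y"
  by (simp add: bil_def vec_eq_iff algebra_simps sum_subtractf)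

lemma bil_diff_right: "bil c x (y - y') = bil c x y - bil c x y'"
  by (simp add: bil_def vec_eq_iff algebra_simps sum_subtractf)

lemma bil_swap: "bil (\<lambda>i j l. c i l j) y x = bil c x y"
  unfolding bil_def by (subst sum.swap) (simp add: mult_ac)

section \<open>Limits of points and of coefficients\<close>

lemma tendsto_bil [tendsto_intros]:
  fixes f g :: "'b \<Rightarrow> 'a::{real_normed_field} ^ 5"
  assumes "(f \<longlongrightarrow> x) F" "(g \<longlongrightarrow> y) F"
  shows "((\<lambda>t. bil c (f t) (g t)) \<longlongrightarrow> bil c x y) F"
  unfolding bil_def using assms by (intro tendsto_vec_lambda tendsto_intros)

lemma tendsto_curve_map [tendsto_intros]:
  fixes f :: "'b \<Rightarrow> 'a::{real_normed_field} ^ 2"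
  assumes "(f \<longlongrightarrow> x) F"
  shows "((\<lambda>t. curve_map d k (f t)) \<longlongrightarrow> curve_map d k x) F"
  unfolding curve_map_def form_eval_def using assms by (intro tendsto_vec_lambda tendsto_intros)

lemma tendsto_minor [tendsto_intros]:
  fixes f g :: "'b \<Rightarrow> 'a::real_normed_field ^ 'n"
  assumes "(f \<longlongrightarrow> x) F" "(g \<longlongrightarrow> y) F"
  shows "((\<lambda>t. minor (f t) (g t) i j) \<longlongrightarrow> minor x y i j) F"
  unfolding minor_def using assms by (intro tendsto_intros)

lemma tendsto_vector_2 [tendsto_intros]:
  fixes f g :: "'b \<Rightarrow> 'a::{topological_space,zero}"
  assumes "(f \<longlongrightarrow> x) F" "(g \<longlongrightarrow> y) F"
  shows "((\<lambda>t. vector [f t, g t] :: 'a ^ 2) \<longlongrightarrow> vector [x, y]) F"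
proof (rule vec_tendstoI)
  fix i :: 2
  show "((\<lambda>t. (vector [f t, g t] :: 'a ^ 2) $ i) \<longlongrightarrow> (vector [x, y] :: 'a ^ 2) $ i) F"
    using exhaust_2[of i] assms by auto
qed

definition coeffs_tendsto :: "('b \<Rightarrow> real poly) \<Rightarrow> real poly \<Rightarrow> 'b filter \<Rightarrow> bool" where
  "coeffs_tendsto f q F \<longleftrightarrow> (\<forall>p. ((\<lambda>x. coeff (f x) p) \<longlongrightarrow> coeff q p) F)"

lemma coeffs_tendsto_const: "coeffs_tendsto (\<lambda>x. q) q F"
  by (simp add: coeffs_tendsto_def)

lemma coeffs_tendsto_pCons:
  "(a \<longlongrightarrow> b) F \<Longrightarrow> coeffs_tendsto f q F \<Longrightarrow> coeffs_tendsto (\<lambda>x. pCons (a x) (f x)) (pCons b q) F"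
  by (auto simp: coeffs_tendsto_def coeff_pCons split: nat.split)

lemma coeffs_tendsto_mult:
  "coeffs_tendsto f q F \<Longrightarrow> coeffs_tendsto g r F \<Longrightarrow> coeffs_tendsto (\<lambda>x. f x * g x) (q * r) F"
  by (auto simp: coeffs_tendsto_def coeff_mult intro!: tendsto_intros)

lemma coeffs_tendsto_power: "coeffs_tendsto f q F \<Longrightarrow> coeffs_tendsto (\<lambda>x. f x ^ n) (q ^ n) F"
  by (induction n) (auto intro: coeffs_tendsto_const coeffs_tendsto_mult)

lemma coeffs_tendsto_smult: "coeffs_tendsto f q F \<Longrightarrow> coeffs_tendsto (\<lambda>x. smult a (f x)) (smult a q) F"
  by (auto simp: coeffs_tendsto_def intro!: tendsto_intros)

lemma coeffs_tendsto_sum: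
  "(\<And>i. i \<in> A \<Longrightarrow> coeffs_tendsto (f i) (q i) F) \<Longrightarrow> coeffs_tendsto (\<lambda>x. \<Sum>i\<in>A. f i x) (\<Sum>i\<in>A. q i) F"
  by (auto simp: coeffs_tendsto_def coeff_sum intro!: tendsto_intros)

subsection \<open>Gluing two complex curves\<close>

text \<open>The passage between the two ends of the neck. Its square is multiplication by \<delta>,
  so up to scalars it is an involution for nonzero \<delta>; at \<delta> = 0 it collapses almost
  everything to the base point [0 : 1].\<close>

definition neck_swap :: "real \<Rightarrow> real ^ 2 ^ 2" where
  "neck_swap \<delta> = vector [vector [0, \<delta>], vector [1, 0]]"

lemma lin_neck_swap: "lin (neck_swap \<delta>) v = vector [of_real \<delta> * v $ 2, v $ 1]"
  by (simp add: vec2_eq_iff lin_def neck_swap_def sum_2)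

definition glue :: "(5 \<Rightarrow> 5 \<Rightarrow> 5 \<Rightarrow> real) \<Rightarrow> nat \<Rightarrow> real poly ^ 5 \<Rightarrow> real poly ^ 5 \<Rightarrow> real \<Rightarrow> real poly ^ 5" where
  "glue c n k\<^sub>1 k\<^sub>2 \<delta> = curve_bil c k\<^sub>1 (curve_subst n (neck_swap \<delta>) k\<^sub>2)"

lemma coeffs_tendsto_glue:
  assumes "(\<delta> \<longlongrightarrow> \<delta>') F"
  shows "coeffs_tendsto (\<lambda>x. glue c n k\<^sub>1 k\<^sub>2 (\<delta> x) $ i) (glue c n k\<^sub>1 k\<^sub>2 \<delta>' $ i) F"
  using assms unfolding glue_def curve_bil_def curve_subst_def form_subst_def neck_swap_def
  by (auto intro!: coeffs_tendsto_sum coeffs_tendsto_smult coeffs_tendsto_mult coeffs_tendsto_power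
      coeffs_tendsto_pCons coeffs_tendsto_const)

text \<open>Projective points are represented on the unit sphere so that compactness
  applies.\<close>

lemma unit_multiples:
  fixes v :: "nat \<Rightarrow> complex^2"
  assumes "\<And>N. v N \<noteq> 0"
  obtains v' where "\<And>N. norm (v' N) = 1" "\<And>N. v' N = of_real (1 / norm (v N)) *s v N"
proof
  fix N
  have "of_real (1 / norm (v N)) *s v N = (1 / norm (v N)) *\<^sub>R v N"
    by (simp add: vec_eq_iff scaleR_conv_of_real[where 'a=complex])
  then show "norm (of_real (1 / norm (v N)) *s v N) = 1" using assms by simp
qed simp

locale gluing =
  fixes c :: "5 \<Rightarrow> 5 \<Rightarrow> 5 \<Rightarrow> real" and m n :: nat and k\<^sub>1 k\<^sub>2 :: "real poly ^ 5" and e :: "real ^ 5"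
  assumes knot1: "real_rational_knot m k\<^sub>1" and knot2: "real_rational_knot n k\<^sub>2"
    and unit_left: "\<And>x::complex^5. bil c (of_real_vec e) x = x"
    and unit_right: "\<And>x::complex^5. bil c x (of_real_vec e) = x"
    and base1: "curve_map m k\<^sub>1 (vector [0, 1] :: complex^2) = of_real_vec e"
    and base2: "curve_map n k\<^sub>2 (vector [0, 1] :: complex^2) = of_real_vec e"
    and disjoint: "\<And>v w :: complex^2. v \<noteq> 0 \<Longrightarrow> w \<noteq> 0 \<Longrightarrow>
      same_point (curve_map m k\<^sub>1 v) (curve_map n k\<^sub>2 w) \<Longrightarrow> same_point (curve_map m k\<^sub>1 v) (of_real_vec e)"
begin

text \<open>The assumptions are symmetric once the product is read in opposite order. Facts about
  the part of the curve near \<open>k\<^sub>1\<close> thus hold for the part near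
  \<open>k\<^sub>2\<close> by interpretation.\<close>

lemma gluing_op: "gluing (\<lambda>i j l. c i l j) n m k\<^sub>2 k\<^sub>1 e"
proof
  fix v w :: "complex^2"
  assume "v \<noteq> 0" "w \<noteq> 0" "same_point (curve_map n k\<^sub>2 v) (curve_map m k\<^sub>1 w)"
  then show "same_point (curve_map n k\<^sub>2 v) (of_real_vec e)"
    using disjoint[of w v] same_point_sym same_point_trans by blast
qed (use knot1 knot2 unit_left unit_right base1 base2 in \<open>auto simp: bil_swap[of c]\<close>)

abbreviation "k \<equiv> glue c n k\<^sub>1 k\<^sub>2"

lemma curve_map_glue:
  "curve_map (m + n) (k \<delta>) v = bil c (curve_map m k\<^sub>1 v) (curve_map n k\<^sub>2 (lin (neck_swap \<delta>) v))"
proof -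
  have "degree (k\<^sub>1 $ i) \<le> m" "degree (curve_subst n (neck_swap \<delta>) k\<^sub>2 $ i) \<le> n" for i
    using knot1 by (simp_all add: real_rational_knot_iff curve_subst_def degree_form_subst)
  then show ?thesis by (simp add: glue_def curve_map_bil curve_map_subst)
qed

lemma degree_glue: "degree (k \<delta> $ i) \<le> m + n"
  using knot1 unfolding glue_def real_rational_knot_iff
  by (intro degree_curve_bil) (auto simp: curve_subst_def degree_form_subst)

lemma curve_map_nonzero: "(v::complex^2) \<noteq> 0 \<Longrightarrow> curve_map m k\<^sub>1 v \<noteq> 0"
  using knot1 by (auto simp: real_rational_knot_def real_rational_curve_def)

lemma through_base:
  assumes "(v::complex^2) $ 1 = 0"
  shows "curve_map m k\<^sub>1 v = (v $ 2) ^ m *s of_real_vec e"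
proof -
  have "v = (v $ 2) *s vector [0, 1]" using assms by (simp add: vec2_eq_iff)
  then show ?thesis using base1 by (metis curve_map_scale)
qed

lemma meets_base_only:
  assumes "(v::complex^2) \<noteq> 0" "same_point (curve_map m k\<^sub>1 v) (of_real_vec e)"
  shows "v $ 1 = 0"
proof -
  have "same_point v (vector [0, 1])"
    using knot1 assms base1 unfolding real_rational_knot_def complex_injective_def
    by (metis vec2_neq_0_iff vector_2(2) zero_neq_one)
  then show ?thesis by (auto simp: same_point_def)
qed

text \<open>At \<delta> = 0 the second factor of the product is constantly the unit up to the scalar
  (v1)^n, so the degenerate curve is \<open>k\<^sub>1\<close> multiplied by that form. It still
  separates whatever \<open>k\<^sub>1\<close> separates, except at the base point.\<close>

lemma bez_glue_0:
  assumes "(w::complex^2) \<noteq> 0"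
  shows "bez (m + n) (k 0 $ i) (k 0 $ j) v w = (v $ 1 * w $ 1) ^ n * bez m (k\<^sub>1 $ i) (k\<^sub>1 $ j) v w"
proof -
  have K0: "curve_map (m + n) (k 0) v = (v $ 1) ^ n *s curve_map m k\<^sub>1 v" for v :: "complex^2"
  proof -
    interpret op: gluing "\<lambda>i j l. c i l j" n m k\<^sub>2 k\<^sub>1 e by (rule gluing_op)
    have "curve_map n k\<^sub>2 (lin (neck_swap 0) v) = (v $ 1) ^ n *s of_real_vec e"
      using op.through_base[of "lin (neck_swap 0) v"] by (simp add: lin_neck_swap)
    then show ?thesis
      using bil_scale[of c 1 "curve_map m k\<^sub>1 v" "(v $ 1) ^ n" "of_real_vec e"]
      by (simp add: curve_map_glue unit_right)
  qed
  have "\<forall>v. bez (m + n) (k 0 $ i) (k 0 $ j) v w = (v $ 1 * w $ 1) ^ n * bez m (k\<^sub>1 $ i) (k\<^sub>1 $ j) v w"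
  proof (rule eq_by_brk_density[OF _ _ assms])
    fix v :: "complex^2" assume v: "brk v w \<noteq> 0"
    have "brk v w * bez (m + n) (k 0 $ i) (k 0 $ j) v w
        = brk v w * ((v $ 1 * w $ 1) ^ n * bez m (k\<^sub>1 $ i) (k\<^sub>1 $ j) v w)"
      unfolding minor_curve_map[symmetric] K0 minor_scale
      by (simp add: minor_curve_map power_mult_distrib)
    then show "bez (m + n) (k 0 $ i) (k 0 $ j) v w = (v $ 1 * w $ 1) ^ n * bez m (k\<^sub>1 $ i) (k\<^sub>1 $ j) v w"
      using v by simp
  qed (intro continuous_intros continuous_on_bez)+
  then show ?thesis by blast
qed

text \<open>In the coordinate at the other end of the neck the glued curve is the oppositely glued
  one, up to the scalar \<delta>^m. Bad pairs are therefore carried to bad pairs.\<close>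

lemma separates_glue_op:
  fixes v w :: "complex^2"
  assumes "w \<noteq> 0" "\<delta> \<noteq> 0" "\<not> separates (m + n) (k \<delta>) v w"
  shows "\<not> separates (n + m) (glue (\<lambda>i j l. c i l j) m k\<^sub>2 k\<^sub>1 \<delta>) (lin (neck_swap \<delta>) v) (lin (neck_swap \<delta>) w)"
proof -
  interpret op: gluing "\<lambda>i j l. c i l j" n m k\<^sub>2 k\<^sub>1 e by (rule gluing_op)
  have dbl: "lin (neck_swap \<delta>) (lin (neck_swap \<delta>) v) = of_real \<delta> *s v" for v :: "complex^2"
    by (simp add: lin_neck_swap vec2_eq_iff)
  have Kop: "curve_map (n + m) (op.k \<delta>) (lin (neck_swap \<delta>) v) = of_real \<delta> ^ m *s curve_map (m + n) (k \<delta>) v"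
    for v :: "complex^2"
    using bil_scale[of c "of_real \<delta> ^ m" "curve_map m k\<^sub>1 v" 1]
    by (simp add: op.curve_map_glue curve_map_glue bil_swap[of c] dbl curve_map_scale)
  have det: "det (neck_swap \<delta>) = - \<delta>" by (simp add: neck_swap_def det_2)
  have eq: "\<forall>v. of_real (- \<delta>) * bez (n + m) (op.k \<delta> $ i) (op.k \<delta> $ j) (lin (neck_swap \<delta>) v) (lin (neck_swap \<delta>) w)
     = of_real \<delta> ^ (2 * m) * bez (m + n) (k \<delta> $ i) (k \<delta> $ j) v w" for i j
  proof (rule eq_by_brk_density[OF _ _ assms(1)])
    fix v :: "complex^2" assume v: "brk v w \<noteq> 0"
    have "brk v w * (of_real (- \<delta>) * bez (n + m) (op.k \<delta> $ i) (op.k \<delta> $ j) (lin (neck_swap \<delta>) v) (lin (neck_swap \<delta>) w))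
       = minor (curve_map (n + m) (op.k \<delta>) (lin (neck_swap \<delta>) v)) (curve_map (n + m) (op.k \<delta>) (lin (neck_swap \<delta>) w)) i j"
      unfolding minor_curve_map brk_lin det by simp
    also have "\<dots> = brk v w * (of_real \<delta> ^ (2 * m) * bez (m + n) (k \<delta> $ i) (k \<delta> $ j) v w)"
      unfolding Kop minor_scale minor_curve_map by (simp add: mult_2 power_add)
    finally show "of_real (- \<delta>) * bez (n + m) (op.k \<delta> $ i) (op.k \<delta> $ j) (lin (neck_swap \<delta>) v) (lin (neck_swap \<delta>) w)
     = of_real \<delta> ^ (2 * m) * bez (m + n) (k \<delta> $ i) (k \<delta> $ j) v w" using v by (metis mult_left_cancel)
  qed (intro continuous_intros continuous_on_bez)+
  show ?thesis
    using eq[THEN spec[of _ v]] assms(2,3) by (simp add: separates_def)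
qed

text \<open>One limit lies on \<open>k\<^sub>1\<close> away from p. The other one lies there as
  well, contradicting that \<open>k\<^sub>1\<close> is a knot, or it is seen at a point of
  \<open>k\<^sub>2\<close> through the neck coordinate \<open>u\<close>, contradicting
  disjointness.\<close>

lemma limit_away_from_base:
  fixes v w u :: "nat \<Rightarrow> complex^2"
  assumes \<delta>: "\<delta> \<longlonglongrightarrow> 0" and v: "v \<longlonglongrightarrow> \<alpha>" and w: "w \<longlonglongrightarrow> \<alpha>'" and u: "u \<longlonglongrightarrow> \<beta>'"
    and us: "\<And>N. u N = s N *s lin (neck_swap (\<delta> N)) (w N)"
    and nz: "\<alpha> $ 1 \<noteq> 0" "\<alpha>' \<noteq> 0" "\<beta>' \<noteq> 0"
    and bad: "\<And>N. \<not> separates (m + n) (k (\<delta> N)) (v N) (w N)"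
  shows False
proof (cases "\<alpha>' $ 1 = 0")
  case False
  \<comment> \<open>Neither limit is at the base point, so the factor in \<open>bez_glue_0\<close>
    is nonzero and failure passes to \<open>k\<^sub>1\<close> itself.\<close>
  have "bez (m + n) (k 0 $ i) (k 0 $ j) \<alpha> \<alpha>' = 0" for i j
  proof -
    have "(\<lambda>N. bez (m + n) (k (\<delta> N) $ i) (k (\<delta> N) $ j) (v N) (w N)) \<longlonglongrightarrow> bez (m + n) (k 0 $ i) (k 0 $ j) \<alpha> \<alpha>'"
      using coeffs_tendsto_glue[OF \<delta>] by (intro tendsto_bez v w) (auto simp: coeffs_tendsto_def)
    then show ?thesis using bad by (simp add: separates_def LIMSEQ_const_iff)
  qed
  then have "\<not> separates m k\<^sub>1 \<alpha> \<alpha>'"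
    using bez_glue_0[OF nz(2)] nz(1) False by (auto simp: separates_def)
  moreover have "\<alpha> \<noteq> 0" using nz(1) by auto
  ultimately show False using knot1 nz(2) by (auto simp: real_rational_knot_iff)
next
  case True
  interpret op: gluing "\<lambda>i j l. c i l j" n m k\<^sub>2 k\<^sub>1 e by (rule gluing_op)
  have Kv: "(\<lambda>N. curve_map (m + n) (k (\<delta> N)) (v N)) \<longlonglongrightarrow> (\<alpha> $ 1) ^ n *s curve_map m k\<^sub>1 \<alpha>"
  proof -
    have "(\<lambda>N. curve_map (m + n) (k (\<delta> N)) (v N)) \<longlonglongrightarrow>
        bil c (curve_map m k\<^sub>1 \<alpha>) (curve_map n k\<^sub>2 (vector [of_real 0 * \<alpha> $ 2, \<alpha> $ 1]))"
      unfolding curve_map_glue lin_neck_swap by (intro tendsto_intros v \<delta>)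
    also have "curve_map n k\<^sub>2 (vector [of_real 0 * \<alpha> $ 2, \<alpha> $ 1]) = (\<alpha> $ 1) ^ n *s of_real_vec e"
      by (subst op.through_base) simp_all
    also have "bil c (curve_map m k\<^sub>1 \<alpha>) \<dots> = (\<alpha> $ 1) ^ n *s curve_map m k\<^sub>1 \<alpha>"
      using bil_scale[of c 1 "curve_map m k\<^sub>1 \<alpha>" "(\<alpha> $ 1) ^ n" "of_real_vec e"] by (simp add: unit_right)
    finally show ?thesis .
  qed
  \<comment> \<open>Without rescaling the limit at the second point could be the zero vector. The
    factor \<open>s N ^ n\<close> turns the argument of \<open>k\<^sub>2\<close> into the normalised
    \<open>u N\<close>.\<close>
  have Kw: "(\<lambda>N. s N ^ n *s curve_map (m + n) (k (\<delta> N)) (w N)) \<longlonglongrightarrow> (\<alpha>' $ 2) ^ m *s curve_map n k\<^sub>2 \<beta>'"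
  proof -
    have "s N ^ n *s curve_map (m + n) (k (\<delta> N)) (w N) = bil c (curve_map m k\<^sub>1 (w N)) (curve_map n k\<^sub>2 (u N))" for N
      using bil_scale[of c 1 "curve_map m k\<^sub>1 (w N)" "s N ^ n"]
      by (simp add: us curve_map_scale curve_map_glue)
    moreover have "(\<lambda>N. bil c (curve_map m k\<^sub>1 (w N)) (curve_map n k\<^sub>2 (u N))) \<longlonglongrightarrow>
       bil c (curve_map m k\<^sub>1 \<alpha>') (curve_map n k\<^sub>2 \<beta>')"
      by (intro tendsto_intros u w)
    moreover have "bil c (curve_map m k\<^sub>1 \<alpha>') (curve_map n k\<^sub>2 \<beta>') = (\<alpha>' $ 2) ^ m *s curve_map n k\<^sub>2 \<beta>'"
      using bil_scale[of c "(\<alpha>' $ 2) ^ m" "of_real_vec e" 1 "curve_map n k\<^sub>2 \<beta>'"]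
      by (simp add: through_base[OF True] unit_left)
    ultimately show ?thesis by simp
  qed
  have "minor ((\<alpha> $ 1) ^ n *s curve_map m k\<^sub>1 \<alpha>) ((\<alpha>' $ 2) ^ m *s curve_map n k\<^sub>2 \<beta>') i j = 0" for i j
  proof -
    have "minor (curve_map (m + n) (k (\<delta> N)) (v N)) (s N ^ n *s curve_map (m + n) (k (\<delta> N)) (w N)) i j = 0" for N
      using bad[of N] minor_scale[of 1 "curve_map (m + n) (k (\<delta> N)) (v N)" "s N ^ n"]
      by (simp add: minor_curve_map separates_def)
    then show ?thesis using tendsto_minor[OF Kv Kw, of i j] by (simp add: LIMSEQ_const_iff)
  qed
  moreover have "\<alpha>' $ 2 \<noteq> 0" using True nz(2) by (auto simp: vec2_neq_0_iff)
  ultimately have "minor (curve_map m k\<^sub>1 \<alpha>) (curve_map n k\<^sub>2 \<beta>') i j = 0" for i j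
    using nz(1) by (simp add: minor_scale)
  moreover have \<alpha>0: "\<alpha> \<noteq> 0" using nz(1) by auto
  ultimately have "same_point (curve_map m k\<^sub>1 \<alpha>) (curve_map n k\<^sub>2 \<beta>')"
    using minor_zero_same_point curve_map_nonzero op.curve_map_nonzero nz(3) by blast
  then have "\<alpha> $ 1 = 0"
    using disjoint[OF \<alpha>0 nz(3)] meets_base_only[OF \<alpha>0] by blast
  then show False using nz(1) by simp
qed

end

section \<open>Divided differences\<close>

definition form_dq :: "nat \<Rightarrow> real poly \<Rightarrow> 'a::real_field \<Rightarrow> 'a \<Rightarrow> 'a" where
  "form_dq d q a b = (\<Sum>p\<le>d. of_real (coeff q p) * (\<Sum>i<p. b ^ (p - Suc i) * a ^ i))"

definition curve_dq :: "nat \<Rightarrow> real poly ^ 5 \<Rightarrow> 'a::real_field \<Rightarrow> 'a \<Rightarrow> 'a ^ 5" where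
  "curve_dq d k a b = (\<chi> i. form_dq d (k $ i) a b)"

text \<open>The divided difference is polynomial in both arguments, hence continuous across the
  diagonal, where it is the derivative.\<close>

lemma curve_dq: "curve_map d k (vector [a, 1]) - curve_map d k (vector [b, 1]) = (a - b) *s curve_dq d k a b"
proof -
  have "form_eval d q (vector [a, 1]) - form_eval d q (vector [b, 1]) = (a - b) * form_dq d q a b" for q
    unfolding form_dq_def form_eval_def sum_distrib_left[of "a - b"] sum_subtractf[symmetric]
    by (intro sum.cong refl)
       (simp add: mult.left_commute[of "a - b"] flip: power_diff_sumr2 right_diff_distrib)
  then show ?thesis by (simp add: vec_eq_iff curve_map_def curve_dq_def flip: left_diff_distrib)
qed

lemma tendsto_curve_dq [tendsto_intros]:
  fixes f g :: "'b \<Rightarrow> 'a::real_normed_field"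
  assumes "(f \<longlongrightarrow> x) F" "(g \<longlongrightarrow> y) F"
  shows "((\<lambda>t. curve_dq d k (f t) (g t)) \<longlongrightarrow> curve_dq d k x y) F"
  unfolding curve_dq_def form_dq_def using assms by (intro tendsto_vec_lambda tendsto_intros)

lemma minor_diff: "minor x y i j = minor (x - y) y i j"
  by (simp add: minor_def algebra_simps)

lemma minor_add_left: "minor (x + x') y i j = minor x y i j + minor x' y i j"
  by (simp add: minor_def algebra_simps)

lemma minor_scale_left: "minor (a *s x) y i j = a * minor x y i j"
  by (simp add: minor_def algebra_simps)

text \<open>Away from u = 0 both sides are the same minor divided by u, since subtracting
  \<open>e\<close> from a row does not change a minor with \<open>e\<close>; let u tend to
  0.\<close>

lemma bez_at_base:
  fixes e :: "'a::real_normed_field ^ 5"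
  assumes "curve_map m k (vector [0, 1]) = e"
  shows "bez m (k $ i) (k $ j) (vector [0, 1]) (vector [0, 1]) = minor (curve_dq m k 0 0) e i j"
proof -
  have L: "((\<lambda>u. bez m (k $ i) (k $ j) (vector [u, 1]) (vector [0, 1])) \<longlongrightarrow>
      bez m (k $ i) (k $ j) (vector [0, 1]) (vector [0, 1 :: 'a])) (at 0)"
    by (intro tendsto_bez tendsto_intros)
  have R: "((\<lambda>u. minor (curve_dq m k u 0) e i j) \<longlongrightarrow> minor (curve_dq m k 0 0) e i j) (at (0::'a))"
    by (intro tendsto_intros)
  have "bez m (k $ i) (k $ j) (vector [u, 1]) (vector [0, 1]) = minor (curve_dq m k u 0) e i j"
    if "u \<noteq> 0" for u :: 'a
  proof -
    have "u * bez m (k $ i) (k $ j) (vector [u, 1]) (vector [0, 1 :: 'a])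
        = minor (curve_map m k (vector [u, 1])) (curve_map m k (vector [0, 1])) i j"
      by (simp add: minor_curve_map brk_def)
    also have "\<dots> = u * minor (curve_dq m k u 0) e i j"
      using curve_dq[of m k u 0] by (subst minor_diff) (simp add: minor_scale_left assms)
    finally show ?thesis using that by simp
  qed
  then have "\<forall>\<^sub>F u :: 'a in at 0. bez m (k $ i) (k $ j) (vector [u, 1]) (vector [0, 1]) = minor (curve_dq m k u 0) e i j"
    by (simp add: eventually_at_filter)
  then show ?thesis
    using tendsto_unique[OF trivial_limit_at Lim_transform_eventually[OF L] R] by blast
qed

section \<open>The glued curve near the node\<close>

context gluing
begin

text \<open>\<open>neck_F\<close> is the surface through the node, in affine coordinates on both
  curves; \<open>neck_P\<close> and \<open>neck_Q\<close> are its divided differences along the path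
  from (a', b') to (a', b) to (a, b).\<close>

definition "neck_P a b a' b' = bil c (curve_dq m k\<^sub>1 a a' :: complex^5) (curve_map n k\<^sub>2 (vector [b, 1]))"
definition "neck_Q a b a' b' = bil c (curve_map m k\<^sub>1 (vector [a', 1])) (curve_dq n k\<^sub>2 b b' :: complex^5)"
definition "neck_F a b = bil c (curve_map m k\<^sub>1 (vector [a, 1])) (curve_map n k\<^sub>2 (vector [b, 1 :: complex]))"

lemma neck_F_diff: "neck_F a b - neck_F a' b' = (a - a') *s neck_P a b a' b' + (b - b') *s neck_Q a b a' b'"
proof -
  have "neck_F a b - neck_F a' b' =
      bil c (curve_map m k\<^sub>1 (vector [a, 1]) - curve_map m k\<^sub>1 (vector [a', 1])) (curve_map n k\<^sub>2 (vector [b, 1]))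
    + bil c (curve_map m k\<^sub>1 (vector [a', 1])) (curve_map n k\<^sub>2 (vector [b, 1]) - curve_map n k\<^sub>2 (vector [b', 1]))"
    by (simp add: neck_F_def bil_diff_left bil_diff_right)
  then show ?thesis
    unfolding curve_dq neck_P_def neck_Q_def
    using bil_scale[of c "a - a'" _ 1] bil_scale[of c 1 _ "b - b'"] by simp
qed

lemma curve_map_neck:
  assumes "a \<noteq> 0"
  shows "curve_map (m + n) (k \<delta>) (vector [a, 1]) = a ^ n *s neck_F a (of_real \<delta> / a)"
proof -
  have "lin (neck_swap \<delta>) (vector [a, 1]) = a *s vector [of_real \<delta> / a, 1]"
    using assms by (simp add: lin_neck_swap vec2_eq_iff)
  then show ?thesis
    using bil_scale[of c 1 "curve_map m k\<^sub>1 (vector [a, 1])" "a ^ n"]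
    by (simp add: curve_map_glue neck_F_def curve_map_scale)
qed

text \<open>The (i, j) minor of the two difference vectors after each has been reduced modulo
  \<open>neck_F a' b'\<close> in the chart of coordinate 0. At the origin it tests the independence
  of the two tangents.\<close>

definition "neck_det a b a' b' i j =
  minor (neck_P a b a' b') (neck_F a' b') i 0 * minor (neck_Q a b a' b') (neck_F a' b') j 0
  - minor (neck_P a b a' b') (neck_F a' b') j 0 * minor (neck_Q a b a' b') (neck_F a' b') i 0"

text \<open>The curve is the slice a * b = \<delta>, along which b - b' = - (a - a') \<delta> / (a
  a'). Cancelling a - a' gives the formula off the diagonal, and continuity in \<open>a\<close>
  extends it.\<close>

lemma bez_neck:
  fixes a a' :: complex and \<delta> :: real
  assumes nz: "a \<noteq> 0" "a' \<noteq> 0"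
  defines "b \<equiv> of_real \<delta> / a" and "b' \<equiv> of_real \<delta> / a'"
  shows "bez (m + n) (k \<delta> $ i) (k \<delta> $ j) (vector [a, 1]) (vector [a', 1]) =
    (a * a') ^ n * (minor (neck_P a b a' b') (neck_F a' b') i j
       - of_real \<delta> / (a * a') * minor (neck_Q a b a' b') (neck_F a' b') i j)"
proof -
  define R where "R a = (a * a') ^ n * (minor (neck_P a (of_real \<delta> / a) a' b') (neck_F a' b') i j
       - of_real \<delta> / (a * a') * minor (neck_Q a (of_real \<delta> / a) a' b') (neck_F a' b') i j)" for a
  define L where "L a = bez (m + n) (k \<delta> $ i) (k \<delta> $ j) (vector [a, 1]) (vector [a', 1])" for a :: complex
  have eq: "L a = R a" if a: "a \<noteq> a'" "a \<noteq> 0" for a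
  proof -
    have "(a - a') * L a = minor (curve_map (m + n) (k \<delta>) (vector [a, 1])) (curve_map (m + n) (k \<delta>) (vector [a', 1])) i j"
      by (simp add: L_def minor_curve_map brk_def)
    also have "\<dots> = (a * a') ^ n * minor (neck_F a (of_real \<delta> / a) - neck_F a' b') (neck_F a' b') i j"
      using a nz by (simp add: curve_map_neck minor_scale b'_def power_mult_distrib flip: minor_diff)
    also have "\<dots> = (a * a') ^ n * ((a - a') * minor (neck_P a (of_real \<delta> / a) a' b') (neck_F a' b') i j
        + (of_real \<delta> / a - b') * minor (neck_Q a (of_real \<delta> / a) a' b') (neck_F a' b') i j)"
      by (simp only: neck_F_diff minor_add_left minor_scale_left)
    also have "of_real \<delta> / a - b' = - ((a - a') * (of_real \<delta> / (a * a')))"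
      using a nz by (simp add: b'_def field_simps)
    finally have "(a - a') * L a = (a - a') * R a" by (simp add: R_def algebra_simps)
    then show ?thesis using a by simp
  qed
  have "L a = R a"
  proof (cases "a = a'")
    case True
    have L: "(L \<longlongrightarrow> L a') (at a')"
      unfolding L_def by (intro tendsto_bez tendsto_intros)
    have R: "(R \<longlongrightarrow> R a') (at a')"
      unfolding R_def neck_P_def neck_Q_def using nz by (intro tendsto_intros) auto
    have "\<forall>\<^sub>F a in at a'. L a = R a"
    proof -
      have "\<forall>\<^sub>F a in at a'. a \<noteq> (0::complex)"
        using nz(2) tendsto_imp_eventually_ne[OF tendsto_ident_at] by blast
      moreover have "\<forall>\<^sub>F a in at a'. a \<noteq> a'" by (simp add: eventually_at_filter)
      ultimately show ?thesis by eventually_elim (use eq in blast)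
    qed
    then have "L a' = R a'"
      using tendsto_unique[OF trivial_limit_at Lim_transform_eventually[OF L] R] by blast
    then show ?thesis using True by simp
  qed (use eq nz in blast)
  then show ?thesis unfolding L_def R_def b_def .
qed

text \<open>A bad pair makes the reduced vectors of \<open>neck_P\<close> and \<open>neck_Q\<close>
  proportional with the single factor \<open>\<rho>\<close>. That factor may be unbounded as the
  pair approaches the node; the determinant vanishes whatever it is, and this statement survives the
  limit.\<close>

lemma neck_det_0:
  fixes a a' :: complex and \<delta> :: real
  assumes nz: "a \<noteq> 0" "a' \<noteq> 0"
    and bad: "\<not> separates (m + n) (k \<delta>) (vector [a, 1]) (vector [a', 1 :: complex])"
  shows "neck_det a (of_real \<delta> / a) a' (of_real \<delta> / a') i j = 0"
proof -
  define \<rho> where "\<rho> = of_real \<delta> / (a * a')"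
  have "minor (neck_P a (of_real \<delta> / a) a' (of_real \<delta> / a')) (neck_F a' (of_real \<delta> / a')) i j
     = \<rho> * minor (neck_Q a (of_real \<delta> / a) a' (of_real \<delta> / a')) (neck_F a' (of_real \<delta> / a')) i j" for i j
    using bez_neck[OF nz, of \<delta> i j] bad nz by (simp add: separates_def \<rho>_def)
  then show ?thesis by (simp add: neck_det_def)
qed

text \<open>All four normalised points tend to [0 : 1], so the affine coordinates a and b on the two
  curves tend to 0 while their product is \<delta>. The vanishing determinants then converge to the
  one at the origin.\<close>

lemma limit_at_neck:
  fixes v w u u' :: "nat \<Rightarrow> complex^2"
  assumes v: "v \<longlonglongrightarrow> \<alpha>" and w: "w \<longlonglongrightarrow> \<alpha>'" and u: "u \<longlonglongrightarrow> \<beta>" and u': "u' \<longlonglongrightarrow> \<beta>'"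
    and us: "\<And>N. u N = s N *s lin (neck_swap (\<delta> N)) (v N)"
    and us': "\<And>N. u' N = s' N *s lin (neck_swap (\<delta> N)) (w N)"
    and z: "\<alpha> $ 1 = 0" "\<alpha>' $ 1 = 0" "\<beta> $ 1 = 0" "\<beta>' $ 1 = 0"
    and nz: "\<alpha> \<noteq> 0" "\<alpha>' \<noteq> 0" "\<beta> \<noteq> 0" "\<beta>' \<noteq> 0"
    and bad: "\<And>N. \<not> separates (m + n) (k (\<delta> N)) (v N) (w N)"
  shows "neck_det 0 0 0 0 i j = 0"
proof -
  have ev: "\<forall>\<^sub>F N in sequentially. v N $ 1 \<noteq> 0 \<and> v N $ 2 \<noteq> 0 \<and> u N $ 1 / u N $ 2 = of_real (\<delta> N) / (v N $ 1 / v N $ 2)"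
    and lim: "(\<lambda>N. v N $ 1 / v N $ 2) \<longlonglongrightarrow> 0" "(\<lambda>N. u N $ 1 / u N $ 2) \<longlonglongrightarrow> 0"
    if v: "v \<longlonglongrightarrow> \<alpha>" and u: "u \<longlonglongrightarrow> \<beta>" and us: "\<And>N. u N = s N *s lin (neck_swap (\<delta> N)) (v N)"
      and z: "\<alpha> $ 1 = 0" "\<beta> $ 1 = 0" and nz: "\<alpha> \<noteq> 0" "\<beta> \<noteq> 0" for v u :: "nat \<Rightarrow> complex^2" and \<alpha> \<beta> s
  proof -
    have n2: "\<alpha> $ 2 \<noteq> 0" "\<beta> $ 2 \<noteq> 0" using z nz by (auto simp: vec2_neq_0_iff)
    have lv: "(\<lambda>N. v N $ i) \<longlonglongrightarrow> \<alpha> $ i" and lu: "(\<lambda>N. u N $ i) \<longlonglongrightarrow> \<beta> $ i" for i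
      by (intro tendsto_vec_nth v u)+
    have "\<forall>\<^sub>F N in sequentially. v N $ 2 \<noteq> 0" "\<forall>\<^sub>F N in sequentially. u N $ 2 \<noteq> 0"
      using tendsto_imp_eventually_ne[OF lv n2(1)] tendsto_imp_eventually_ne[OF lu n2(2)] by auto
    then show "\<forall>\<^sub>F N in sequentially. v N $ 1 \<noteq> 0 \<and> v N $ 2 \<noteq> 0 \<and> u N $ 1 / u N $ 2 = of_real (\<delta> N) / (v N $ 1 / v N $ 2)"
    proof eventually_elim
      case (elim N)
      then show ?case using us[of N] by (auto simp: lin_neck_swap)
    qed
    show "(\<lambda>N. v N $ 1 / v N $ 2) \<longlonglongrightarrow> 0" "(\<lambda>N. u N $ 1 / u N $ 2) \<longlonglongrightarrow> 0"
      using tendsto_divide[OF lv[of 1] lv[of 2] n2(1)] tendsto_divide[OF lu[of 1] lu[of 2] n2(2)] z by simp_all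
  qed
  define D where "D N = neck_det (v N $ 1 / v N $ 2) (u N $ 1 / u N $ 2) (w N $ 1 / w N $ 2) (u' N $ 1 / u' N $ 2) i j" for N
  have D: "D \<longlonglongrightarrow> neck_det 0 0 0 0 i j"
    unfolding D_def neck_det_def neck_P_def neck_Q_def neck_F_def
    by (intro tendsto_intros lim[OF v u us z(1,3) nz(1,3)] lim[OF w u' us' z(2,4) nz(2,4)])
  have "\<forall>\<^sub>F N in sequentially. D N = 0"
    using ev[OF v u us z(1,3) nz(1,3)] ev[OF w u' us' z(2,4) nz(2,4)]
  proof eventually_elim
    case (elim N)
    define a a' where "a = v N $ 1 / v N $ 2" and "a' = w N $ 1 / w N $ 2"
    have vw: "v N = (v N $ 2) *s vector [a, 1]" "w N = (w N $ 2) *s vector [a', 1]"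
      using elim by (simp_all add: vec2_eq_iff a_def a'_def)
    have "(vector [a', 1] :: complex^2) \<noteq> 0" by (simp add: vec2_neq_0_iff)
    then have "\<not> separates (m + n) (k (\<delta> N)) (vector [a, 1]) (vector [a', 1 :: complex])"
      using bad[of N] elim separates_scale[of "vector [a', 1]" "v N $ 2" "w N $ 2" "m + n" "k (\<delta> N)" "vector [a, 1]"] vw
      by metis
    then have "neck_det a (of_real (\<delta> N) / a) a' (of_real (\<delta> N) / a') i j = 0"
      using neck_det_0[of a a'] elim by (simp add: a_def a'_def)
    then show ?case using elim by (simp add: D_def a_def a'_def)
  qed
  then have "(\<lambda>N. 0) \<longlonglongrightarrow> neck_det 0 0 0 0 i j"
    by (rule Lim_transform_eventually[OF D])
  then show ?thesis by (simp add: LIMSEQ_const_iff)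
qed

text \<open>At the origin one factor of each product is the unit \<open>e\<close>, so the two
  differences become the velocities of \<open>k\<^sub>1\<close> and of
  \<open>k\<^sub>2\<close>.\<close>

lemma neck_det_base:
  assumes "e $ 0 = 1"
  shows "neck_det 0 0 0 0 i j = of_real
    (bez m (k\<^sub>1 $ i) (k\<^sub>1 $ 0) (vector [0, 1]) (vector [0, 1]) * bez n (k\<^sub>2 $ j) (k\<^sub>2 $ 0) (vector [0, 1]) (vector [0, 1])
     - bez m (k\<^sub>1 $ j) (k\<^sub>1 $ 0) (vector [0, 1]) (vector [0, 1]) * bez n (k\<^sub>2 $ i) (k\<^sub>2 $ 0) (vector [0, 1]) (vector [0, 1]))"
proof -
  have v: "(vector [0, 1] :: complex^2) = of_real_vec (vector [0, 1])" by (simp add: vec2_eq_iff)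
  show ?thesis
    unfolding neck_det_def neck_P_def neck_Q_def neck_F_def base1 base2 unit_left unit_right
    by (simp add: bez_at_base[OF base1, symmetric] bez_at_base[OF base2, symmetric])
       (simp add: v bez_of_real)
qed

theorem separates_glue:
  assumes e0: "e $ 0 = 1"
    and indep: "bez m (k\<^sub>1 $ i) (k\<^sub>1 $ 0) (vector [0, 1]) (vector [0, 1 :: real]) * bez n (k\<^sub>2 $ j) (k\<^sub>2 $ 0) (vector [0, 1]) (vector [0, 1])
     \<noteq> bez m (k\<^sub>1 $ j) (k\<^sub>1 $ 0) (vector [0, 1]) (vector [0, 1]) * bez n (k\<^sub>2 $ i) (k\<^sub>2 $ 0) (vector [0, 1]) (vector [0, 1])"
  shows "\<exists>\<delta>\<^sub>0>0. \<forall>\<delta>. \<delta> \<noteq> 0 \<and> \<bar>\<delta>\<bar> < \<delta>\<^sub>0 \<longrightarrow> (\<forall>v w :: complex^2. v \<noteq> 0 \<longrightarrow> w \<noteq> 0 \<longrightarrow> separates (m + n) (k \<delta>) v w)"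
proof (rule ccontr)
  interpret op: gluing "\<lambda>i j l. c i l j" n m k\<^sub>2 k\<^sub>1 e by (rule gluing_op)
  assume "\<not> ?thesis"
  then have "\<exists>\<delta> v w. \<delta> \<noteq> 0 \<and> \<bar>\<delta>\<bar> < 1 / real (Suc N) \<and> (v::complex^2) \<noteq> 0 \<and> (w::complex^2) \<noteq> 0 \<and> \<not> separates (m + n) (k \<delta>) v w" for N
    by (metis of_nat_0_less_iff zero_less_Suc zero_less_divide_1_iff)
  then obtain \<delta> v\<^sub>0 w\<^sub>0 where \<delta>nz: "\<And>N. \<delta> N \<noteq> 0" and \<delta>: "\<And>N. \<bar>\<delta> N\<bar> < 1 / real (Suc N)"
    and nz0: "\<And>N. (v\<^sub>0 N::complex^2) \<noteq> 0" "\<And>N. (w\<^sub>0 N::complex^2) \<noteq> 0"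
    and bad0: "\<And>N. \<not> separates (m + n) (k (\<delta> N)) (v\<^sub>0 N) (w\<^sub>0 N)"
    by metis
  have \<delta>0: "\<delta> \<longlonglongrightarrow> 0"
    by (rule tendsto_rabs_zero_cancel, rule tendsto_sandwich[OF _ _ tendsto_const LIMSEQ_Suc[OF lim_1_over_n]])
       (use \<delta> in \<open>auto intro: less_imp_le always_eventually\<close>)
  obtain v where v: "\<And>N. norm (v N) = 1" "\<And>N. v N = of_real (1 / norm (v\<^sub>0 N)) *s v\<^sub>0 N"
    using unit_multiples[of v\<^sub>0] nz0 by blast
  obtain w where w: "\<And>N. norm (w N) = 1" "\<And>N. w N = of_real (1 / norm (w\<^sub>0 N)) *s w\<^sub>0 N"
    using unit_multiples[of w\<^sub>0] nz0 by blast
  have Jnz: "lin (neck_swap (\<delta> N)) x \<noteq> 0" if "x \<noteq> 0" for N and x :: "complex^2"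
    using that \<delta>nz[of N] by (auto simp: lin_neck_swap vec2_neq_0_iff)
  have vw_nz: "v N \<noteq> 0" "w N \<noteq> 0" for N using v(1)[of N] w(1)[of N] by auto
  \<comment> \<open>The swap becomes singular as \<delta> tends to 0, so the position seen from
    \<open>k\<^sub>2\<close> is not determined by the limit of \<open>v\<close>. It is normalised
    separately and receives a limit of its own.\<close>
  obtain u where u: "\<And>N. norm (u N) = 1" "\<And>N. u N = of_real (1 / norm (lin (neck_swap (\<delta> N)) (v N))) *s lin (neck_swap (\<delta> N)) (v N)"
    using unit_multiples[of "\<lambda>N. lin (neck_swap (\<delta> N)) (v N)"] Jnz vw_nz by blast
  obtain u' where u': "\<And>N. norm (u' N) = 1" "\<And>N. u' N = of_real (1 / norm (lin (neck_swap (\<delta> N)) (w N))) *s lin (neck_swap (\<delta> N)) (w N)"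
    using unit_multiples[of "\<lambda>N. lin (neck_swap (\<delta> N)) (w N)"] Jnz vw_nz by blast
  have bad: "\<not> separates (m + n) (k (\<delta> N)) (v N) (w N)" for N
    using bad0[of N] nz0 separates_scale[OF nz0(2)] v(2) w(2) by simp
  have bad_op: "\<not> separates (n + m) (op.k (\<delta> N)) (u N) (u' N)" for N
    using separates_glue_op[OF vw_nz(2) \<delta>nz bad, of N] u(2) u'(2) Jnz vw_nz
      separates_scale[OF Jnz[OF vw_nz(2)]] by simp
  let ?S = "sphere 0 1 :: (complex^2) set"
  have "compact (?S \<times> ?S \<times> ?S \<times> ?S)" by (intro compact_Times compact_sphere)
  moreover have "(v N, w N, u N, u' N) \<in> ?S \<times> ?S \<times> ?S \<times> ?S" for N using v w u u' by simp
  ultimately obtain l r where l: "l \<in> ?S \<times> ?S \<times> ?S \<times> ?S" and r: "strict_mono (r :: nat \<Rightarrow> nat)"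
    and lim: "((\<lambda>N. (v N, w N, u N, u' N)) \<circ> r) \<longlonglongrightarrow> l"
    using seq_compactE[OF compact_imp_seq_compact, of "?S \<times> ?S \<times> ?S \<times> ?S" "\<lambda>N. (v N, w N, u N, u' N)"] by blast
  obtain \<alpha> \<alpha>' \<beta> \<beta>' where l_eq: "l = (\<alpha>, \<alpha>', \<beta>, \<beta>')" by (cases l) auto
  have lims: "(v \<circ> r) \<longlonglongrightarrow> \<alpha>" "(w \<circ> r) \<longlonglongrightarrow> \<alpha>'" "(u \<circ> r) \<longlonglongrightarrow> \<beta>" "(u' \<circ> r) \<longlonglongrightarrow> \<beta>'"
    using tendsto_fst[OF lim] tendsto_fst[OF tendsto_snd[OF lim]] tendsto_fst[OF tendsto_snd[OF tendsto_snd[OF lim]]]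
      tendsto_snd[OF tendsto_snd[OF tendsto_snd[OF lim]]] by (simp_all add: l_eq o_def)
  have nz: "\<alpha> \<noteq> 0" "\<alpha>' \<noteq> 0" "\<beta> \<noteq> 0" "\<beta>' \<noteq> 0" using l by (auto simp: l_eq)
  have \<delta>r: "(\<delta> \<circ> r) \<longlonglongrightarrow> 0" using \<delta>0 r by (rule LIMSEQ_subseq_LIMSEQ)
  \<comment> \<open>Swapping twice is multiplication by \<delta>, so \<open>v\<close> is in turn a
    multiple of the swapped \<open>u\<close>; this is what the opposite gluing asks for.\<close>
  have ret: "\<exists>s. \<forall>N. (x \<circ> r) N = s N *s lin (neck_swap ((\<delta> \<circ> r) N)) ((y \<circ> r) N)"
    if "\<And>N. y N = of_real (1 / norm (lin (neck_swap (\<delta> N)) (x N))) *s lin (neck_swap (\<delta> N)) (x N)"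
      "\<And>N. x N \<noteq> 0" for x y :: "nat \<Rightarrow> complex^2"
  proof (intro exI allI)
    fix N
    show "(x \<circ> r) N = (of_real (norm (lin (neck_swap (\<delta> (r N))) (x (r N)))) / of_real (\<delta> (r N))) *s lin (neck_swap ((\<delta> \<circ> r) N)) ((y \<circ> r) N)"
      using Jnz[OF that(2), of "r N" "r N"] \<delta>nz[of "r N"]
      unfolding comp_def that(1)[of "r N"] lin_scale vector_smult_assoc
      by (simp add: lin_neck_swap vec2_eq_iff)
  qed
  obtain s s' where s: "\<And>N. (v \<circ> r) N = s N *s lin (neck_swap ((\<delta> \<circ> r) N)) ((u \<circ> r) N)"
    "\<And>N. (w \<circ> r) N = s' N *s lin (neck_swap ((\<delta> \<circ> r) N)) ((u' \<circ> r) N)"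
    using ret[OF u(2) vw_nz(1)] ret[OF u'(2) vw_nz(2)] by blast
  have t: "(u \<circ> r) N = of_real (1 / norm (lin (neck_swap (\<delta> (r N))) (v (r N)))) *s lin (neck_swap ((\<delta> \<circ> r) N)) ((v \<circ> r) N)"
    "(u' \<circ> r) N = of_real (1 / norm (lin (neck_swap (\<delta> (r N))) (w (r N)))) *s lin (neck_swap ((\<delta> \<circ> r) N)) ((w \<circ> r) N)" for N
    using u(2) u'(2) by simp_all
  have badr: "\<not> separates (m + n) (k ((\<delta> \<circ> r) N)) ((v \<circ> r) N) ((w \<circ> r) N)"
    "\<not> separates (m + n) (k ((\<delta> \<circ> r) N)) ((w \<circ> r) N) ((v \<circ> r) N)"
    "\<not> separates (n + m) (op.k ((\<delta> \<circ> r) N)) ((u \<circ> r) N) ((u' \<circ> r) N)"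
    "\<not> separates (n + m) (op.k ((\<delta> \<circ> r) N)) ((u' \<circ> r) N) ((u \<circ> r) N)" for N
  proof -
    have "u N \<noteq> 0" "u' N \<noteq> 0" for N using u(1)[of N] u'(1)[of N] by auto
    then show "\<not> separates (m + n) (k ((\<delta> \<circ> r) N)) ((v \<circ> r) N) ((w \<circ> r) N)"
      "\<not> separates (m + n) (k ((\<delta> \<circ> r) N)) ((w \<circ> r) N) ((v \<circ> r) N)"
      "\<not> separates (n + m) (op.k ((\<delta> \<circ> r) N)) ((u \<circ> r) N) ((u' \<circ> r) N)"
      "\<not> separates (n + m) (op.k ((\<delta> \<circ> r) N)) ((u' \<circ> r) N) ((u \<circ> r) N)"
      using bad[of "r N"] bad_op[of "r N"] separates_sym[OF vw_nz(2), of "m + n" "k (\<delta> (r N))" "r N" "v (r N)"]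
        separates_sym[of "u' (r N)" "n + m" "op.k (\<delta> (r N))" "u (r N)"] by auto
  qed
  \<comment> \<open>Each of the four limits is forced to the base point, exchanging the two points
    of the pair and the two curves as required. Only the node remains.\<close>
  have "\<alpha> $ 1 = 0" using limit_away_from_base[OF \<delta>r lims(1,2,4) t(2) _ nz(2,4) badr(1)] by blast
  moreover have "\<alpha>' $ 1 = 0" using limit_away_from_base[OF \<delta>r lims(2,1,3) t(1) _ nz(1,3) badr(2)] by blast
  moreover have "\<beta> $ 1 = 0" using op.limit_away_from_base[OF \<delta>r lims(3,4,2) s(2) _ nz(4,2) badr(3)] by blast
  moreover have "\<beta>' $ 1 = 0" using op.limit_away_from_base[OF \<delta>r lims(4,3,1) s(1) _ nz(3,1) badr(4)] by blast
  ultimately have "neck_det 0 0 0 0 i j = 0"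
    using limit_at_neck[OF lims t _ _ _ _ nz badr(1)] by blast
  then show False using neck_det_base[OF e0, of i j] indep by (simp only: of_real_eq_0_iff)
qed

end

subsection \<open>Real parametrisations\<close>

lemma has_vector_derivative_vecI:
  fixes f :: "real \<Rightarrow> real ^ 'n"
  assumes "\<And>i. ((\<lambda>x. f x $ i) has_field_derivative f' $ i) (at a)"
  shows "(f has_vector_derivative f') (at a)"
  unfolding has_vector_derivative_def
proof (subst has_derivative_componentwise_within, rule ballI)
  fix b :: "real ^ 'n" assume "b \<in> Basis"
  then obtain i where b: "b = axis i 1" by (auto simp: Basis_vec_def)
  have "((\<lambda>x. f x $ i) has_derivative (\<lambda>x. x * f' $ i)) (at a)"
    using assms[of i] by (simp add: has_field_derivative_def mult_commute_abs)
  then show "((\<lambda>x. f x \<bullet> b) has_derivative (\<lambda>x. (x *\<^sub>R f') \<bullet> b)) (at a)"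
    by (simp add: b inner_axis)
qed

text \<open>In type \<open>4\<close> the index \<open>4\<close> equals \<open>0\<close>, so the
  embedding into the nonzero indices of type \<open>5\<close> is a table rather than an arithmetic
  formula.\<close>

definition inc :: "4 \<Rightarrow> 5" where
  "inc i = (if i = 1 then 1 else if i = 2 then 2 else if i = 3 then 3 else 4)"

lemma inc_simps [simp]: "inc 1 = 1" "inc 2 = 2" "inc 3 = 3" "inc 4 = 4"
  by (simp_all add: inc_def)

lemma index5_cases: obtains "i = 0" | j where "i = inc j"
  using exhaust_5[of i] inc_simps by metis

lemma affine_point_inc: "affine_point x $ i = x $ inc i / x $ 0"
  using exhaust_4[of i] by (auto simp: affine_point_nth)

definition hom_point :: "real ^ 4 \<Rightarrow> real ^ 5" where
  "hom_point p = (\<chi> i. if i = 0 then 1 else if i = 1 then p $ 1 else if i = 2 then p $ 2 else if i = 3 then p $ 3 else p $ 4)"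

lemma hom_point_nth [simp]: "hom_point p $ 0 = 1" "hom_point p $ inc i = p $ i"
  using exhaust_4[of i] by (auto simp: hom_point_def)

lemma vec5_eq_iff: "(x::'a^5) = y \<longleftrightarrow> x $ 0 = y $ 0 \<and> (\<forall>i. x $ inc i = y $ inc i)"
  by (auto simp: vec_eq_iff forall_5 forall_4)

lemma affine_point_hom [simp]: "affine_point (hom_point p) = p"
  by (simp add: vec_eq_iff affine_point_inc)

lemma hom_affine_point: "x $ 0 \<noteq> 0 \<Longrightarrow> x = x $ 0 *s hom_point (affine_point x)"
  by (simp add: vec5_eq_iff affine_point_inc)

lemma affine_point_scale: "c \<noteq> 0 \<Longrightarrow> affine_point (c *s x) = affine_point x"
  by (simp add: vec_eq_iff affine_point_inc)

lemma on_quadric_scale: "on_quadric x \<Longrightarrow> on_quadric (c *s x)"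
  by (simp add: on_quadric_def power_mult_distrib flip: distrib_left)

lemma norm_vec4: "(norm (x::real^4))\<^sup>2 = (x $ 1)\<^sup>2 + (x $ 2)\<^sup>2 + (x $ 3)\<^sup>2 + (x $ 4)\<^sup>2"
  unfolding power2_norm_eq_inner by (simp add: inner_vec_def sum_4 power2_eq_square)

lemma on_quadric_nonzero: "on_quadric x \<Longrightarrow> x \<noteq> 0 \<Longrightarrow> x $ 0 \<noteq> 0"
proof
  assume x: "on_quadric x" "x \<noteq> 0" "x $ 0 = 0"
  then have "(x $ 1)\<^sup>2 + (x $ 2)\<^sup>2 + (x $ 3)\<^sup>2 + (x $ 4)\<^sup>2 = 0" by (simp add: on_quadric_def)
  then have "x $ 1 = 0" "x $ 2 = 0" "x $ 3 = 0" "x $ 4 = 0"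
    by (smt (verit) zero_le_power2 zero_eq_power2)+
  then show False using x by (simp add: vec_eq_iff forall_5)
qed

lemma on_quadric_hom: "on_quadric (hom_point p) \<longleftrightarrow> norm p = 1"
proof -
  have "on_quadric (hom_point p) \<longleftrightarrow> (norm p)\<^sup>2 = 1"
    unfolding norm_vec4 on_quadric_def by (simp add: hom_point_def)
  then show ?thesis by (simp add: power2_eq_1_iff) (use norm_ge_zero[of p] in linarith)
qed

lemma affine_point_sphere:
  assumes "on_quadric x" "x $ 0 \<noteq> 0"
  shows "affine_point x \<in> S3"
proof -
  have "hom_point (affine_point x) = inverse (x $ 0) *s x"
    using assms(2) by (simp add: vec5_eq_iff affine_point_inc field_simps)
  then have "on_quadric (hom_point (affine_point x))" using on_quadric_scale[OF assms(1)] by simp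
  then show ?thesis by (simp add: on_quadric_hom)
qed

section \<open>The angle parametrisation of a knot\<close>

definition circ :: "real \<Rightarrow> real ^ 2" where
  "circ \<phi> = vector [sin \<phi>, cos \<phi>]"

lemma circ_nonzero: "circ \<phi> \<noteq> 0"
  using sin_zero_abs_cos_one[of \<phi>] by (auto simp: vec2_neq_0_iff circ_def)

lemma continuous_on_circ [continuous_intros]: "continuous_on S circ"
  unfolding circ_def by (intro continuous_intros)

lemma brk_circ: "brk (circ \<phi>) (circ \<psi>) = sin (\<phi> - \<psi>)"
  by (simp add: brk_def circ_def sin_diff)

lemma circ_polar:
  assumes "v \<noteq> 0"
  obtains r \<phi> where "r \<noteq> 0" "v = r *s circ \<phi>"
proof -
  define r where "r = norm v"
  have r: "r > 0" "r\<^sup>2 = (v $ 1)\<^sup>2 + (v $ 2)\<^sup>2"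
    using assms unfolding r_def power2_norm_eq_inner
    by (simp_all add: inner_vec_def sum_2 power2_eq_square)
  have "(v $ 2 / r)\<^sup>2 + (v $ 1 / r)\<^sup>2 = r\<^sup>2 / r\<^sup>2"
    by (simp only: power_divide r(2) add_divide_distrib add.commute)
  then have "(v $ 2 / r)\<^sup>2 + (v $ 1 / r)\<^sup>2 = 1" using r(1) by simp
  then obtain t where "v $ 2 / r = cos t" "v $ 1 / r = sin t"
    by (rule sincos_total_2pi)
  then have "v = r *s circ t"
    using r(1) by (simp add: vec2_eq_iff circ_def field_simps)
  with r(1) show ?thesis by (intro that[of r t]) simp_all
qed

text \<open>The angle 0 stands for [0 : 1]. Opposite vectors give the same projective point, so the
  closed curve has period pi and not 2 pi.\<close>

definition knot_curve :: "nat \<Rightarrow> real poly ^ 5 \<Rightarrow> real \<Rightarrow> real ^ 4" where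
  "knot_curve d k \<phi> = affine_point (curve_map d k (circ \<phi>))"

text \<open>The Wronskian form of the quotient rule; the sign comes from
  \<open>brk (circ \<phi>) (circ \<psi>) = sin (\<phi> - \<psi>)\<close>, which decreases in \<psi>
  at \<phi>.\<close>

definition knot_deriv :: "nat \<Rightarrow> real poly ^ 5 \<Rightarrow> real \<Rightarrow> real ^ 4" where
  "knot_deriv d k \<phi> = (\<chi> i. - bez d (k $ 0) (k $ inc i) (circ \<phi>) (circ \<phi>) / (curve_map d k (circ \<phi>) $ 0)\<^sup>2)"

lemma curve_map_real_nonzero:
  assumes "real_rational_knot d k" "(v::real^2) \<noteq> 0"
  shows "curve_map d k v $ 0 \<noteq> 0"
proof -
  have "curve_map d k (of_real_vec v :: complex^2) \<noteq> 0"
    using assms by (auto simp: real_rational_knot_def real_rational_curve_def)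
  then have "curve_map d k v \<noteq> 0" by (auto simp: curve_map_of_real)
  then show ?thesis
    using assms(1) on_quadric_nonzero by (auto simp: real_rational_knot_iff)
qed

lemma separates_real:
  assumes "real_rational_knot d k" "v \<noteq> 0" "w \<noteq> 0"
  shows "separates d k v (w :: real^2)"
proof -
  have "separates d k (of_real_vec v :: complex^2) (of_real_vec w)"
    using assms by (auto simp: real_rational_knot_iff)
  then show ?thesis by (simp add: separates_def bez_of_real)
qed

lemma knot_curve_periodic: "knot_curve d k (\<phi> + pi) = knot_curve d k \<phi>"
proof -
  have *: "circ (\<phi> + pi) = (-1) *s circ \<phi>" by (simp add: circ_def vec2_eq_iff)
  show ?thesis unfolding knot_curve_def * curve_map_scale by (rule affine_point_scale) simp
qed

lemma knot_curve_periodic_int: "knot_curve d k (\<phi> + of_int N * pi) = knot_curve d k \<phi>"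
proof (induction N rule: int_induct[where k = 0])
  case (step1 i)
  then show ?case using knot_curve_periodic[of d k "\<phi> + of_int i * pi"] by (simp add: algebra_simps)
next
  case (step2 i)
  then show ?case using knot_curve_periodic[of d k "\<phi> + of_int (i - 1) * pi"] by (simp add: algebra_simps)
qed simp

lemma knot_curve_has_derivative:
  assumes "real_rational_knot d k"
  shows "(knot_curve d k has_vector_derivative knot_deriv d k \<phi>) (at \<phi>)"
proof (rule has_vector_derivative_vecI)
  fix i
  have "(\<lambda>h::real. sin h / h) \<midarrow>0\<rightarrow> 1"
    using DERIV_sin[of 0] by (simp add: has_field_derivative_iff)
  then have "((\<lambda>w. sin (w - \<phi>) / (w - \<phi>)) \<longlongrightarrow> 1) (at \<phi>)"
    by (intro LIM_offset_zero_cancel[of _ \<phi>]) simp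
  from tendsto_minus[OF this]
  have "((\<lambda>w. brk (circ \<phi>) (circ w) / (w - \<phi>)) \<longlongrightarrow> - 1) (at \<phi>)"
    by (simp add: brk_circ sin_diff minus_divide_left mult.commute)
  from has_field_derivative_curve_quotient[OF continuous_on_circ this, of d "k $ 0" "k $ inc i"]
  show "((\<lambda>x. knot_curve d k x $ i) has_field_derivative knot_deriv d k \<phi> $ i) (at \<phi>)"
    using curve_map_real_nonzero[OF assms circ_nonzero]
    by (simp add: knot_curve_def knot_deriv_def affine_point_inc curve_map_nth)
qed

lemma continuous_on_knot_deriv:
  assumes "real_rational_knot d k"
  shows "continuous_on S (knot_deriv d k)"
  unfolding knot_deriv_def
  using curve_map_real_nonzero[OF assms circ_nonzero]
  by (intro continuous_on_vec_lambda continuous_on_divide continuous_on_minus continuous_on_power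
      continuous_on_bez continuous_on_component continuous_on_curve_map continuous_on_circ) simp

lemma continuous_on_knot_curve:
  assumes "real_rational_knot d k"
  shows "continuous_on S (knot_curve d k)"
  by (intro continuous_at_imp_continuous_on ballI has_vector_derivative_continuous[OF knot_curve_has_derivative[OF assms]])

lemma knot_deriv_nonzero:
  assumes "real_rational_knot d k"
  shows "knot_deriv d k \<phi> \<noteq> 0"
proof
  assume z: "knot_deriv d k \<phi> = 0"
  have nz: "form_eval d (k $ 0) (circ \<phi>) \<noteq> 0"
    using curve_map_real_nonzero[OF assms circ_nonzero] by (simp add: curve_map_nth)
  obtain j where j: "bez d (k $ 0) (k $ j) (circ \<phi>) (circ \<phi>) \<noteq> 0"
    using separates_at[OF separates_real[OF assms circ_nonzero circ_nonzero] circ_nonzero nz] by blast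
  have "bez d (k $ 0) (k $ inc i) (circ \<phi>) (circ \<phi>) = 0" for i
    using z nz by (auto simp: knot_deriv_def vec_eq_iff curve_map_nth)
  moreover have "bez d (k $ 0) (k $ 0) (circ \<phi>) (circ \<phi>) = 0"
    using bez_pluecker[OF circ_nonzero[of \<phi>], of d k 0 "circ \<phi>" 0 0] nz by simp
  ultimately show False using j by (cases j rule: index5_cases) auto
qed

text \<open>Equal affine points have vanishing minors, each of which is sin (\<phi> - \<psi>) times
  a Bezoutian, and some Bezoutian is nonzero.\<close>

lemma knot_curve_eq_iff:
  assumes "real_rational_knot d k"
  shows "knot_curve d k \<phi> = knot_curve d k \<psi> \<longleftrightarrow> sin (\<phi> - \<psi>) = 0"
proof
  assume eq: "knot_curve d k \<phi> = knot_curve d k \<psi>"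
  define x y where "x = curve_map d k (circ \<phi>)" and "y = curve_map d k (circ \<psi>)"
  have x: "x $ 0 \<noteq> 0" and y: "y $ 0 \<noteq> 0"
    using curve_map_real_nonzero[OF assms circ_nonzero] by (simp_all add: x_def y_def)
  define h where "h = hom_point (affine_point x)"
  have "x = x $ 0 *s h" unfolding h_def by (rule hom_affine_point[OF x])
  moreover have "y = y $ 0 *s h"
    using hom_affine_point[OF y] eq by (simp add: knot_curve_def x_def y_def h_def)
  ultimately have "minor x y i j = (x $ 0 * y $ 0) * minor h h i j" for i j
    by (metis minor_scale)
  then have "minor x y i j = 0" for i j by (simp add: minor_def)
  then have "sin (\<phi> - \<psi>) * bez d (k $ i) (k $ j) (circ \<phi>) (circ \<psi>) = 0" for i j
    using minor_curve_map[of d k "circ \<phi>" "circ \<psi>" i j] by (simp add: x_def y_def brk_circ)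
  then show "sin (\<phi> - \<psi>) = 0"
    using separates_real[OF assms circ_nonzero circ_nonzero] unfolding separates_def by (metis mult_eq_0_iff)
next
  assume "sin (\<phi> - \<psi>) = 0"
  then obtain N where "\<phi> - \<psi> = of_int N * pi" using sin_zero_iff_int2 by blast
  then have "\<phi> = \<psi> + of_int N * pi" by simp
  then show "knot_curve d k \<phi> = knot_curve d k \<psi>" using knot_curve_periodic_int by simp
qed

lemma range_knot_curve: "range (knot_curve d k) = real_points d k"
proof (intro equalityI subsetI)
  fix x assume "x \<in> real_points d k"
  then obtain v where v: "v \<noteq> 0" "x = affine_point (curve_map d k v)"
    by (auto simp: real_points_def)
  obtain r \<phi> where "r \<noteq> 0" "v = r *s circ \<phi>" using circ_polar[OF v(1)] by blast
  then have "x = knot_curve d k \<phi>"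
    using v by (simp add: knot_curve_def curve_map_scale affine_point_scale)
  then show "x \<in> range (knot_curve d k)" by blast
qed (auto simp: knot_curve_def real_points_def circ_nonzero)

lemma knot_curve_sphere:
  assumes "real_rational_knot d k"
  shows "knot_curve d k \<phi> \<in> S3"
  using assms curve_map_real_nonzero[OF assms circ_nonzero] affine_point_sphere
  unfolding knot_curve_def real_rational_knot_iff by blast

text \<open>An increasing angle that gains pi in unit time meets every class modulo pi by the
  intermediate value theorem, and within one period two angles differ by less than pi, where the
  sine has no zero.\<close>

lemma reparametrised_knot:
  assumes k: "real_rational_knot d k"
    and \<phi>: "\<And>t. (\<phi> has_field_derivative \<phi>' t) (at t)" "continuous_on UNIV \<phi>'" "\<And>t. \<phi>' t > 0"
    and per: "\<And>t. \<phi> (t + 1) = \<phi> t + pi"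
  shows "C1_knot (\<lambda>t. knot_curve d k (\<phi> t))"
    and "range (\<lambda>t. knot_curve d k (\<phi> t)) = real_points d k"
    and "((\<lambda>t. knot_curve d k (\<phi> t)) has_vector_derivative \<phi>' t *\<^sub>R knot_deriv d k (\<phi> t)) (at t)"
proof -
  have mono: "\<phi> s < \<phi> t" if "s < t" for s t
    using that DERIV_pos_imp_increasing[of s t \<phi>] \<phi> by blast
  have D: "((\<lambda>t. knot_curve d k (\<phi> t)) has_vector_derivative \<phi>' t *\<^sub>R knot_deriv d k (\<phi> t)) (at t)" for t
    using vector_diff_chain_at[of \<phi> "\<phi>' t" t "knot_curve d k" "knot_deriv d k (\<phi> t)"] \<phi>(1)[of t]
      knot_curve_has_derivative[OF k] by (simp add: has_real_derivative_iff_has_vector_derivative o_def)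
  have c\<phi>: "continuous_on UNIV \<phi>"
    by (intro continuous_at_imp_continuous_on ballI DERIV_isCont[OF \<phi>(1)])
  have shift: "\<phi> (t + real N) = \<phi> t + real N * pi" for t N
  proof (induction N)
    case (Suc N)
    then show ?case using per[of "t + real N"] by (simp add: algebra_simps)
  qed simp
  show "range (\<lambda>t. knot_curve d k (\<phi> t)) = real_points d k"
    unfolding range_knot_curve[symmetric]
  proof (intro equalityI subsetI)
    fix x assume "x \<in> range (knot_curve d k)"
    then obtain \<psi> where x: "x = knot_curve d k \<psi>" by blast
    obtain N where N: "\<bar>\<psi> - \<phi> 0\<bar> < real N * pi"
      using reals_Archimedean3[OF pi_gt_zero] by blast
    have "\<phi> (- real N) = \<phi> 0 - real N * pi" "\<phi> (real N) = \<phi> 0 + real N * pi"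
      using shift[of "- real N" N] shift[of 0 N] by simp_all
    then have "\<phi> (- real N) \<le> \<psi>" "\<psi> \<le> \<phi> (real N)" using N by linarith+
    then obtain t where "\<phi> t = \<psi>"
      using IVT'[of \<phi> "- real N" \<psi> "real N"] continuous_on_subset[OF c\<phi>] by auto
    then show "x \<in> range (\<lambda>t. knot_curve d k (\<phi> t))" using x by blast
  qed auto
  show "C1_knot (\<lambda>t. knot_curve d k (\<phi> t))"
    unfolding C1_knot_def
  proof (intro conjI allI)
    show "knot_curve d k (\<phi> (t + 1)) = knot_curve d k (\<phi> t)" for t
      by (simp add: per knot_curve_periodic)
    show "(\<lambda>t. knot_curve d k (\<phi> t)) C1_differentiable_on UNIV"
      unfolding C1_differentiable_on_def
      using D continuous_on_knot_deriv[OF k]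
      by (intro exI[of _ "\<lambda>t. \<phi>' t *\<^sub>R knot_deriv d k (\<phi> t)"])
         (auto intro!: continuous_intros \<phi>(2) continuous_on_compose2[OF _ c\<phi>])
    show "vector_derivative (\<lambda>t. knot_curve d k (\<phi> t)) (at t) \<noteq> 0" for t
      using vector_derivative_at[OF D, of t] \<phi>(3)[of t] knot_deriv_nonzero[OF k] by simp
    show "inj_on (\<lambda>t. knot_curve d k (\<phi> t)) {0..<1}"
    proof (rule linorder_inj_onI)
      fix s t :: real assume st: "s < t" "s \<in> {0..<1}" "t \<in> {0..<1}"
      have "\<phi> t < \<phi> (s + 1)" using st by (intro mono) auto
      then have "0 < \<phi> t - \<phi> s" "\<phi> t - \<phi> s < pi" using mono[OF st(1)] per[of s] by simp_all
      then have "sin (\<phi> t - \<phi> s) \<noteq> 0" using sin_gt_zero[of "\<phi> t - \<phi> s"] by simp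
      then show "knot_curve d k (\<phi> s) \<noteq> knot_curve d k (\<phi> t)"
        using knot_curve_eq_iff[OF k] by metis
    qed auto
    show "range (\<lambda>t. knot_curve d k (\<phi> t)) \<subseteq> S3"
      using knot_curve_sphere[OF k] by blast
  qed
  show "((\<lambda>t. knot_curve d k (\<phi> t)) has_vector_derivative \<phi>' t *\<^sub>R knot_deriv d k (\<phi> t)) (at t)"
    by (rule D)
qed

lemma bez_antisym:
  fixes v w :: "'a::real_normed_field ^ 2"
  assumes "w \<noteq> 0"
  shows "bez d g f v w = - bez d f g v w"
proof -
  have "\<forall>v. bez d g f v w = - bez d f g v w"
  proof (rule eq_by_brk_density[OF _ _ assms])
    fix v assume v: "brk v w \<noteq> 0"
    have "brk v w * bez d g f v w = brk v w * (- bez d f g v w)"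
      using brk_bez[of d f v g w] brk_bez[of d g v f w] by (auto simp: algebra_simps)
    then show "bez d g f v w = - bez d f g v w" using v by (metis mult_left_cancel)
  qed (intro continuous_intros continuous_on_bez)+
  then show ?thesis by blast
qed

lemma knot_deriv_base:
  assumes "curve_map d k (vector [0, 1] :: real^2) $ 0 = 1"
  shows "knot_deriv d k 0 $ i = bez d (k $ inc i) (k $ 0) (vector [0, 1]) (vector [0, 1])"
proof -
  have "circ 0 = vector [0, 1]" by (simp add: circ_def)
  then show ?thesis
    using bez_antisym[OF circ_nonzero, of d "k $ 0" "k $ inc i" "circ 0" 0] assms by (simp add: knot_deriv_def)
qed

lemma real_points_lin:
  assumes "M' ** M = mat 1" "c \<noteq> 0"
  shows "real_points d (curve_lin (mat c) (curve_subst d M k)) = real_points d k"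
proof -
  have M': "M ** M' = mat 1" using assms(1) matrix_left_right_inverse by blast
  have cm: "affine_point (curve_map d (curve_lin (mat c) (curve_subst d M k)) v) = affine_point (curve_map d k (M *v v))" for v
  proof -
    have "mat c *v x = c *s x" for x :: "real^5"
      by (simp add: matrix_vector_mult_def mat_def vec_eq_iff if_distrib[of "\<lambda>x. x * _"] cong: if_cong)
    then show ?thesis
      using assms(2) by (simp add: curve_map_lin curve_map_subst lin_real affine_point_scale)
  qed
  have "(\<lambda>v. M *v v) ` {v. v \<noteq> 0} = {v. v \<noteq> 0}"
  proof (intro equalityI subsetI)
    fix v :: "real^2" assume v: "v \<in> {v. v \<noteq> 0}"
    have "v = M *v (M' *v v)" by (simp add: matrix_vector_mul_assoc M')
    moreover have "M' *v v \<noteq> 0" using v calculation by (metis matrix_vector_mult_0_right mem_Collect_eq)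
    ultimately show "v \<in> (\<lambda>v. M *v v) ` {v. v \<noteq> 0}" by blast
  next
    fix v assume "v \<in> (\<lambda>v. M *v v) ` {v. v \<noteq> 0}"
    then obtain u where u: "u \<noteq> 0" "v = M *v u" by blast
    then have "M' *v v = u" by (simp add: matrix_vector_mul_assoc assms(1))
    then show "v \<in> {v. v \<noteq> 0}" using u(1) by auto
  qed
  then show ?thesis
    unfolding real_points_def cm by (metis (no_types) image_image)
qed

lemma base_point_normalisation:
  assumes k: "real_rational_knot d k" and p: "p \<in> real_points d k"
  obtains k' where "real_rational_knot d k'" "real_points d k' = real_points d k"
    "curve_map d k' (vector [0, 1] :: 'a::real_field^2) = of_real_vec (hom_point p)"
proof -
  obtain v where v: "v \<noteq> 0" "p = affine_point (curve_map d k v)" using p by (auto simp: real_points_def)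
  define c where "c = inverse (curve_map d k v $ 0)"
  have c: "c \<noteq> 0" using curve_map_real_nonzero[OF k v(1)] by (simp add: c_def)
  \<comment> \<open>The second column is \<open>v\<close>, the image of [0, 1]; the first is
    orthogonal to it and of the same length, which makes the determinant |v|^2.\<close>
  define M :: "real^2^2" where "M = vector [vector [v $ 2, v $ 1], vector [- v $ 1, v $ 2]]"
  have "det M = (v $ 2)\<^sup>2 + (v $ 1)\<^sup>2" by (simp add: M_def det_2 power2_eq_square)
  then have "det M \<noteq> 0" using v(1) by (auto simp: vec2_neq_0_iff sum_power2_eq_zero_iff)
  then obtain M' where M: "M' ** M = mat 1"
    using invertible_det_nz invertible_left_inverse by metis
  define k' where "k' = curve_lin (mat c) (curve_subst d M k)"
  have T: "mat (inverse c) ** mat c = (mat 1 :: real^5^5)"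
    using c by (simp add: matrix_matrix_mult_def mat_def vec_eq_iff if_distrib[of "\<lambda>x. x * _"] cong: if_cong)
  have matc: "mat c *v x = c *s x" for x :: "real^5"
      by (simp add: matrix_vector_mult_def mat_def vec_eq_iff if_distrib[of "\<lambda>x. x * _"] cong: if_cong)
  have "real_rational_knot d k'"
    unfolding k'_def by (rule real_rational_knot_transform[OF k T M]) (simp add: matc on_quadric_scale)
  moreover have "real_points d k' = real_points d k" unfolding k'_def by (rule real_points_lin[OF M c])
  moreover have "curve_map d k' (vector [0, 1] :: 'a^2) = of_real_vec (hom_point p)"
  proof -
    have "curve_map d k' (vector [0, 1] :: real^2) = c *s curve_map d k (M *v vector [0, 1])"
      by (simp add: k'_def curve_map_lin curve_map_subst lin_real matc)
    also have "M *v vector [0, 1] = v" by (simp add: M_def vec2_eq_iff matrix_vector_mult_def sum_2)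
    also have "c *s curve_map d k v = hom_point p"
      using curve_map_real_nonzero[OF k v(1)]
      by (simp add: vec5_eq_iff c_def v(2) affine_point_inc divide_inverse)
    finally have "of_real_vec (curve_map d k' (vector [0, 1] :: real^2)) = (of_real_vec (hom_point p) :: 'a^5)" by simp
    moreover have "of_real_vec (vector [0, 1] :: real^2) = (vector [0, 1] :: 'a^2)" by (simp add: vec2_eq_iff)
    ultimately show ?thesis using curve_map_of_real[of d k' "vector [0, 1]", where 'a='a] by simp
  qed
  ultimately show ?thesis using that by blast
qed

lemma noncollinear_minor:
  fixes x y :: "real ^ 'n"
  assumes "\<not> collinear {0, x, y}"
  obtains i j where "x $ i * y $ j \<noteq> x $ j * y $ i"
proof (rule ccontr)
  assume "\<not> thesis"
  then have eq: "x $ i * y $ j = x $ j * y $ i" for i j using that by blast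
  have "x \<noteq> 0" using assms by auto
  then obtain i where i: "x $ i \<noteq> 0" by (auto simp: vec_eq_iff)
  have "y = (y $ i / x $ i) *\<^sub>R x" using eq[of i] i by (simp add: vec_eq_iff field_simps)
  then have "collinear {0, x, y}" unfolding collinear_lemma by blast
  then show False using assms by blast
qed

subsection \<open>Disjointness after a generic translation\<close>

text \<open>Gaussian elimination: an equation with a nonzero coefficient removes one unknown from
  the remaining equations.\<close>

lemma underdetermined_system:
  fixes g :: "'b \<Rightarrow> 'a \<Rightarrow> 'f::field"
  assumes "finite E" "finite A" "card E < card A"
  shows "\<exists>c. (\<exists>a\<in>A. c a \<noteq> 0) \<and> (\<forall>e\<in>E. (\<Sum>a\<in>A. c a * g e a) = 0)"
  using assms
proof (induction E arbitrary: A g rule: finite_induct)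
  case empty
  then have "A \<noteq> {}" by auto
  then show ?case by (intro exI[of _ "\<lambda>_. 1"]) auto
next
  case (insert e E)
  show ?case
  proof (cases "\<forall>a\<in>A. g e a = 0")
    case True
    obtain c where "\<exists>a\<in>A. c a \<noteq> 0" "\<forall>e\<in>E. (\<Sum>a\<in>A. c a * g e a) = 0"
      using insert.IH[of A g] insert.hyps insert.prems by auto
    then show ?thesis using True by (intro exI[of _ c]) auto
  next
    case False
    then obtain a\<^sub>0 where a0: "a\<^sub>0 \<in> A" "g e a\<^sub>0 \<noteq> 0" by blast
    define B where "B = A - {a\<^sub>0}"
    have B: "finite B" "card E < card B" "A = insert a\<^sub>0 B" "a\<^sub>0 \<notin> B"
      using a0 insert.hyps insert.prems by (auto simp: B_def)
    obtain c where c: "\<exists>a\<in>B. c a \<noteq> 0"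
      "\<forall>e'\<in>E. (\<Sum>a\<in>B. c a * (g e' a - g e' a\<^sub>0 * (g e a / g e a\<^sub>0))) = 0"
      using insert.IH[OF B(1,2), of "\<lambda>e' a. g e' a - g e' a\<^sub>0 * (g e a / g e a\<^sub>0)"] by blast
    \<comment> \<open>The value at the pivot is the one that solves equation
      \<open>e\<close>.\<close>
    define d where "d = c(a\<^sub>0 := - (\<Sum>a\<in>B. c a * (g e a / g e a\<^sub>0)))"
    have sum: "(\<Sum>a\<in>A. d a * g e' a) = (\<Sum>a\<in>B. c a * (g e' a - g e' a\<^sub>0 * (g e a / g e a\<^sub>0)))" for e'
    proof -
      have "(\<Sum>a\<in>B. d a * g e' a) = (\<Sum>a\<in>B. c a * g e' a)"
        using B(4) by (intro sum.cong) (auto simp: d_def)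
      then show ?thesis
        using B by (simp add: d_def right_diff_distrib sum_subtractf sum_distrib_left sum_distrib_right mult_ac)
    qed
    have "(\<Sum>a\<in>A. d a * g e' a) = 0" if "e' \<in> insert e E" for e'
      using that c(2) a0(2) unfolding sum by auto
    moreover have "\<exists>a\<in>A. d a \<noteq> 0" using c(1) B by (auto simp: d_def)
    ultimately show ?thesis by blast
  qed
qed

text \<open>Forms are treated as functions, so that a form in one point may carry another point as a
  parameter. Continuity recovers the values at infinity from those at finite points.\<close>

definition is_form :: "nat \<Rightarrow> (complex ^ 2 \<Rightarrow> complex) \<Rightarrow> bool" where
  "is_form D f \<longleftrightarrow> (\<exists>q. degree q \<le> D \<and> (\<forall>z. f (vector [z, 1]) = poly q z)) \<and>
     (\<forall>c v. f (c *s v) = c ^ D * f v) \<and> continuous_on UNIV f"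

lemma is_form_mult: "is_form a f \<Longrightarrow> is_form b g \<Longrightarrow> is_form (a + b) (\<lambda>v. f v * g v)"
  unfolding is_form_def
proof (elim conjE exE, intro conjI)
  fix q r assume "degree q \<le> a" "\<forall>z. f (vector [z, 1]) = poly q z" "degree r \<le> b" "\<forall>z. g (vector [z, 1]) = poly r z"
  then show "\<exists>q. degree q \<le> a + b \<and> (\<forall>z. f (vector [z, 1]) * g (vector [z, 1]) = poly q z)"
    using degree_mult_le[of q r] by (intro exI[of _ "q * r"]) auto
qed (auto simp: power_add intro!: continuous_intros)

lemma is_form_1: "is_form 0 (\<lambda>v. 1)"
  unfolding is_form_def by (auto intro!: exI[of _ 1])

lemma is_form_power: "is_form a f \<Longrightarrow> is_form (a * n) (\<lambda>v. f v ^ n)"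
  by (induction n) (auto intro: is_form_1 is_form_mult)

lemma is_form_scale: "is_form a f \<Longrightarrow> is_form a (\<lambda>v. c * f v)"
  unfolding is_form_def
proof (elim conjE exE, intro conjI)
  fix q assume "degree q \<le> a" "\<forall>z. f (vector [z, 1]) = poly q z"
  then show "\<exists>q. degree q \<le> a \<and> (\<forall>z. c * f (vector [z, 1]) = poly q z)"
    using degree_smult_le[of c q] by (intro exI[of _ "smult c q"]) auto
qed (auto intro!: continuous_intros)

lemma is_form_add: "is_form a f \<Longrightarrow> is_form a g \<Longrightarrow> is_form a (\<lambda>v. f v + g v)"
  unfolding is_form_def
proof (elim conjE exE, intro conjI)
  fix q r assume "degree q \<le> a" "\<forall>z. f (vector [z, 1]) = poly q z" "degree r \<le> a" "\<forall>z. g (vector [z, 1]) = poly r z"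
  then show "\<exists>q. degree q \<le> a \<and> (\<forall>z. f (vector [z, 1]) + g (vector [z, 1]) = poly q z)"
    using degree_add_le[of q a r] by (intro exI[of _ "q + r"]) auto
qed (auto simp: algebra_simps intro!: continuous_intros)

lemma is_form_0: "is_form a (\<lambda>v. 0)"
  unfolding is_form_def by (auto intro!: exI[of _ 0])

lemma is_form_sum: "(\<And>i. i \<in> A \<Longrightarrow> is_form a (f i)) \<Longrightarrow> is_form a (\<lambda>v. \<Sum>i\<in>A. f i v)"
  by (induction A rule: infinite_finite_induct) (auto intro: is_form_0 is_form_add)

lemma is_form_eval:
  assumes "degree q \<le> d"
  shows "is_form d (form_eval d q)"
  unfolding is_form_def
proof (intro conjI exI[of _ "map_poly of_real q"] allI)
  show "form_eval d q (vector [z, 1]) = poly (map_poly of_real q) z" for z :: complex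
    using assms by (subst form_eval_conv_poly) auto
  show "degree (map_poly of_real q :: complex poly) \<le> d"
    using assms by (simp add: degree_map_poly)
qed (auto simp: form_eval_scale intro!: continuous_on_form_eval continuous_intros)

text \<open>A nonzero polynomial of degree at most D has at most D roots. This reduces an identity
  of forms to D + 1 evaluations, hence to finitely many linear equations on coefficients.\<close>

lemma is_form_vanish:
  assumes f: "is_form D f" and zero: "\<And>j. j \<le> D \<Longrightarrow> f (vector [of_nat j, 1]) = 0"
  shows "f v = 0"
proof -
  obtain q where q: "degree q \<le> D" "\<And>z. f (vector [z, 1]) = poly q z" using f by (auto simp: is_form_def)
  have "q = 0"
  proof (rule ccontr)
    assume "q \<noteq> 0"
    have "D + 1 = card ((of_nat :: nat \<Rightarrow> complex) ` {..D})"
      by (subst card_image) (auto simp: inj_on_def)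
    also have "\<dots> \<le> card {z. poly q z = 0}"
      using zero q(2) poly_roots_finite[OF \<open>q \<noteq> 0\<close>] by (intro card_mono) auto
    also have "\<dots> \<le> degree q" using card_poly_roots_bound[OF \<open>q \<noteq> 0\<close>] by simp
    finally show False using q(1) by simp
  qed
  have *: "f v = 0" if "v $ 2 \<noteq> 0" for v
  proof -
    have "v = v $ 2 *s vector [v $ 1 / v $ 2, 1]" using that by (simp add: vec2_eq_iff)
    then have "f v = (v $ 2) ^ D * f (vector [v $ 1 / v $ 2, 1])" using f by (metis is_form_def)
    then show ?thesis by (simp add: q(2) \<open>q = 0\<close>)
  qed
  have "\<forall>v. f v = (\<lambda>v. 0) v"
  proof (rule eq_by_brk_density[where w = "vector [1, 0]"])
    show "continuous_on UNIV f" using f by (simp add: is_form_def)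
    fix v :: "complex^2" assume "brk v (vector [1, 0]) \<noteq> 0"
    then show "f v = (\<lambda>v. 0) v" using * by (auto simp: brk_def)
  qed (auto simp: vec2_neq_0_iff)
  then show ?thesis by simp
qed

text \<open>For \<open>a < M ^ 3\<close> the exponents are the three base-M digits of
  \<open>a\<close>. The term is the corresponding monomial in the differences x_l / x_0 - y_l / y_0,
  cleared of denominators by (x_0 y_0)^(3 M) so that all terms have the same bidegree.\<close>

definition bterm :: "nat \<Rightarrow> (nat \<Rightarrow> 'a::comm_ring_1) \<Rightarrow> (nat \<Rightarrow> 'a) \<Rightarrow> nat \<Rightarrow> 'a" where
  "bterm M x y a =
     (x 1 * y 0 - y 1 * x 0) ^ (a mod M) *
     ((x 2 * y 0 - y 2 * x 0) ^ (a div M mod M) *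
     ((x 3 * y 0 - y 3 * x 0) ^ (a div M\<^sup>2) *
      (x 0 * y 0) ^ (3 * M - (a mod M + a div M mod M + a div M\<^sup>2))))"

lemma digits:
  fixes a M :: nat
  assumes "a < M ^ 3"
  shows "a mod M < M" "a div M mod M < M" "a div M\<^sup>2 < M"
    "a = a mod M + M * (a div M mod M) + M\<^sup>2 * (a div M\<^sup>2)"
proof -
  have M: "M > 0" using assms by (cases M) auto
  then show "a mod M < M" "a div M mod M < M" by auto
  show "a div M\<^sup>2 < M"
    using assms by (simp add: less_mult_imp_div_less power3_eq_cube power2_eq_square)
  have "a div M = M * (a div M\<^sup>2) + a div M mod M"
    using mult_div_mod_eq[of M "a div M"] by (simp add: power2_eq_square div_mult2_eq)
  then have "M * (a div M) = M\<^sup>2 * (a div M\<^sup>2) + M * (a div M mod M)"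
    by (metis distrib_left mult.assoc power2_eq_square)
  then show "a = a mod M + M * (a div M mod M) + M\<^sup>2 * (a div M\<^sup>2)"
    using mult_div_mod_eq[of M a] by linarith
qed

lemma is_form_bterm:
  assumes "\<And>l. is_form d (x l)" and a: "a < M ^ 3"
  shows "is_form (3 * M * d) (\<lambda>v. bterm M (\<lambda>l. x l v) y a)"
    and "is_form (3 * M * d) (\<lambda>v. bterm M y (\<lambda>l. x l v) a)"
proof -
  define i j k where "i = a mod M" and "j = a div M mod M" and "k = a div M\<^sup>2"
  have sum: "d * i + (d * j + (d * k + d * (3 * M - (i + j + k)))) = 3 * M * d"
  proof -
    have "i + j + k \<le> 3 * M" using digits(1,2,3)[OF a] unfolding i_def j_def k_def by linarith
    then show ?thesis by (simp add: mult.commute flip: distrib_left)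
  qed
  have f: "is_form d (\<lambda>v. x l v * c - e * x l' v)" "is_form d (\<lambda>v. c * x l v - x l' v * e)"
     "is_form d (\<lambda>v. x l v * c)" "is_form d (\<lambda>v. c * x l v)" for l l' c e
    using is_form_add[OF is_form_scale[OF assms(1), of c l] is_form_scale[OF assms(1), of "-e" l']]
      is_form_scale[OF assms(1), of c l] by (simp_all add: mult.commute)
  show "is_form (3 * M * d) (\<lambda>v. bterm M (\<lambda>l. x l v) y a)"
    unfolding bterm_def sum[symmetric] i_def[symmetric] j_def[symmetric] k_def[symmetric]
    by (intro is_form_mult is_form_power f)
  show "is_form (3 * M * d) (\<lambda>v. bterm M y (\<lambda>l. x l v) a)"
    unfolding bterm_def sum[symmetric] i_def[symmetric] j_def[symmetric] k_def[symmetric]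
    by (intro is_form_mult is_form_power f)
qed

text \<open>The differences of the points of two rational curves in affine three-space form the image of
  a surface, so they satisfy a polynomial equation. It is found by counting coefficients, and
  read along the monomial curve with coordinates \<open>\<tau>, \<tau> ^ M, \<tau> ^ M\<^sup>2\<close>, on which
  the monomials of degree less than \<open>M\<close> in each variable are distinct powers of \<open>\<tau>\<close>.\<close>

lemma algebraic_relation:
  fixes x y :: "nat \<Rightarrow> complex^2 \<Rightarrow> complex"
  assumes x: "\<And>l. is_form m (x l)" and y: "\<And>l. is_form n (y l)"
  shows "\<exists>M F. M \<ge> 2 \<and> F \<noteq> 0 \<and> (\<forall>v w \<tau>. x 0 v * y 0 w \<noteq> 0 \<longrightarrow>
      x 1 v * y 0 w - y 1 w * x 0 v = \<tau> * (x 0 v * y 0 w) \<longrightarrow>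
      x 2 v * y 0 w - y 2 w * x 0 v = \<tau> ^ M * (x 0 v * y 0 w) \<longrightarrow>
      x 3 v * y 0 w - y 3 w * x 0 v = \<tau> ^ M\<^sup>2 * (x 0 v * y 0 w) \<longrightarrow> poly F \<tau> = 0)"
proof -
  \<comment> \<open>There are M^3 unknown coefficients, against at most 16 M^2 (m + 1) (n + 1) grid
    points. The summand 2 makes the inequality strict and guarantees M \<ge> 2, so that 1, M and M^2
    are distinct exponents.\<close>
  define M where "M = 16 * ((m + 1) * (n + 1)) + 2"
  define E where "E = {..3 * M * m} \<times> {..3 * M * n}"
  have "card E = (3 * M * m + 1) * (3 * M * n + 1)" by (simp add: E_def card_cartesian_product)
  also have "\<dots> \<le> (4 * M * (m + 1)) * (4 * M * (n + 1))"
    by (intro mult_mono) (auto simp: M_def algebra_simps)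
  also have "\<dots> = M\<^sup>2 * (16 * ((m + 1) * (n + 1)))" by (simp add: power2_eq_square algebra_simps)
  also have "\<dots> < M\<^sup>2 * M" by (rule mult_strict_left_mono) (auto simp: M_def)
  also have "\<dots> = card {..<M ^ 3}" by (simp add: power3_eq_cube power2_eq_square)
  finally have "card E < card {..<M ^ 3}" .
  then obtain c where c: "\<exists>a\<in>{..<M ^ 3}. c a \<noteq> 0" 
    "\<forall>e\<in>E. (\<Sum>a<M ^ 3. c a * (\<lambda>(i, j). bterm M (\<lambda>l. x l (vector [of_nat i, 1])) (\<lambda>l. y l (vector [of_nat j, 1]))) e a) = 0"
    using underdetermined_system[of E "{..<M ^ 3}" "\<lambda>(i, j). bterm M (\<lambda>l. x l (vector [of_nat i, 1])) (\<lambda>l. y l (vector [of_nat j, 1]))"]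
    by (auto simp: E_def simp del: card_lessThan card_cartesian_product)
  \<comment> \<open>Vanishing on the grid is spread to all points in one variable at a time.\<close>
  have 1: "(\<Sum>a<M ^ 3. c a * bterm M (\<lambda>l. x l (vector [of_nat i, 1])) (\<lambda>l. y l w) a) = 0" if "i \<le> 3 * M * m" for i w
  proof (rule is_form_vanish[where D = "3 * M * n" and v = w])
    show "is_form (3 * M * n) (\<lambda>w. \<Sum>a<M ^ 3. c a * bterm M (\<lambda>l. x l (vector [of_nat i, 1])) (\<lambda>l. y l w) a)"
      by (intro is_form_sum is_form_scale is_form_bterm y) auto
  qed (use that c(2) in \<open>auto simp: E_def\<close>)
  have 2: "(\<Sum>a<M ^ 3. c a * bterm M (\<lambda>l. x l v) (\<lambda>l. y l w) a) = 0" for v w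
  proof (rule is_form_vanish[where D = "3 * M * m" and v = v])
    show "is_form (3 * M * m) (\<lambda>v. \<Sum>a<M ^ 3. c a * bterm M (\<lambda>l. x l v) (\<lambda>l. y l w) a)"
      by (intro is_form_sum is_form_scale is_form_bterm x) auto
  qed (use 1 in auto)
  define F where "F = (\<Sum>a<M ^ 3. monom (c a) a)"
  \<comment> \<open>On the monomial curve the term numbered \<open>a\<close> becomes the power
    \<tau>^a, so no two coefficients merge and \<open>F\<close> inherits a nonzero one.\<close>
  have "coeff F a = c a" if "a < M ^ 3" for a
    using that by (simp add: F_def coeff_sum)
  then have "F \<noteq> 0" using c(1) by (metis coeff_0 lessThan_iff)
  moreover have "poly F \<tau> = 0"
    if nz: "x 0 v * y 0 w \<noteq> 0" and b: "x 1 v * y 0 w - y 1 w * x 0 v = \<tau> * (x 0 v * y 0 w)"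
      "x 2 v * y 0 w - y 2 w * x 0 v = \<tau> ^ M * (x 0 v * y 0 w)"
      "x 3 v * y 0 w - y 3 w * x 0 v = \<tau> ^ M\<^sup>2 * (x 0 v * y 0 w)" for v w \<tau>
  proof -
    have "bterm M (\<lambda>l. x l v) (\<lambda>l. y l w) a = (x 0 v * y 0 w) ^ (3 * M) * \<tau> ^ a" if a: "a < M ^ 3" for a
    proof -
      define i j k where "i = a mod M" and "j = a div M mod M" and "k = a div M\<^sup>2"
      have le: "i + j + k \<le> 3 * M" and aeq: "a = i + M * j + M\<^sup>2 * k"
        using digits[OF a] unfolding i_def j_def k_def by linarith+
      define Q where "Q = x 0 v * y 0 w"
      have "bterm M (\<lambda>l. x l v) (\<lambda>l. y l w) a = (\<tau> * Q) ^ i * ((\<tau> ^ M * Q) ^ j * ((\<tau> ^ M\<^sup>2 * Q) ^ k * Q ^ (3 * M - (i + j + k))))"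
        unfolding bterm_def b i_def j_def k_def Q_def ..
      also have "\<dots> = (Q ^ (i + j + k) * Q ^ (3 * M - (i + j + k))) * \<tau> ^ (i + M * j + M\<^sup>2 * k)"
        by (simp add: power_mult_distrib power_add mult_ac flip: power_mult)
      also have "Q ^ (i + j + k) * Q ^ (3 * M - (i + j + k)) = Q ^ (3 * M)"
        using le by (simp flip: power_add)
      finally show ?thesis by (simp add: aeq[symmetric] Q_def)
    qed
    then have "(x 0 v * y 0 w) ^ (3 * M) * poly F \<tau> = 0"
      using 2[of v w] by (simp add: F_def poly_sum poly_monom sum_distrib_left mult_ac)
    then show ?thesis using nz by simp
  qed
  moreover have "M \<ge> 2" by (simp add: M_def)
  ultimately show ?thesis by blast
qed

text \<open>A translation of three-space acting on the quadric y0 y4 = y1^2 + y2^2 + y3^2. The last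
  row is dictated by the expansion of |y + t|^2, and the point (0, 0, 0, 0, 1) is fixed.\<close>

definition translation :: "real \<Rightarrow> real \<Rightarrow> real \<Rightarrow> real^5^5" where
  "translation a b c = (\<chi> i j. if i = 0 then (if j = 0 then 1 else 0)
     else if i = 1 then (if j = 0 then a else if j = 1 then 1 else 0)
     else if i = 2 then (if j = 0 then b else if j = 2 then 1 else 0)
     else if i = 3 then (if j = 0 then c else if j = 3 then 1 else 0)
     else (if j = 0 then a\<^sup>2 + b\<^sup>2 + c\<^sup>2 else if j = 1 then 2 * a else if j = 2 then 2 * b else if j = 3 then 2 * c else 1))"

lemma lin_translation:
  "lin (translation a b c) y $ 0 = y $ 0"
  "lin (translation a b c) y $ 1 = y $ 1 + of_real a * y $ 0"
  "lin (translation a b c) y $ 2 = y $ 2 + of_real b * y $ 0"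
  "lin (translation a b c) y $ 3 = y $ 3 + of_real c * y $ 0"
  "lin (translation a b c) y $ 4 = y $ 4 + 2 * (of_real a * y $ 1 + of_real b * y $ 2 + of_real c * y $ 3)
      + of_real (a\<^sup>2 + b\<^sup>2 + c\<^sup>2) * y $ 0"
  by (simp_all add: lin_def translation_def sum_5 algebra_simps)

abbreviation monomial_translation :: "nat \<Rightarrow> real \<Rightarrow> real^5^5" where
  "monomial_translation M \<tau> \<equiv> translation \<tau> (\<tau> ^ M) (\<tau> ^ M\<^sup>2)"

text \<open>On y0 = 0 a translation changes only the last coordinate. The first three coordinates
  fix the proportionality factor independently of \<tau>, and the last one then yields a polynomial
  equation for \<tau>.\<close>

lemma finite_bad_at_infinity:
  fixes x y :: "complex ^ 5"
  assumes "x $ 0 = 0" "y $ 0 = 0" "\<not> (x $ 1 = 0 \<and> x $ 2 = 0 \<and> x $ 3 = 0)" "M \<ge> 2"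
  shows "finite {\<tau>. same_point x (lin (monomial_translation M \<tau>) y)}"
proof (cases "\<exists>\<tau>. same_point x (lin (monomial_translation M \<tau>) y)")
  case True
  have eqs: "\<exists>c. c \<noteq> 0 \<and> x $ 1 = c * y $ 1 \<and> x $ 2 = c * y $ 2 \<and> x $ 3 = c * y $ 3 \<and>
      x $ 4 = c * (y $ 4 + 2 * (of_real \<tau> * y $ 1 + of_real (\<tau> ^ M) * y $ 2 + of_real (\<tau> ^ M\<^sup>2) * y $ 3))"
    if \<tau>: "same_point x (lin (monomial_translation M \<tau>) y)" for \<tau>
  proof -
    obtain c where c: "c \<noteq> 0" "x = c *s lin (monomial_translation M \<tau>) y" using \<tau> by (auto simp: same_point_def)
    show ?thesis
      by (rule exI[of _ c]) (use c(1) in \<open>simp add: c(2) lin_translation assms(2)\<close>)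
  qed
  obtain c where c: "c \<noteq> 0" "x $ 1 = c * y $ 1" "x $ 2 = c * y $ 2" "x $ 3 = c * y $ 3"
    using True eqs by blast
  define G where "G = [:c * y $ 4 - x $ 4:] + monom (2 * c * y $ 1) 1 + monom (2 * c * y $ 2) M + monom (2 * c * y $ 3) (M\<^sup>2)"
  \<comment> \<open>Distinct exponents keep the three coefficients of \<open>G\<close> apart; one of
    them is nonzero because the first three coordinates of \<open>x\<close> are not all
    zero.\<close>
  have M: "M \<noteq> 1" "M \<noteq> 0" "M\<^sup>2 \<noteq> 1" "M\<^sup>2 \<noteq> 0" "M\<^sup>2 \<noteq> M" using assms(4) by (auto simp: power2_eq_square)
  have "coeff G 1 = 2 * c * y $ 1" "coeff G M = 2 * c * y $ 2" "coeff G (M\<^sup>2) = 2 * c * y $ 3"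
    using M by (auto simp: G_def coeff_pCons split: nat.splits)
  then have "G \<noteq> 0" using c assms(3) by (metis coeff_0 mult_eq_0_iff zero_neq_numeral)
  then have "finite {z. poly G z = 0}" by (rule poly_roots_finite)
  then have "finite (complex_of_real -` {z. poly G z = 0})" by (rule finite_vimageI) (simp add: inj_on_def)
  moreover have "{\<tau>. same_point x (lin (monomial_translation M \<tau>) y)} \<subseteq> complex_of_real -` {z. poly G z = 0}"
  proof (intro subsetI)
    fix \<tau> assume "\<tau> \<in> {\<tau>. same_point x (lin (monomial_translation M \<tau>) y)}"
    then obtain d where d: "x $ 1 = d * y $ 1" "x $ 2 = d * y $ 2" "x $ 3 = d * y $ 3"
      "x $ 4 = d * (y $ 4 + 2 * (of_real \<tau> * y $ 1 + of_real (\<tau> ^ M) * y $ 2 + of_real (\<tau> ^ M\<^sup>2) * y $ 3))"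
      using eqs by blast
    have "d = c" using assms(3) c d by auto
    then show "\<tau> \<in> complex_of_real -` {z. poly G z = 0}"
      using d(4) by (simp add: G_def poly_monom algebra_simps)
  qed
  ultimately show ?thesis using finite_subset by blast
next
  case False
  then show ?thesis by simp
qed

text \<open>\<open>Z\<close> only has to cover the zeros up to scalars, so [1 : 0] is put in without
  asking whether it is one.\<close>

lemma finite_zeros_of_form:
  assumes "q \<noteq> 0" "degree q \<le> d"
  obtains Z :: "(complex^2) set" where "finite Z" "\<And>v. v \<in> Z \<Longrightarrow> v \<noteq> 0"
    "\<And>v. v \<noteq> 0 \<Longrightarrow> form_eval d q v = 0 \<Longrightarrow> \<exists>c u. c \<noteq> 0 \<and> u \<in> Z \<and> v = c *s u"
proof -
  define q' :: "complex poly" where "q' = map_poly of_real q"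
  have "q' \<noteq> 0" using assms(1) by (simp add: q'_def map_poly_eq_0_iff)
  define Z where "Z = insert (vector [1, 0]) ((\<lambda>z. vector [z, 1] :: complex^2) ` {z. poly q' z = 0})"
  have "finite Z" unfolding Z_def using poly_roots_finite[OF \<open>q' \<noteq> 0\<close>] by simp
  moreover have "v \<noteq> 0" if "v \<in> Z" for v using that by (auto simp: Z_def vec2_neq_0_iff)
  moreover have "\<exists>c u. c \<noteq> 0 \<and> u \<in> Z \<and> v = c *s u" if v: "v \<noteq> 0" "form_eval d q v = 0" for v
  proof (cases "v $ 2 = 0")
    case True
    then show ?thesis using v(1)
      by (intro exI[of _ "v $ 1"] exI[of _ "vector [1, 0]"]) (auto simp: Z_def vec2_eq_iff vec2_neq_0_iff)
  next
    case False
    then have "poly q' (v $ 1 / v $ 2) = 0"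
      using form_eval_conv_poly[OF False assms(2)] v(2) by (simp add: q'_def)
    then show ?thesis using False
      by (intro exI[of _ "v $ 2"] exI[of _ "vector [v $ 1 / v $ 2, 1]"]) (auto simp: Z_def vec2_eq_iff)
  qed
  ultimately show ?thesis using that by blast
qed

text \<open>The only coincidence left over is at (0, 0, 0, 0, 1), which will be the image of p. The
  hyperplane y0 = 0 needs its own treatment: over the complex numbers it cuts the quadric of the
  application in a cone and not merely in this apex.\<close>

theorem generic_translation:
  assumes deg: "\<And>i. degree (K\<^sub>1 $ i) \<le> m" "\<And>i. degree (K\<^sub>2 $ i) \<le> n"
    and nz: "K\<^sub>1 $ 0 \<noteq> 0" "K\<^sub>2 $ 0 \<noteq> 0"
  obtains M B where "M \<ge> 2" "finite B"
    "\<And>\<tau> v w. \<tau> \<notin> B \<Longrightarrow> v \<noteq> 0 \<Longrightarrow> w \<noteq> 0 \<Longrightarrow>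
       same_point (curve_map m K\<^sub>1 v) (lin (monomial_translation M \<tau>) (curve_map n K\<^sub>2 (w::complex^2))) \<Longrightarrow>
       curve_map m K\<^sub>1 v $ 0 = 0 \<and> curve_map m K\<^sub>1 v $ 1 = 0 \<and> curve_map m K\<^sub>1 v $ 2 = 0 \<and> curve_map m K\<^sub>1 v $ 3 = 0"
proof -
  define x :: "nat \<Rightarrow> complex^2 \<Rightarrow> complex" where "x l = form_eval m (K\<^sub>1 $ of_nat l)" for l :: nat
  define y :: "nat \<Rightarrow> complex^2 \<Rightarrow> complex" where "y l = form_eval n (K\<^sub>2 $ of_nat l)" for l :: nat
  have xy: "is_form m (x l)" "is_form n (y l)" for l
    unfolding x_def y_def by (intro is_form_eval deg)+
  obtain M F where M: "M \<ge> 2" and F: "F \<noteq> 0" and rel: "\<And>v w \<tau>. x 0 v * y 0 w \<noteq> 0 \<Longrightarrow>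
      x 1 v * y 0 w - y 1 w * x 0 v = \<tau> * (x 0 v * y 0 w) \<Longrightarrow>
      x 2 v * y 0 w - y 2 w * x 0 v = \<tau> ^ M * (x 0 v * y 0 w) \<Longrightarrow>
      x 3 v * y 0 w - y 3 w * x 0 v = \<tau> ^ M\<^sup>2 * (x 0 v * y 0 w) \<Longrightarrow> poly F \<tau> = 0"
    using algebraic_relation[of m x n y, OF xy] by blast
  obtain Z\<^sub>1 where Z1: "finite Z\<^sub>1" "\<And>v. v \<in> Z\<^sub>1 \<Longrightarrow> v \<noteq> 0"
    "\<And>v. v \<noteq> 0 \<Longrightarrow> form_eval m (K\<^sub>1 $ 0) v = 0 \<Longrightarrow> \<exists>c u. c \<noteq> 0 \<and> u \<in> Z\<^sub>1 \<and> (v::complex^2) = c *s u"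
    using finite_zeros_of_form[OF nz(1) deg(1)] by metis
  obtain Z\<^sub>2 where Z2: "finite Z\<^sub>2" "\<And>v. v \<in> Z\<^sub>2 \<Longrightarrow> v \<noteq> 0"
    "\<And>v. v \<noteq> 0 \<Longrightarrow> form_eval n (K\<^sub>2 $ 0) v = 0 \<Longrightarrow> \<exists>c u. c \<noteq> 0 \<and> u \<in> Z\<^sub>2 \<and> (v::complex^2) = c *s u"
    using finite_zeros_of_form[OF nz(2) deg(2)] by metis
  define flat where "flat z \<longleftrightarrow> z $ 1 = 0 \<and> z $ 2 = 0 \<and> z $ 3 = 0" for z :: "complex^5"
  \<comment> \<open>Roots of \<open>F\<close> account for coincidences at finite points, the union
    for those at infinity, where finitely many pairs suffice.\<close>
  define B where "B = complex_of_real -` {z. poly F z = 0} \<union>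
    (\<Union>(v, w) \<in> {(v, w) \<in> Z\<^sub>1 \<times> Z\<^sub>2. curve_map m K\<^sub>1 v $ 0 = 0 \<and> curve_map n K\<^sub>2 w $ 0 = 0 \<and> \<not> flat (curve_map m K\<^sub>1 v)}.
       {\<tau>. same_point (curve_map m K\<^sub>1 v) (lin (monomial_translation M \<tau>) (curve_map n K\<^sub>2 w))})"
  have "finite (complex_of_real -` {z. poly F z = 0})"
    by (rule finite_vimageI[OF poly_roots_finite[OF F]]) (simp add: inj_on_def)
  moreover have "finite {(v, w) \<in> Z\<^sub>1 \<times> Z\<^sub>2. curve_map m K\<^sub>1 v $ 0 = 0 \<and> curve_map n K\<^sub>2 w $ 0 = 0 \<and> \<not> flat (curve_map m K\<^sub>1 v)}"
    by (rule finite_subset[OF _ finite_cartesian_product[OF Z1(1) Z2(1)]]) auto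
  ultimately have "finite B"
    unfolding B_def by (auto simp: flat_def intro!: finite_bad_at_infinity M)
  moreover have "curve_map m K\<^sub>1 v $ 0 = 0 \<and> flat (curve_map m K\<^sub>1 v)"
    if \<tau>: "\<tau> \<notin> B" and v: "v \<noteq> 0" and w: "w \<noteq> 0"
      and same: "same_point (curve_map m K\<^sub>1 v) (lin (monomial_translation M \<tau>) (curve_map n K\<^sub>2 (w::complex^2)))" for \<tau> v w
  proof -
    define X Y where "X = curve_map m K\<^sub>1 v" and "Y = curve_map n K\<^sub>2 w"
    obtain c where c: "c \<noteq> 0" "X = c *s lin (monomial_translation M \<tau>) Y"
      using same by (auto simp: same_point_def X_def Y_def)
    have X: "X $ 0 = c * Y $ 0" "X $ 1 = c * (Y $ 1 + of_real \<tau> * Y $ 0)"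
      "X $ 2 = c * (Y $ 2 + of_real \<tau> ^ M * Y $ 0)" "X $ 3 = c * (Y $ 3 + of_real \<tau> ^ M\<^sup>2 * Y $ 0)"
      by (simp_all add: c(2) lin_translation)
    have xX: "x 0 v = X $ 0" "x 1 v = X $ 1" "x 2 v = X $ 2" "x 3 v = X $ 3"
      "y 0 w = Y $ 0" "y 1 w = Y $ 1" "y 2 w = Y $ 2" "y 3 w = Y $ 3"
      by (simp_all add: x_def y_def X_def Y_def curve_map_nth)
    have "Y $ 0 = 0"
    proof (rule ccontr)
      assume Y: "Y $ 0 \<noteq> 0"
      \<comment> \<open>The affine difference of the two coinciding points is the translation
        vector, which lies on the monomial curve.\<close>
      have "poly F (of_real \<tau>) = 0"
        by (rule rel[of v w]) (use Y c(1) in \<open>unfold xX X, simp_all add: algebra_simps\<close>)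
      then show False using \<tau> by (simp add: B_def)
    qed
    then have 0: "X $ 0 = 0" "Y $ 0 = 0" using X by auto
    obtain a v' where v': "a \<noteq> 0" "v' \<in> Z\<^sub>1" "v = a *s v'" using Z1(3)[OF v] 0(1) by (auto simp: X_def curve_map_nth)
    obtain b w' where w': "b \<noteq> 0" "w' \<in> Z\<^sub>2" "w = b *s w'" using Z2(3)[OF w] 0(2) by (auto simp: Y_def curve_map_nth)
    have s: "same_point (curve_map m K\<^sub>1 v') (lin (monomial_translation M \<tau>) (curve_map n K\<^sub>2 w'))"
    proof -
      have "same_point (curve_map m K\<^sub>1 v') (curve_map m K\<^sub>1 v)"
        using same_point_scale[of "a ^ m" "curve_map m K\<^sub>1 v'"] v' by (simp add: curve_map_scale same_point_sym)
      moreover have "same_point (lin (monomial_translation M \<tau>) (curve_map n K\<^sub>2 w)) (lin (monomial_translation M \<tau>) (curve_map n K\<^sub>2 w'))"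
        using same_point_scale[of "b ^ n" "lin (monomial_translation M \<tau>) (curve_map n K\<^sub>2 w')"] w' by (simp add: curve_map_scale lin_scale)
      ultimately show ?thesis using same same_point_trans by blast
    qed
    have z: "curve_map m K\<^sub>1 v' $ 0 = 0" "curve_map n K\<^sub>2 w' $ 0 = 0"
      using 0 v' w' by (simp_all add: X_def Y_def curve_map_scale)
    have "flat (curve_map m K\<^sub>1 v')"
    proof (rule ccontr)
      assume "\<not> flat (curve_map m K\<^sub>1 v')"
      then have "\<tau> \<in> B" unfolding B_def using s z v'(2) w'(2) by blast
      then show False using \<tau> by blast
    qed
    then have "flat X" using v' by (simp add: X_def flat_def curve_map_scale)
    then show ?thesis using 0 by (simp add: X_def)
  qed
  ultimately show ?thesis using that[OF M, of B] unfolding flat_def by blast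
qed

subsection \<open>Moving a knot by a symmetry of the quadric close to the identity\<close>

lemma curve_subst_id:
  assumes "\<And>i. degree (k $ i) \<le> d"
  shows "curve_subst d (mat 1) k = k"
proof -
  have "form_subst d (mat 1) q = q" if "degree q \<le> d" for q
  proof -
    have "form_subst d (mat 1) q = (\<Sum>i\<le>d. monom (coeff q i) i)"
      by (simp add: form_subst_def mat_def monom_altdef flip: one_pCons)
    then show ?thesis using poly_as_sum_of_monoms'[OF that] by simp
  qed
  then show ?thesis using assms by (simp add: vec_eq_iff curve_subst_def)
qed

definition quadric_symmetries :: "(real^5^5) set" where
  "quadric_symmetries = {T. (\<forall>x. on_quadric x \<longrightarrow> on_quadric (T *v x)) \<and> (\<exists>T'. T' ** T = mat 1)}"

lemma real_rational_knot_lin: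
  assumes "real_rational_knot d k" "T \<in> quadric_symmetries"
  shows "real_rational_knot d (curve_lin T k)"
proof -
  obtain T' where T: "T' ** T = mat 1" "\<And>x. on_quadric x \<Longrightarrow> on_quadric (T *v x)"
    using assms(2) by (auto simp: quadric_symmetries_def)
  have "real_rational_knot d (curve_lin T (curve_subst d (mat 1) k))"
    by (rule real_rational_knot_transform[OF assms(1) T(1) _ T(2), of "mat 1"]) auto
  then show ?thesis using curve_subst_id assms(1) by (auto simp: real_rational_knot_iff)
qed

lemma mat_1_quadric_symmetries: "mat 1 \<in> quadric_symmetries"
  by (auto simp: quadric_symmetries_def intro: exI[of _ "mat 1"])

text \<open>This exhibits the Bezoutians of the moved curve as polynomials in the entries of
  \<open>T\<close>, so derivatives of the curve depend continuously on \<open>T\<close>.\<close>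

lemma bez_curve_lin:
  fixes v w :: "'a::real_normed_field ^ 2"
  assumes "w \<noteq> 0"
  shows "bez d (curve_lin T k $ i) (curve_lin T k $ j) v w =
    (\<Sum>l\<in>UNIV. \<Sum>m\<in>UNIV. of_real (T $ i $ l * T $ j $ m) * bez d (k $ l) (k $ m) v w)"
proof -
  have "\<forall>v. bez d (curve_lin T k $ i) (curve_lin T k $ j) v w =
    (\<Sum>l\<in>UNIV. \<Sum>m\<in>UNIV. of_real (T $ i $ l * T $ j $ m) * bez d (k $ l) (k $ m) v w)"
  proof (rule eq_by_brk_density[OF _ _ assms])
    fix v assume v: "brk v w \<noteq> 0"
    have "brk v w * bez d (curve_lin T k $ i) (curve_lin T k $ j) v w
        = (\<Sum>l\<in>UNIV. \<Sum>m\<in>UNIV. of_real (T $ i $ l * T $ j $ m) * (brk v w * bez d (k $ l) (k $ m) v w))"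
      unfolding minor_curve_map[symmetric] curve_map_lin minor_lin ..
    also have "\<dots> = brk v w * (\<Sum>l\<in>UNIV. \<Sum>m\<in>UNIV. of_real (T $ i $ l * T $ j $ m) * bez d (k $ l) (k $ m) v w)"
      by (simp add: sum_distrib_left mult_ac)
    finally show "bez d (curve_lin T k $ i) (curve_lin T k $ j) v w =
      (\<Sum>l\<in>UNIV. \<Sum>m\<in>UNIV. of_real (T $ i $ l * T $ j $ m) * bez d (k $ l) (k $ m) v w)"
      by (rule iffD1[OF mult_left_cancel[OF v]])
  qed (intro continuous_intros continuous_on_bez)+
  then show ?thesis by blast
qed

text \<open>Closeness to first order on a compact interval; [-10, 10] contains [0, pi], a full
  period, and the angles of absolute value less than 1 used at the node.\<close>

definition knot_close :: "real \<Rightarrow> nat \<Rightarrow> real poly ^ 5 \<Rightarrow> real poly ^ 5 \<Rightarrow> bool" where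
  "knot_close \<epsilon> d k' k \<longleftrightarrow> (\<forall>\<phi>\<in>{-10..10}. dist (knot_curve d k' \<phi>) (knot_curve d k \<phi>) \<le> \<epsilon> \<and>
     dist (knot_deriv d k' \<phi>) (knot_deriv d k \<phi>) \<le> \<epsilon>)"

lemma knot_close_trans: "knot_close a d k k' \<Longrightarrow> knot_close b d k' k'' \<Longrightarrow> knot_close (a + b) d k k''"
  unfolding knot_close_def
  by (meson add_mono dist_triangle order_trans)

text \<open>Curve and derivative are jointly continuous in symmetry and angle, and the interval is
  compact, so closeness at each angle becomes uniform. Only symmetries are considered because they
  keep the denominators away from zero.\<close>

lemma knot_close_near_identity:
  assumes k: "real_rational_knot d k" and \<epsilon>: "\<epsilon> > 0"
  obtains X where "open X" "mat 1 \<in> X" "\<And>T. T \<in> X \<Longrightarrow> T \<in> quadric_symmetries \<Longrightarrow> knot_close \<epsilon> d (curve_lin T k) k"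
proof -
  have id: "curve_lin (mat 1) k = k"
    by (simp add: curve_lin_def vec_eq_iff mat_def if_distrib[of "\<lambda>c. smult c _"] cong: if_cong)
  have nz: "(T *v curve_map d k (circ \<phi>)) $ 0 \<noteq> 0" if "T \<in> quadric_symmetries" for T \<phi>
    using curve_map_real_nonzero[OF real_rational_knot_lin[OF k that] circ_nonzero]
    by (simp add: curve_map_lin lin_real)
  have cnt: "continuous_on S (\<lambda>x. (fst x *v curve_map d k (circ (snd x))) $ i)" for S and i :: 5
    unfolding matrix_vector_mult_def
    by (auto intro!: continuous_intros continuous_on_component continuous_on_curve_map
        continuous_on_compose2[OF continuous_on_circ[of UNIV]])
  have c1: "continuous_on (quadric_symmetries \<times> {-10..10}) (\<lambda>x. knot_curve d (curve_lin (fst x) k) (snd x))"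
    unfolding knot_curve_def curve_map_lin lin_real
    by (rule continuous_on_eq[where f = "\<lambda>x. \<chi> i. (fst x *v curve_map d k (circ (snd x))) $ inc i / (fst x *v curve_map d k (circ (snd x))) $ 0"])
       (auto simp: vec_eq_iff affine_point_inc nz intro!: continuous_on_vec_lambda continuous_on_divide cnt)
  have c2: "continuous_on (quadric_symmetries \<times> {-10..10}) (\<lambda>x. knot_deriv d (curve_lin (fst x) k) (snd x))"
    unfolding knot_deriv_def curve_map_lin lin_real bez_curve_lin[OF circ_nonzero] using nz
    by (auto intro!: continuous_on_vec_lambda continuous_on_divide continuous_on_minus continuous_on_power cnt
        continuous_on_sum continuous_on_mult continuous_on_bez continuous_on_component continuous_on_fst
        continuous_on_id continuous_on_snd continuous_on_compose2[OF continuous_on_circ[of UNIV]])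
  obtain X1 where X1: "mat 1 \<in> X1" "open X1" "\<forall>T\<in>X1 \<inter> quadric_symmetries. \<forall>\<phi>\<in>{-10..10}.
      dist (knot_curve d (curve_lin (fst (T, \<phi>)) k) (snd (T, \<phi>))) (knot_curve d (curve_lin (fst (mat 1 :: real^5^5, \<phi>)) k) (snd (mat 1 :: real^5^5, \<phi>))) \<le> \<epsilon>"
    using continuous_on_prod_compactE[OF c1 compact_Icc mat_1_quadric_symmetries \<epsilon>] by metis
  obtain X2 where X2: "mat 1 \<in> X2" "open X2" "\<forall>T\<in>X2 \<inter> quadric_symmetries. \<forall>\<phi>\<in>{-10..10}.
      dist (knot_deriv d (curve_lin (fst (T, \<phi>)) k) (snd (T, \<phi>))) (knot_deriv d (curve_lin (fst (mat 1 :: real^5^5, \<phi>)) k) (snd (mat 1 :: real^5^5, \<phi>))) \<le> \<epsilon>"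
    using continuous_on_prod_compactE[OF c2 compact_Icc mat_1_quadric_symmetries \<epsilon>] by metis
  show ?thesis
  proof
    show "open (X1 \<inter> X2)" "mat 1 \<in> X1 \<inter> X2" using X1 X2 by auto
    show "knot_close \<epsilon> d (curve_lin T k) k" if "T \<in> X1 \<inter> X2" "T \<in> quadric_symmetries" for T
      using X1(3) X2(3) that by (auto simp: knot_close_def id)
  qed
qed

section \<open>Separating the homogenising coordinate from the other four\<close>

definition mk5 :: "real \<Rightarrow> real^4 \<Rightarrow> real^5" where
  "mk5 a q = (\<chi> i. if i = 0 then a else if i = 1 then q $ 1 else if i = 2 then q $ 2 else if i = 3 then q $ 3 else q $ 4)"

definition tl5 :: "real^5 \<Rightarrow> real^4" where
  "tl5 x = (\<chi> i. x $ inc i)"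

lemma mk5_nth [simp]: "mk5 a q $ 0 = a" "mk5 a q $ inc i = q $ i"
  using exhaust_4[of i] by (auto simp: mk5_def)

lemma tl5_nth [simp]: "tl5 x $ i = x $ inc i"
  by (simp add: tl5_def)

lemma tl5_mk5 [simp]: "tl5 (mk5 a q) = q"
  by (simp add: vec_eq_iff)

lemma mk5_tl5: "mk5 (x $ 0) (tl5 x) = x"
  by (simp add: vec5_eq_iff)

lemma hom_point_mk5: "hom_point p = mk5 1 p"
  by (simp add: vec5_eq_iff)

lemma on_quadric_mk5: "on_quadric (mk5 a q) \<longleftrightarrow> (norm q)\<^sup>2 = a\<^sup>2"
  unfolding norm_vec4 on_quadric_def by (simp add: mk5_def)

lemma on_quadric_tl5: "on_quadric x \<longleftrightarrow> (norm (tl5 x))\<^sup>2 = (x $ 0)\<^sup>2"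
  using on_quadric_mk5[of "x $ 0" "tl5 x"] by (simp add: mk5_tl5)

lemma matrix_real: "linear f \<Longrightarrow> matrix f *v x = f (x::real^'n)"
  by (rule matrix_works) (simp add: linear_def scalar_mult_eq_scaleR)

lemma linear_tl5: "linear tl5"
  by (rule linearI) (simp_all add: vec_eq_iff)

lemma linear_mk5: "linear f \<Longrightarrow> linear g \<Longrightarrow> linear (\<lambda>x. mk5 (f x) (g x))"
  by (rule linearI) (simp_all add: vec5_eq_iff linear_add linear_scale)

lemma matrix_left_inverse:
  assumes "linear f" "linear (g :: real^'n \<Rightarrow> real^'n)" "\<And>x. g (f x) = x"
  shows "matrix g ** matrix f = mat 1"
proof -
  have "g \<circ> f = id" using assms(3) by auto
  then show ?thesis using matrix_compose[OF assms(1,2)] by (simp add: matrix_id_mat_1)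
qed

lemma base_real:
  assumes "curve_map d k (vector [0, 1] :: real^2) = hom_point p"
  shows "knot_curve d k 0 = p" and "knot_curve d k pi = p"
proof -
  have "circ 0 = vector [0, 1]" by (simp add: circ_def)
  then show "knot_curve d k 0 = p" by (simp add: knot_curve_def assms)
  then show "knot_curve d k pi = p" using knot_curve_periodic[of d k 0] by simp
qed

lemma knot_deriv_orthogonal:
  assumes "real_rational_knot d k"
  shows "knot_curve d k \<phi> \<bullet> knot_deriv d k \<phi> = 0"
proof -
  have "((\<lambda>\<phi>. knot_curve d k \<phi> \<bullet> knot_curve d k \<phi>) has_vector_derivative
      (knot_curve d k \<phi> \<bullet> knot_deriv d k \<phi> + knot_deriv d k \<phi> \<bullet> knot_curve d k \<phi>)) (at \<phi>)"
    using bounded_bilinear.has_vector_derivative[OF bounded_bilinear_inner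
        knot_curve_has_derivative[OF assms] knot_curve_has_derivative[OF assms]] .
  moreover have "(\<lambda>\<phi>. knot_curve d k \<phi> \<bullet> knot_curve d k \<phi>) = (\<lambda>\<phi>. 1)"
    using knot_curve_sphere[OF assms] by (auto simp: dot_square_norm)
  ultimately have "knot_curve d k \<phi> \<bullet> knot_deriv d k \<phi> + knot_deriv d k \<phi> \<bullet> knot_curve d k \<phi> = 0"
    using vector_derivative_unique_at[OF _ has_vector_derivative_const] by metis
  then show ?thesis by (simp add: inner_commute)
qed

text \<open>\<open>T\<close> acts on velocity vectors modulo the base vector. Subtracting the
  multiple of \<open>p\<close> returns the image to the representative with coordinate 0 equal to
  zero.\<close>

lemma knot_deriv_lin:
  assumes base: "curve_map d k (vector [0, 1] :: real^2) = hom_point p"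
    and T: "T *v hom_point p = hom_point p"
  defines "t \<equiv> T *v mk5 0 (knot_deriv d k 0)"
  shows "knot_deriv d (curve_lin T k) 0 = tl5 t - t $ 0 *\<^sub>R p"
proof -
  define D where "D = curve_dq d k 0 (0::real)"
  have base': "curve_map d (curve_lin T k) (vector [0, 1] :: real^2) = hom_point p"
    by (simp add: curve_map_lin lin_real base T)
  have 1: "knot_deriv d k 0 $ i = minor D (hom_point p) (inc i) 0" for i
    unfolding D_def using base by (subst knot_deriv_base) (simp_all add: bez_at_base)
  \<comment> \<open>The velocity of the homogeneous lift differs from the affine velocity by a
    multiple of the base vector, which the minors do not see.\<close>
  have D: "D = mk5 0 (knot_deriv d k 0) + D $ 0 *\<^sub>R hom_point p"
    by (simp add: vec5_eq_iff 1 minor_def)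
  have 2: "minor (lin T x) (lin T y) i j = (\<Sum>l\<in>UNIV. \<Sum>m\<in>UNIV. T $ i $ l * T $ j $ m * minor x y l m)" for x y :: "real^5" and i j
    using minor_lin[of T x y i j] by simp
  have "(vector [0, 1] :: real^2) \<noteq> 0" by (simp add: vec2_neq_0_iff)
  then have "knot_deriv d (curve_lin T k) 0 $ i = minor (T *v D) (T *v hom_point p) (inc i) 0" for i
    using base' by (subst knot_deriv_base)
      (simp_all add: bez_curve_lin bez_at_base[OF base] 2 D_def flip: lin_real)
  moreover have "T *v D = t + D $ 0 *\<^sub>R hom_point p"
    by (subst D) (simp add: t_def matrix_vector_right_distrib T scaleR_matrix_vector_assoc matrix_vector_mult_scaleR)
  ultimately show ?thesis
    by (simp add: vec_eq_iff T minor_def algebra_simps)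
qed

subsection \<open>General position\<close>

text \<open>For orthonormal \<open>s\<close> and \<open>q\<close>, the rotation by \<alpha> from
  \<open>s\<close> towards \<open>q\<close> that is the identity on the orthogonal
  complement.\<close>

definition plane_rotation :: "real^4 \<Rightarrow> real^4 \<Rightarrow> real \<Rightarrow> real^4 \<Rightarrow> real^4" where
  "plane_rotation s q \<alpha> x = x + ((cos \<alpha> - 1) * (x \<bullet> s) - sin \<alpha> * (x \<bullet> q)) *\<^sub>R s
     + ((cos \<alpha> - 1) * (x \<bullet> q) + sin \<alpha> * (x \<bullet> s)) *\<^sub>R q"

lemma linear_plane_rotation: "linear (plane_rotation s q \<alpha>)"
  by (rule linearI) (simp_all add: plane_rotation_def algebra_simps inner_add_left)

context
  fixes s q :: "real^4"
  assumes sq: "norm s = 1" "norm q = 1" "s \<bullet> q = 0"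
begin

lemma plane_rotation_inner: "plane_rotation s q \<alpha> x \<bullet> s = cos \<alpha> * (x \<bullet> s) - sin \<alpha> * (x \<bullet> q)"
  "plane_rotation s q \<alpha> x \<bullet> q = cos \<alpha> * (x \<bullet> q) + sin \<alpha> * (x \<bullet> s)"
  using sq by (simp_all add: plane_rotation_def inner_add_left inner_commute[of q s] dot_square_norm algebra_simps)

lemma plane_rotation_inverse: "plane_rotation s q (- \<alpha>) (plane_rotation s q \<alpha> x) = x"
proof -
  have sc: "sin \<alpha> * sin \<alpha> = 1 - cos \<alpha> * cos \<alpha>"
    using sin_cos_squared_add[of \<alpha>] by (simp add: power2_eq_square)
  have "plane_rotation s q (- \<alpha>) y = y + ((cos \<alpha> - 1) * (y \<bullet> s) + sin \<alpha> * (y \<bullet> q)) *\<^sub>R s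
     + ((cos \<alpha> - 1) * (y \<bullet> q) - sin \<alpha> * (y \<bullet> s)) *\<^sub>R q" for y
    by (simp add: plane_rotation_def)
  then have "plane_rotation s q (- \<alpha>) (plane_rotation s q \<alpha> x) = plane_rotation s q \<alpha> x
     + ((cos \<alpha> - 1) * (cos \<alpha> * (x \<bullet> s) - sin \<alpha> * (x \<bullet> q)) + sin \<alpha> * (cos \<alpha> * (x \<bullet> q) + sin \<alpha> * (x \<bullet> s))) *\<^sub>R s
     + ((cos \<alpha> - 1) * (cos \<alpha> * (x \<bullet> q) + sin \<alpha> * (x \<bullet> s)) - sin \<alpha> * (cos \<alpha> * (x \<bullet> s) - sin \<alpha> * (x \<bullet> q))) *\<^sub>R q"
    by (simp only: plane_rotation_inner)
  also have "(cos \<alpha> - 1) * (cos \<alpha> * (x \<bullet> s) - sin \<alpha> * (x \<bullet> q)) + sin \<alpha> * (cos \<alpha> * (x \<bullet> q) + sin \<alpha> * (x \<bullet> s))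
     = - ((cos \<alpha> - 1) * (x \<bullet> s) - sin \<alpha> * (x \<bullet> q))"
    using sc by algebra
  also have "(cos \<alpha> - 1) * (cos \<alpha> * (x \<bullet> q) + sin \<alpha> * (x \<bullet> s)) - sin \<alpha> * (cos \<alpha> * (x \<bullet> s) - sin \<alpha> * (x \<bullet> q))
     = - ((cos \<alpha> - 1) * (x \<bullet> q) + sin \<alpha> * (x \<bullet> s))"
    using sc by algebra
  finally show ?thesis by (simp add: plane_rotation_def algebra_simps)
qed

lemma norm_plane_rotation: "norm (plane_rotation s q \<alpha> x) = norm x"
proof -
  have sc: "sin \<alpha> * sin \<alpha> = 1 - cos \<alpha> * cos \<alpha>"
    using sin_cos_squared_add[of \<alpha>] by (simp add: power2_eq_square)
  have "plane_rotation s q \<alpha> x \<bullet> plane_rotation s q \<alpha> x = plane_rotation s q \<alpha> x \<bullet> x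
      + ((cos \<alpha> - 1) * (x \<bullet> s) - sin \<alpha> * (x \<bullet> q)) * (plane_rotation s q \<alpha> x \<bullet> s)
      + ((cos \<alpha> - 1) * (x \<bullet> q) + sin \<alpha> * (x \<bullet> s)) * (plane_rotation s q \<alpha> x \<bullet> q)"
    by (subst (2) plane_rotation_def) (simp only: inner_add_right inner_scaleR_right)
  also have "plane_rotation s q \<alpha> x \<bullet> x = x \<bullet> x + ((cos \<alpha> - 1) * (x \<bullet> s) - sin \<alpha> * (x \<bullet> q)) * (x \<bullet> s)
      + ((cos \<alpha> - 1) * (x \<bullet> q) + sin \<alpha> * (x \<bullet> s)) * (x \<bullet> q)"
    by (simp only: plane_rotation_def inner_add_left inner_scaleR_left inner_commute[of s x] inner_commute[of q x])
  finally have "plane_rotation s q \<alpha> x \<bullet> plane_rotation s q \<alpha> x = x \<bullet> x"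
    unfolding plane_rotation_inner using sc by algebra
  then show ?thesis by (simp add: norm_eq_sqrt_inner)
qed

end

definition rotation5 :: "real^4 \<Rightarrow> real^4 \<Rightarrow> real \<Rightarrow> real^5^5" where
  "rotation5 s q \<alpha> = matrix (\<lambda>x. mk5 (x $ 0) (plane_rotation s q \<alpha> (tl5 x)))"

lemma linear_rotation5: "linear (\<lambda>x. mk5 (x $ 0) (plane_rotation s q \<alpha> (tl5 x)))"
  using linear_compose[OF linear_tl5 linear_plane_rotation]
  by (intro linear_mk5) (auto simp: o_def intro!: linearI)

lemma rotation5_vec: "rotation5 s q \<alpha> *v x = mk5 (x $ 0) (plane_rotation s q \<alpha> (tl5 x))"
  unfolding rotation5_def by (rule matrix_real[OF linear_rotation5])

lemma rotation5_symmetry: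
  assumes "norm s = 1" "norm q = 1" "s \<bullet> q = 0"
  shows "rotation5 s q \<alpha> \<in> quadric_symmetries"
  unfolding quadric_symmetries_def
proof (intro CollectI conjI exI[of _ "rotation5 s q (- \<alpha>)"] allI impI)
  show "on_quadric (rotation5 s q \<alpha> *v x)" if "on_quadric x" for x
    using that by (simp add: rotation5_vec on_quadric_tl5 norm_plane_rotation[OF assms])
  show "rotation5 s q (- \<alpha>) ** rotation5 s q \<alpha> = mat 1"
    unfolding rotation5_def
    by (rule matrix_left_inverse[OF linear_rotation5 linear_rotation5])
       (simp add: plane_rotation_inverse[OF assms] mk5_tl5)
qed

lemma tendsto_rotation5: "((\<lambda>\<alpha>. rotation5 s q \<alpha>) \<longlongrightarrow> mat 1) (at 0)"
proof (intro vec_tendstoI)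
  fix i j :: 5
  have tr: "((\<lambda>\<alpha>. plane_rotation s q \<alpha> x $ l) \<longlongrightarrow> x $ l) (at 0)" for x l
    unfolding plane_rotation_def by (auto intro!: tendsto_eq_intros)
  have *: "(mat 1 :: real^5^5) $ i $ j = axis j 1 $ i" by (simp add: mat_def axis_def)
  from tr[of "tl5 (axis j 1)"] have "((\<lambda>\<alpha>. mk5 (axis j 1 $ 0) (plane_rotation s q \<alpha> (tl5 (axis j 1))) $ i) \<longlongrightarrow> mk5 (axis j 1 $ 0) (tl5 (axis j 1)) $ i) (at 0)"
    by (cases i rule: index5_cases) auto
  then show "((\<lambda>\<alpha>. rotation5 s q \<alpha> $ i $ j) \<longlongrightarrow> mat 1 $ i $ j) (at 0)"
    using * by (simp add: rotation5_def matrix_def mk5_tl5)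
qed

text \<open>If the tangents agree, \<open>k\<^sub>2\<close> is rotated in the plane of its tangent
  and a direction \<open>q\<close> orthogonal to both the tangent and p. This fixes p and gives the
  tangent a component along \<open>q\<close>.\<close>

lemma independent_tangents:
  assumes k1: "real_rational_knot m k\<^sub>1" and k2: "real_rational_knot n k\<^sub>2"
    and base: "curve_map m k\<^sub>1 (vector [0, 1] :: real^2) = hom_point p"
      "curve_map n k\<^sub>2 (vector [0, 1] :: real^2) = hom_point p" and \<epsilon>: "\<epsilon> > 0"
  obtains k\<^sub>2' where "real_rational_knot n k\<^sub>2'" "curve_map n k\<^sub>2' (vector [0, 1] :: real^2) = hom_point p"
    "knot_close \<epsilon> n k\<^sub>2' k\<^sub>2" "\<not> collinear {0, knot_deriv m k\<^sub>1 0, knot_deriv n k\<^sub>2' 0}"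
proof (cases "collinear {0, knot_deriv m k\<^sub>1 0, knot_deriv n k\<^sub>2 0}")
  case False
  moreover have "knot_close \<epsilon> n k\<^sub>2 k\<^sub>2" using \<epsilon> by (simp add: knot_close_def)
  ultimately show ?thesis using that k2 base by blast
next
  case True
  define a where "a = knot_deriv n k\<^sub>2 0"
  have a: "a \<noteq> 0" "p \<bullet> a = 0"
    using knot_deriv_nonzero[OF k2] knot_deriv_orthogonal[OF k2, of 0] base_real[OF base(2)] by (simp_all add: a_def)
  obtain c where c: "knot_deriv m k\<^sub>1 0 = c *\<^sub>R a" "c \<noteq> 0"
  proof -
    have "collinear {0, a, knot_deriv m k\<^sub>1 0}" using True by (simp add: a_def insert_commute)
    then obtain c where "knot_deriv m k\<^sub>1 0 = c *\<^sub>R a" using a(1) knot_deriv_nonzero[OF k1] by (auto simp: collinear_lemma)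
    then show ?thesis using that knot_deriv_nonzero[OF k1, of 0] by auto
  qed
  obtain q\<^sub>0 :: "4 \<Rightarrow> real" where q0: "\<exists>i. q\<^sub>0 i \<noteq> 0" "\<forall>e\<in>{p, a}. (\<Sum>i\<in>UNIV. q\<^sub>0 i * e $ i) = 0"
  proof -
    have "card {p, a} < card (UNIV :: 4 set)"
      using card_insert_le_m1[of 2 "{a}" p] by simp
    then show ?thesis using that underdetermined_system[of "{p, a}" "UNIV :: 4 set" "\<lambda>e i. e $ i"] by auto
  qed
  define q where "q = (1 / norm (\<chi> i. q\<^sub>0 i)) *\<^sub>R (\<chi> i. q\<^sub>0 i)"
  define s where "s = (1 / norm a) *\<^sub>R a"
  have "(\<chi> i. q\<^sub>0 i) \<noteq> 0" using q0(1) by (auto simp: vec_eq_iff)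
  then have q: "norm q = 1" "q \<bullet> p = 0" "q \<bullet> a = 0"
    using q0(2) by (simp_all add: q_def inner_vec_def flip: sum_divide_distrib)
  have s: "norm s = 1" "s \<bullet> p = 0" "s \<bullet> q = 0"
    using a q by (simp_all add: s_def inner_commute)
  obtain X where X: "open X" "mat 1 \<in> X"
    "\<And>T. T \<in> X \<Longrightarrow> T \<in> quadric_symmetries \<Longrightarrow> knot_close \<epsilon> n (curve_lin T k\<^sub>2) k\<^sub>2"
    using knot_close_near_identity[OF k2 \<epsilon>] by metis
  have "\<forall>\<^sub>F \<alpha> in at 0. rotation5 s q \<alpha> \<in> X"
    using topological_tendstoD[OF tendsto_rotation5 X(1,2)] .
  then obtain d where d: "d > 0" "\<And>\<alpha>. \<alpha> \<noteq> 0 \<Longrightarrow> \<bar>\<alpha>\<bar> < d \<Longrightarrow> rotation5 s q \<alpha> \<in> X"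
    unfolding eventually_at by (auto simp: dist_real_def)
  \<comment> \<open>The bound 1 keeps the angle below pi, where the sine is positive.\<close>
  define \<alpha> where "\<alpha> = min (d / 2) 1"
  have \<alpha>: "0 < \<alpha>" "\<alpha> < pi" "rotation5 s q \<alpha> \<in> X"
    using d pi_gt3 by (auto simp: \<alpha>_def intro!: d(2))
  define T where "T = rotation5 s q \<alpha>"
  have T: "T \<in> quadric_symmetries" unfolding T_def by (rule rotation5_symmetry[OF s(1) q(1) s(3)])
  have Tp: "T *v hom_point p = hom_point p"
    using s q by (simp add: T_def rotation5_vec hom_point_mk5 plane_rotation_def inner_commute)
  have "knot_deriv n (curve_lin T k\<^sub>2) 0 = plane_rotation s q \<alpha> a"
    using knot_deriv_lin[OF base(2) Tp] by (simp add: a_def T_def rotation5_vec)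
  moreover have "\<not> collinear {0, knot_deriv m k\<^sub>1 0, plane_rotation s q \<alpha> a}"
  proof
    assume "collinear {0, knot_deriv m k\<^sub>1 0, plane_rotation s q \<alpha> a}"
    moreover have "plane_rotation s q \<alpha> a \<noteq> 0" using norm_plane_rotation[OF s(1) q(1) s(3), of \<alpha> a] a by auto
    ultimately obtain c' where c': "plane_rotation s q \<alpha> a = c' *\<^sub>R c *\<^sub>R a"
      using c a(1) by (auto simp: collinear_lemma)
    have "plane_rotation s q \<alpha> a \<bullet> q = sin \<alpha> * norm a"
      using a by (simp add: plane_rotation_inner[OF s(1) q(1) s(3)] inner_commute[of a q] q(3)) (simp add: s_def dot_square_norm power2_eq_square)
    moreover have "plane_rotation s q \<alpha> a \<bullet> q = 0" unfolding c' using q(3) by (simp add: inner_commute)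
    ultimately show False using sin_gt_zero[OF \<alpha>(1,2)] a(1) by simp
  qed
  ultimately show ?thesis
    using that[of "curve_lin T k\<^sub>2"] real_rational_knot_lin[OF k2 T] X(3)[OF _ T] \<alpha>(3) base(2) Tp
    by (simp add: curve_map_lin lin_real T_def)
qed

text \<open>Stereographic coordinates from \<open>p\<close>: if \<open>f\<close> is an isometry with \<open>f p = (1, 0, 0, 0)\<close>,
  the five coordinates are the denominator, the three numerators and the form that makes the
  quadric \<open>y\<^sub>0 y\<^sub>4 = y\<^sub>1\<^sup>2 + y\<^sub>2\<^sup>2 + y\<^sub>3\<^sup>2\<close>.\<close>

definition stereo :: "(real^4 \<Rightarrow> real^4) \<Rightarrow> real^5 \<Rightarrow> real^5" where
  "stereo f x = (\<chi> i. if i = 0 then x $ 0 - f (tl5 x) $ 1 else if i = 1 then f (tl5 x) $ 2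
     else if i = 2 then f (tl5 x) $ 3 else if i = 3 then f (tl5 x) $ 4 else x $ 0 + f (tl5 x) $ 1)"

definition unstereo :: "(real^4 \<Rightarrow> real^4) \<Rightarrow> real^5 \<Rightarrow> real^5" where
  "unstereo g y = mk5 ((y $ 0 + y $ 4) / 2) (g (vector [(y $ 4 - y $ 0) / 2, y $ 1, y $ 2, y $ 3]))"

lemma stereo_nth:
  "stereo f x $ 0 = x $ 0 - f (tl5 x) $ 1" "stereo f x $ 1 = f (tl5 x) $ 2" "stereo f x $ 2 = f (tl5 x) $ 3"
  "stereo f x $ 3 = f (tl5 x) $ 4" "stereo f x $ 4 = x $ 0 + f (tl5 x) $ 1"
  by (simp_all add: stereo_def)

lemma linear_stereo:
  assumes "linear f"
  shows "linear (stereo f)"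
proof -
  have l: "linear (\<lambda>x. f (tl5 x))" using linear_compose[OF linear_tl5 assms] by (simp add: o_def)
  show ?thesis
    by (rule linearI) (simp_all add: vec_eq_iff forall_5 stereo_nth linear_add[OF l] linear_scale[OF l] algebra_simps)
qed

lemma vec4_eq_iff: "(x::'a^4) = y \<longleftrightarrow> x $ 1 = y $ 1 \<and> x $ 2 = y $ 2 \<and> x $ 3 = y $ 3 \<and> x $ 4 = y $ 4"
  by (simp add: vec_eq_iff forall_4)

lemma vector4_nth:
  "(vector [a, b, c, d] :: 'a::zero^4) $ 1 = a" "(vector [a, b, c, d] :: 'a^4) $ 2 = b"
  "(vector [a, b, c, d] :: 'a^4) $ 3 = c" "(vector [a, b, c, d] :: 'a^4) $ 4 = d"
  by (simp_all add: vector_def)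

lemma linear_unstereo:
  assumes "linear g"
  shows "linear (unstereo g)"
  unfolding unstereo_def
proof (rule linear_mk5)
  show "linear (\<lambda>y::real^5. (y $ 0 + y $ 4) / 2)" by (rule linearI) (simp_all add: field_simps)
  have "linear (\<lambda>y::real^5. vector [(y $ 4 - y $ 0) / 2, y $ 1, y $ 2, y $ 3] :: real^4)"
    by (rule linearI) (simp_all add: vec4_eq_iff vector4_nth field_simps)
  from linear_compose[OF this assms]
  show "linear (\<lambda>y::real^5. g (vector [(y $ 4 - y $ 0) / 2, y $ 1, y $ 2, y $ 3]))" by (simp add: o_def)
qed

lemma unstereo_stereo:
  assumes "\<And>x. g (f x) = x"
  shows "unstereo g (stereo f x) = x"
proof -
  have "vector [(stereo f x $ 4 - stereo f x $ 0) / 2, stereo f x $ 1, stereo f x $ 2, stereo f x $ 3] = f (tl5 x)"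
    by (simp add: vec4_eq_iff vector4_nth stereo_nth)
  then show ?thesis by (simp add: unstereo_def assms stereo_nth mk5_tl5)
qed

lemma stereo_unstereo:
  assumes "\<And>x. f (g x) = x"
  shows "stereo f (unstereo g y) = y"
  by (simp add: vec_eq_iff forall_5 stereo_nth unstereo_def assms vector4_nth field_simps)

definition flat_quadric :: "real^5 \<Rightarrow> bool" where
  "flat_quadric y \<longleftrightarrow> y $ 0 * y $ 4 = (y $ 1)\<^sup>2 + (y $ 2)\<^sup>2 + (y $ 3)\<^sup>2"

lemma flat_quadric_stereo:
  assumes "\<And>x. norm (f x) = norm x"
  shows "flat_quadric (stereo f x) \<longleftrightarrow> on_quadric x"
proof -
  have "(norm (tl5 x))\<^sup>2 = (f (tl5 x) $ 1)\<^sup>2 + (f (tl5 x) $ 2)\<^sup>2 + (f (tl5 x) $ 3)\<^sup>2 + (f (tl5 x) $ 4)\<^sup>2"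
    using norm_vec4[of "f (tl5 x)"] assms by simp
  then show ?thesis
    unfolding flat_quadric_def on_quadric_tl5 stereo_nth by (auto simp: power2_eq_square algebra_simps)
qed

lemma flat_quadric_translation: "flat_quadric y \<Longrightarrow> flat_quadric (translation a b c *v y)"
  unfolding flat_quadric_def lin_real[symmetric] lin_translation by (simp add: power2_eq_square algebra_simps)

lemma translation_inverse: "translation (-a) (-b) (-c) ** translation a b c = mat 1"
proof -
  have "(translation (-a) (-b) (-c) ** translation a b c) *v y = mat 1 *v y" for y :: "real^5"
    unfolding lin_real[symmetric] lin_mult
    by (simp add: vec_eq_iff forall_5 lin_translation power2_eq_square algebra_simps)
  then show ?thesis using matrix_eq by blast
qed

lemma tendsto_monomial_translation:
  assumes "M \<ge> 2"
  shows "((\<lambda>\<tau>. monomial_translation M \<tau>) \<longlongrightarrow> mat 1) (at 0)"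
proof (intro vec_tendstoI)
  fix i j :: 5
  have z: "((0::real) ^ M) = 0" "((0::real) ^ M\<^sup>2) = 0" "M > 0" using assms by auto
  have t: "((\<lambda>\<tau>::real. \<tau>) \<longlongrightarrow> 0) (at 0)" "((\<lambda>\<tau>::real. \<tau> ^ M) \<longlongrightarrow> 0) (at 0)" "((\<lambda>\<tau>::real. \<tau> ^ M\<^sup>2) \<longlongrightarrow> 0) (at 0)"
    using z tendsto_power[OF tendsto_ident_at[of "0::real" UNIV], of M] tendsto_power[OF tendsto_ident_at[of "0::real" UNIV], of "M\<^sup>2"]
    by auto
  have t2: "((\<lambda>\<tau>::real. \<tau>\<^sup>2 + (\<tau> ^ M)\<^sup>2 + (\<tau> ^ M\<^sup>2)\<^sup>2) \<longlongrightarrow> 0) (at 0)"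
    "((\<lambda>\<tau>::real. 2 * \<tau>) \<longlongrightarrow> 0) (at 0)" "((\<lambda>\<tau>::real. 2 * \<tau> ^ M) \<longlongrightarrow> 0) (at 0)" "((\<lambda>\<tau>::real. 2 * \<tau> ^ M\<^sup>2) \<longlongrightarrow> 0) (at 0)"
    using t z by (auto intro!: tendsto_eq_intros)
  show "((\<lambda>\<tau>. monomial_translation M \<tau> $ i $ j) \<longlongrightarrow> mat 1 $ i $ j) (at 0)"
    using exhaust_5[of i] exhaust_5[of j] t t2
    by (elim disjE; simp only: translation_def mat_def vec_lambda_beta; simp)
qed

text \<open>In stereographic coordinates from p the two curves are separated by a small generic
  translation, which fixes p. Keeping the derivative at 0 is part of the claim because independence
  of the tangents must not be lost.\<close>

theorem disjoint_perturbation: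
  assumes k1: "real_rational_knot m k\<^sub>1" and k2: "real_rational_knot n k\<^sub>2"
    and base: "curve_map m k\<^sub>1 (vector [0, 1] :: real^2) = hom_point p"
      "curve_map n k\<^sub>2 (vector [0, 1] :: real^2) = hom_point p" and \<epsilon>: "\<epsilon> > 0"
  obtains k\<^sub>2' where "real_rational_knot n k\<^sub>2'" "curve_map n k\<^sub>2' (vector [0, 1] :: real^2) = hom_point p"
    "knot_close \<epsilon> n k\<^sub>2' k\<^sub>2" "knot_deriv n k\<^sub>2' 0 = knot_deriv n k\<^sub>2 0"
    "\<And>v w :: complex^2. v \<noteq> 0 \<Longrightarrow> w \<noteq> 0 \<Longrightarrow>
      same_point (curve_map m k\<^sub>1 v) (curve_map n k\<^sub>2' w) \<Longrightarrow> same_point (curve_map m k\<^sub>1 v) (of_real_vec (hom_point p))"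
proof -
  have pn: "norm p = 1" using knot_curve_sphere[OF k1, of 0] base_real[OF base(1)] by simp
  obtain f :: "real^4 \<Rightarrow> real^4" where f: "orthogonal_transformation f" "f p = axis (1::4) 1"
    using orthogonal_transformation_exists[of p "axis (1::4) 1"] pn by auto
  define g where "g = inv f"
  have fg: "f (g x) = x" "g (f x) = x" for x
    using orthogonal_transformation_surj[OF f(1)] orthogonal_transformation_inj[OF f(1)]
    by (simp_all add: g_def surj_f_inv_f)
  have lf: "linear f" and nf: "\<And>x. norm (f x) = norm x" and inf: "\<And>x y. f x \<bullet> f y = x \<bullet> y"
    using f(1) unfolding orthogonal_transformation by (auto simp: f(1)[unfolded orthogonal_transformation_def])
  have lg: "linear g"
    by (rule linearI) (metis fg lf linear_add linear_scale)+
  have f1: "f x $ 1 = x \<bullet> p" for x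
    using inf[of x p] by (simp add: f(2) inner_axis)
  define S where "S = matrix (stereo f)"
  define S' where "S' = matrix (unstereo g)"
  have S: "S *v x = stereo f x" "S' *v x = unstereo g x" for x
    unfolding S_def S'_def by (simp_all add: matrix_real linear_stereo[OF lf] linear_unstereo[OF lg])
  have S'S: "S' ** S = mat 1" and SS': "S ** S' = mat 1"
    unfolding S_def S'_def
    by (rule matrix_left_inverse; simp add: linear_stereo[OF lf] linear_unstereo[OF lg] unstereo_stereo[of g f, OF fg(2)] stereo_unstereo[of f g, OF fg(1)])+
  define K\<^sub>1 where "K\<^sub>1 = curve_lin S k\<^sub>1"
  define K\<^sub>2 where "K\<^sub>2 = curve_lin S k\<^sub>2"
  have deg: "degree (K\<^sub>1 $ i) \<le> m" "degree (K\<^sub>2 $ i) \<le> n" for i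
    unfolding K\<^sub>1_def K\<^sub>2_def using k1 k2 by (auto intro!: degree_curve_lin simp: real_rational_knot_iff)
  \<comment> \<open>The denominator is x0 - x \<bullet> p, zero at a real point of the quadric only
    if that point is p. At the angle pi / 2 the curve is away from p by injectivity.\<close>
  have nz: "curve_lin S k $ 0 \<noteq> 0" if k: "real_rational_knot d k" and b: "curve_map d k (vector [0, 1] :: real^2) = hom_point p" for d k
  proof
    assume 0: "curve_lin S k $ 0 = 0"
    define x where "x = curve_map d k (circ (pi / 2))"
    have x0: "x $ 0 \<noteq> 0" unfolding x_def by (rule curve_map_real_nonzero[OF k circ_nonzero])
    have "curve_map d (curve_lin S k) (circ (pi / 2)) $ 0 = 0" by (simp add: curve_map_nth 0 form_eval_0)
    then have "x $ 0 = tl5 x \<bullet> p"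
      by (simp add: curve_map_lin lin_real S stereo_nth f1 x_def)
    moreover have "tl5 x = x $ 0 *\<^sub>R knot_curve d k (pi / 2)"
      using x0 by (simp add: vec_eq_iff knot_curve_def x_def affine_point_inc)
    ultimately have "knot_curve d k (pi / 2) \<bullet> p = 1" using x0 by simp
    moreover have "norm (knot_curve d k (pi / 2)) = 1" using knot_curve_sphere[OF k] by simp
    ultimately have "(knot_curve d k (pi / 2) - p) \<bullet> (knot_curve d k (pi / 2) - p) = 0"
      unfolding inner_diff_left inner_diff_right using pn by (simp add: inner_commute dot_square_norm)
    then have "knot_curve d k (pi / 2) = knot_curve d k 0" using base_real[OF b] by simp
    then show False using knot_curve_eq_iff[OF k] by simp
  qed
  obtain M B where M: "M \<ge> 2" and B: "finite B" and gen: "\<And>\<tau> v w. \<tau> \<notin> B \<Longrightarrow> v \<noteq> 0 \<Longrightarrow> w \<noteq> 0 \<Longrightarrow>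
       same_point (curve_map m K\<^sub>1 v) (lin (monomial_translation M \<tau>) (curve_map n K\<^sub>2 (w::complex^2))) \<Longrightarrow>
       curve_map m K\<^sub>1 v $ 0 = 0 \<and> curve_map m K\<^sub>1 v $ 1 = 0 \<and> curve_map m K\<^sub>1 v $ 2 = 0 \<and> curve_map m K\<^sub>1 v $ 3 = 0"
    using generic_translation[of K\<^sub>1 m K\<^sub>2 n, OF deg nz[OF k1 base(1), folded K\<^sub>1_def] nz[OF k2 base(2), folded K\<^sub>2_def]] by metis
  define T where "T \<tau> = S' ** (monomial_translation M \<tau> ** S)" for \<tau>
  have Tx: "T \<tau> *v x = unstereo g (monomial_translation M \<tau> *v stereo f x)" for \<tau> x
    by (simp add: T_def S flip: matrix_vector_mul_assoc)
  have Tsym: "T \<tau> \<in> quadric_symmetries" for \<tau>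
    unfolding quadric_symmetries_def
  proof (intro CollectI conjI allI impI exI[of _ "S' ** (translation (-\<tau>) (- (\<tau> ^ M)) (- (\<tau> ^ M\<^sup>2)) ** S)"])
    fix x assume "on_quadric x"
    then have "flat_quadric (monomial_translation M \<tau> *v stereo f x)"
      using flat_quadric_stereo[of f, OF nf] flat_quadric_translation by blast
    then show "on_quadric (T \<tau> *v x)"
      unfolding Tx using flat_quadric_stereo[of f, OF nf, of "unstereo g _"] stereo_unstereo[of f g, OF fg(1)] by metis
  next
    show "(S' ** (translation (-\<tau>) (- (\<tau> ^ M)) (- (\<tau> ^ M\<^sup>2)) ** S)) ** T \<tau> = mat 1"
      unfolding T_def by (metis SS' S'S matrix_mul_assoc matrix_mul_lid translation_inverse)
  qed
  have "(T \<longlongrightarrow> S' ** (mat 1 ** S)) (at 0)"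
    unfolding T_def using tendsto_monomial_translation[OF M]
    unfolding matrix_matrix_mult_def by (intro tendsto_intros) auto
  then have "(T \<longlongrightarrow> mat 1) (at 0)" by (simp add: S'S)
  moreover obtain X where X: "open X" "mat 1 \<in> X"
    "\<And>T. T \<in> X \<Longrightarrow> T \<in> quadric_symmetries \<Longrightarrow> knot_close \<epsilon> n (curve_lin T k\<^sub>2) k\<^sub>2"
    using knot_close_near_identity[OF k2 \<epsilon>] by metis
  ultimately have "\<forall>\<^sub>F \<tau> in at 0. T \<tau> \<in> X" by (intro topological_tendstoD)
  then obtain d where d: "d > 0" "\<And>\<tau>. \<tau> \<noteq> 0 \<Longrightarrow> \<bar>\<tau>\<bar> < d \<Longrightarrow> T \<tau> \<in> X"
    unfolding eventually_at by (auto simp: dist_real_def)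
  \<comment> \<open>The parameter must be small and nonzero for closeness and must avoid the
    finitely many bad values.\<close>
  have "infinite ({0<..<d} - B)" using d(1) B by (simp add: Diff_infinite_finite)
  then obtain \<tau> where "\<tau> \<in> {0<..<d} - B" by (metis ex_in_conv finite.emptyI)
  then have \<tau>: "\<tau> \<notin> B" "T \<tau> \<in> X" using d(2)[of \<tau>] by auto
  have stp: "stereo f (hom_point p) = axis 4 2"
    using pn by (simp add: vec_eq_iff forall_5 stereo_nth hom_point_mk5 f(2) axis_def)
  have Tp: "T \<tau> *v hom_point p = hom_point p"
  proof -
    have "monomial_translation M \<tau> *v axis 4 2 = axis 4 2"
      by (simp add: vec_eq_iff forall_5 lin_translation axis_def flip: lin_real)
    then show ?thesis unfolding Tx stp by (simp add: unstereo_stereo[of g f, OF fg(2)] flip: stp)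
  qed
  define a where "a = knot_deriv n k\<^sub>2 0"
  have ap: "a \<bullet> p = 0"
    using knot_deriv_orthogonal[OF k2, of 0] base_real[OF base(2)] by (simp add: a_def inner_commute)
  \<comment> \<open>A tangent vector at p has stereographic coordinate 0 equal to zero, so the
    translation moves it by a multiple of the image of p only. Modulo p it does not move.\<close>
  have "T \<tau> *v mk5 0 a = mk5 0 a + (\<tau> * f a $ 2 + \<tau> ^ M * f a $ 3 + \<tau> ^ M\<^sup>2 * f a $ 4) *\<^sub>R hom_point p"
  proof -
    have s: "stereo f (mk5 0 a) $ 0 = 0" by (simp add: stereo_nth f1 ap)
    have "monomial_translation M \<tau> *v stereo f (mk5 0 a)
        = stereo f (mk5 0 a) + (\<tau> * f a $ 2 + \<tau> ^ M * f a $ 3 + \<tau> ^ M\<^sup>2 * f a $ 4) *\<^sub>R stereo f (hom_point p)"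
      unfolding lin_real[symmetric] stp vec_eq_iff forall_5 lin_translation vector_add_component vector_scaleR_component
      by (simp add: s) (simp add: stereo_nth axis_def)
    then show ?thesis
      unfolding Tx by (simp add: linear_add[OF linear_unstereo[OF lg]] linear_scale[OF linear_unstereo[OF lg]] unstereo_stereo[of g f, OF fg(2)])
  qed
  then have der: "knot_deriv n (curve_lin (T \<tau>) k\<^sub>2) 0 = knot_deriv n k\<^sub>2 0"
    using knot_deriv_lin[OF base(2) Tp] by (simp add: a_def vec_eq_iff)
  have disj: "same_point (curve_map m k\<^sub>1 v) (of_real_vec (hom_point p))"
    if vw: "v \<noteq> 0" "w \<noteq> 0" and same: "same_point (curve_map m k\<^sub>1 v) (curve_map n (curve_lin (T \<tau>) k\<^sub>2) w)" for v w :: "complex^2"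
  proof -
    obtain c where c: "c \<noteq> 0" "curve_map m k\<^sub>1 v = c *s lin (T \<tau>) (curve_map n k\<^sub>2 w)"
      using same by (auto simp: same_point_def curve_map_lin)
    have SS: "lin S (lin S' x) = x" "lin S' (lin S x) = x" for x :: "complex^5"
      by (simp_all add: SS' S'S flip: lin_mult)
    have "same_point (curve_map m K\<^sub>1 v) (lin (monomial_translation M \<tau>) (curve_map n K\<^sub>2 w))"
      unfolding same_point_def K\<^sub>1_def K\<^sub>2_def curve_map_lin c(2)
      by (intro exI[of _ c] conjI c(1)) (simp add: T_def lin_scale lin_mult SS)
    \<comment> \<open>A point with only its last coordinate left is a multiple of the image of p,
      which is \<open>axis 4 2\<close>; hence the division by 2.\<close>
    from gen[OF \<tau>(1) vw this] obtain b where b: "curve_map m K\<^sub>1 v = b *s of_real_vec (axis 4 2)"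
      using that by (intro that[of "curve_map m K\<^sub>1 v $ 4 / 2"]) (simp add: vec_eq_iff forall_5 axis_def)
    have "curve_map m k\<^sub>1 v = lin S' (curve_map m K\<^sub>1 v)" by (simp add: K\<^sub>1_def curve_map_lin SS)
    also have "\<dots> = b *s of_real_vec (hom_point p)"
      unfolding b lin_scale lin_of_real_vec S stp[symmetric] unstereo_stereo[of g f, OF fg(2)] ..
    finally have *: "curve_map m k\<^sub>1 v = b *s of_real_vec (hom_point p)" .
    moreover have "b \<noteq> 0"
      using * k1 vw(1) by (auto simp: real_rational_knot_def real_rational_curve_def)
    ultimately show ?thesis using same_point_scale by metis
  qed
  show ?thesis
    using that[OF real_rational_knot_lin[OF k2 Tsym, of \<tau>]] base(2) Tp X(3)[OF \<tau>(2) Tsym] der disj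
    by (simp add: curve_map_lin lin_real)
qed

subsection \<open>The product on the sphere\<close>

text \<open>Hamilton's product with \<open>x $ 1\<close> as the real part.\<close>

definition qmul :: "real^4 \<Rightarrow> real^4 \<Rightarrow> real^4" where
  "qmul x y = vector [x$1 * y$1 - x$2 * y$2 - x$3 * y$3 - x$4 * y$4,
     x$1 * y$2 + x$2 * y$1 + x$3 * y$4 - x$4 * y$3,
     x$1 * y$3 - x$2 * y$4 + x$3 * y$1 + x$4 * y$2,
     x$1 * y$4 + x$2 * y$3 - x$3 * y$2 + x$4 * y$1]"

definition qcnj :: "real^4 \<Rightarrow> real^4" where
  "qcnj x = vector [x$1, - x$2, - x$3, - x$4]"

lemma qmul_nth:
  "qmul x y $ 1 = x$1 * y$1 - x$2 * y$2 - x$3 * y$3 - x$4 * y$4"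
  "qmul x y $ 2 = x$1 * y$2 + x$2 * y$1 + x$3 * y$4 - x$4 * y$3"
  "qmul x y $ 3 = x$1 * y$3 - x$2 * y$4 + x$3 * y$1 + x$4 * y$2"
  "qmul x y $ 4 = x$1 * y$4 + x$2 * y$3 - x$3 * y$2 + x$4 * y$1"
  by (simp_all add: qmul_def vector4_nth)

lemma qcnj_nth: "qcnj x $ 1 = x $ 1" "qcnj x $ 2 = - x $ 2" "qcnj x $ 3 = - x $ 3" "qcnj x $ 4 = - x $ 4"
  by (simp_all add: qcnj_def vector4_nth)

lemma qmul_assoc: "qmul (qmul x y) z = qmul x (qmul y z)"
  by (simp add: vec4_eq_iff qmul_nth algebra_simps)

lemma norm_qmul: "norm (qmul x y) = norm x * norm y"
proof -
  have "(norm (qmul x y))\<^sup>2 = (norm x * norm y)\<^sup>2"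
    by (simp add: norm_vec4 power_mult_distrib) (simp add: qmul_nth power2_eq_square algebra_simps)
  then show ?thesis by (simp add: power2_eq_iff_nonneg)
qed

lemma norm_qcnj: "norm (qcnj x) = norm x"
proof -
  have "(norm (qcnj x))\<^sup>2 = (norm x)\<^sup>2" by (simp add: norm_vec4 qcnj_nth)
  then show ?thesis by (simp add: power2_eq_iff_nonneg)
qed

lemma qmul_unit:
  assumes "norm p = 1"
  shows "qmul (qmul p (qcnj p)) y = y" "qmul x (qmul (qcnj p) p) = x"
proof -
  have p: "(p$1)\<^sup>2 + (p$2)\<^sup>2 + (p$3)\<^sup>2 + (p$4)\<^sup>2 = 1" using norm_vec4[of p] assms by simp
  have "qmul p (qcnj p) = vector [1, 0, 0, 0]" "qmul (qcnj p) p = vector [1, 0, 0, 0]"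
    using p by (simp_all add: vec4_eq_iff qmul_nth qcnj_nth vector4_nth power2_eq_square)
  then show "qmul (qmul p (qcnj p)) y = y" "qmul x (qmul (qcnj p) p) = x"
    by (simp_all add: vec4_eq_iff qmul_nth vector4_nth)
qed

text \<open>The group law x p^(-1) y, whose neutral element is p; for a unit quaternion the
  conjugate is the inverse.\<close>

definition spmul :: "real^4 \<Rightarrow> real^4 \<Rightarrow> real^4 \<Rightarrow> real^4" where
  "spmul p x y = qmul (qmul x (qcnj p)) y"

lemma spmul_unit:
  assumes "norm p = 1"
  shows "spmul p p y = y" "spmul p x p = x" "norm (spmul p x y) = norm x * norm y"
  using qmul_unit[OF assms] assms by (simp_all add: spmul_def qmul_assoc norm_qmul norm_qcnj)

lemma bounded_bilinear_spmul: "norm p = 1 \<Longrightarrow> bounded_bilinear (spmul p)"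
proof (standard, goal_cases)
  case 5
  then show ?case using spmul_unit(3)[OF 5] by (intro exI[of _ 1]) simp
qed (simp_all add: spmul_def vec4_eq_iff qmul_nth algebra_simps)

definition projmul :: "real^4 \<Rightarrow> real^5 \<Rightarrow> real^5 \<Rightarrow> real^5" where
  "projmul p x y = mk5 (x $ 0 * y $ 0) (spmul p (tl5 x) (tl5 y))"

definition projmul_coeff :: "real^4 \<Rightarrow> 5 \<Rightarrow> 5 \<Rightarrow> 5 \<Rightarrow> real" where
  "projmul_coeff p i j l = projmul p (axis j 1) (axis l 1) $ i"

context
  fixes p :: "real^4"
  assumes p: "norm p = 1"
begin

interpretation sp: bounded_bilinear "spmul p" by (rule bounded_bilinear_spmul[OF p])

lemma bilinear_projmul: "linear (\<lambda>x. projmul p x y)" "linear (\<lambda>y. projmul p x y)"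
proof -
  have t: "tl5 (a + b) = tl5 a + tl5 b" "tl5 (r *\<^sub>R a) = r *\<^sub>R tl5 a" for a b r
    using linear_tl5 by (simp_all add: linear_add linear_scale)
  show "linear (\<lambda>x. projmul p x y)" "linear (\<lambda>y. projmul p x y)"
    by (rule linearI; simp add: projmul_def vec5_eq_iff t sp.add_left sp.add_right sp.scaleR_left sp.scaleR_right algebra_simps)+
qed

lemma bil_projmul: "bil (projmul_coeff p) x y = projmul p x y"
proof -
  have ex: "x = (\<Sum>j\<in>UNIV. x $ j *\<^sub>R axis j 1)" for x :: "real^5"
    using basis_expansion[of x] by (simp add: scalar_mult_eq_scaleR)
  have "projmul p x y = projmul p (\<Sum>j\<in>UNIV. x $ j *\<^sub>R axis j 1) (\<Sum>l\<in>UNIV. y $ l *\<^sub>R axis l 1)"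
    using ex[of x] ex[of y] by simp
  also have "\<dots> = (\<Sum>j\<in>UNIV. x $ j *\<^sub>R projmul p (axis j 1) (\<Sum>l\<in>UNIV. y $ l *\<^sub>R axis l 1))"
    by (simp only: linear_sum[OF bilinear_projmul(1)] linear_scale[OF bilinear_projmul(1)])
  also have "\<dots> = (\<Sum>j\<in>UNIV. x $ j *\<^sub>R (\<Sum>l\<in>UNIV. y $ l *\<^sub>R projmul p (axis j 1) (axis l 1)))"
    by (simp only: linear_sum[OF bilinear_projmul(2)] linear_scale[OF bilinear_projmul(2)])
  finally show ?thesis
    by (simp add: vec_eq_iff bil_def projmul_coeff_def sum_distrib_left mult_ac)
qed

lemma projmul_unit: "projmul p (hom_point p) y = y" "projmul p x (hom_point p) = x"
  by (simp_all add: projmul_def hom_point_mk5 spmul_unit[OF p] mk5_tl5)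

text \<open>The unit laws amount to linear relations between real structure constants. Testing them
  on real basis vectors proves them over every scalar field, the complex numbers included.\<close>

lemma bil_projmul_unit:
  "bil (projmul_coeff p) (of_real_vec (hom_point p)) x = (x::'a::real_field^5)"
  "bil (projmul_coeff p) x (of_real_vec (hom_point p)) = x"
proof -
  have a: "(\<Sum>j\<in>UNIV. projmul_coeff p i j l * hom_point p $ j) = mat 1 $ i $ l" for i l
  proof -
    have "(\<Sum>j\<in>UNIV. projmul_coeff p i j l * hom_point p $ j) = bil (projmul_coeff p) (hom_point p) (axis l 1) $ i"
      by (simp add: bil_def axis_def if_distrib[of "\<lambda>z. _ * z"] cong: if_cong)
    then show ?thesis by (simp add: bil_projmul projmul_unit mat_def axis_def)
  qed
  have b: "(\<Sum>l\<in>UNIV. projmul_coeff p i j l * hom_point p $ l) = mat 1 $ i $ j" for i j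
  proof -
    have "(\<Sum>l\<in>UNIV. projmul_coeff p i j l * hom_point p $ l) = bil (projmul_coeff p) (axis j 1) (hom_point p) $ i"
      by (subst bil_swap[symmetric]) (simp add: bil_def axis_def if_distrib[of "\<lambda>z. _ * z"] cong: if_cong)
    then show ?thesis by (simp add: bil_projmul projmul_unit mat_def axis_def)
  qed
  have "bil (projmul_coeff p) (of_real_vec (hom_point p)) x
      = (\<chi> i. \<Sum>l\<in>UNIV. of_real (\<Sum>j\<in>UNIV. projmul_coeff p i j l * hom_point p $ j) * x $ l)"
    unfolding bil_def by (subst sum.swap) (simp add: sum_distrib_right sum_distrib_left mult_ac)
  also have "\<dots> = lin (mat 1) x" unfolding a lin_def ..
  finally show "bil (projmul_coeff p) (of_real_vec (hom_point p)) x = x" by simp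
  have "bil (projmul_coeff p) x (of_real_vec (hom_point p))
      = (\<chi> i. \<Sum>j\<in>UNIV. of_real (\<Sum>l\<in>UNIV. projmul_coeff p i j l * hom_point p $ l) * x $ j)"
    unfolding bil_def by (simp add: sum_distrib_right sum_distrib_left mult_ac)
  also have "\<dots> = lin (mat 1) x" unfolding b lin_def ..
  finally show "bil (projmul_coeff p) x (of_real_vec (hom_point p)) = x" by simp
qed

lemma on_quadric_projmul: "on_quadric x \<Longrightarrow> on_quadric y \<Longrightarrow> on_quadric (projmul p x y)"
  by (simp add: on_quadric_tl5 projmul_def spmul_unit[OF p] power_mult_distrib)

lemma affine_point_projmul:
  assumes "x $ 0 \<noteq> 0" "y $ 0 \<noteq> 0"
  shows "affine_point (projmul p x y) = spmul p (affine_point x) (affine_point y)"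
proof -
  have a: "affine_point z = (1 / z $ 0) *\<^sub>R tl5 z" for z
    by (simp add: vec_eq_iff affine_point_inc)
  show ?thesis
    unfolding a by (simp add: projmul_def sp.scaleR_left sp.scaleR_right)
qed

end

subsection \<open>Parametrisation of the glued curve\<close>

text \<open>On the hyperbola \<open>tan \<phi> * tan \<omega> = - \<delta>\<close> one has \<open>cos (\<phi> - \<omega>) = \<kappa> * cos (\<phi> + \<omega>)\<close> with
  \<open>\<kappa> = (1 - \<delta>) / (1 + \<delta>)\<close>. Taking \<open>\<phi> + \<omega> = 2 * pi * t\<close> as the parameter gives a regular
  parametrisation that tends to the loop through both curves as \<open>\<kappa>\<close> tends to \<open>1\<close>.\<close>

definition angle :: "real \<Rightarrow> real \<Rightarrow> real" where
  "angle \<kappa> t = arccos (\<kappa> * cos (2 * pi * t))"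

definition angle_deriv :: "real \<Rightarrow> real \<Rightarrow> real" where
  "angle_deriv \<kappa> t = 2 * pi * \<kappa> * sin (2 * pi * t) / sqrt (1 - (\<kappa> * cos (2 * pi * t))\<^sup>2)"

definition ang1 :: "real \<Rightarrow> real \<Rightarrow> real" where "ang1 \<kappa> t = pi * t + angle \<kappa> t / 2"
definition ang2 :: "real \<Rightarrow> real \<Rightarrow> real" where "ang2 \<kappa> t = pi * t - angle \<kappa> t / 2"

lemma kappa_cos_le: 
  assumes "0 \<le> \<kappa>" "\<kappa> \<le> (1::real)"
  shows "\<bar>\<kappa> * cos x\<bar> \<le> \<kappa>"
  using mult_left_mono[OF abs_cos_le_one[of x] assms(1)] assms by (simp add: abs_mult)

lemma angle_has_derivative:
  assumes "0 \<le> \<kappa>" "\<kappa> < 1"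
  shows "(angle \<kappa> has_field_derivative angle_deriv \<kappa> t) (at t)"
proof -
  have "\<bar>\<kappa> * cos (2 * pi * t)\<bar> < 1" using kappa_cos_le[of \<kappa> "2 * pi * t"] assms by simp
  then have b: "-1 < \<kappa> * cos (2 * pi * t)" "\<kappa> * cos (2 * pi * t) < 1" by linarith+
  show ?thesis
    unfolding angle_def angle_deriv_def
    by (rule derivative_eq_intros refl b | simp)+ (simp add: field_simps)
qed

text \<open>With s and c the sine and cosine, the claim is \<kappa>^2 s^2 < 1 - \<kappa>^2 c^2, that
  is \<kappa>^2 < 1. It says that both angles, whose speeds are pi plus or minus half of this
  derivative, strictly increase.\<close>

lemma abs_angle_deriv:
  assumes "0 \<le> \<kappa>" "\<kappa> < 1"
  shows "\<bar>angle_deriv \<kappa> t\<bar> < 2 * pi"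
proof -
  define s c where "s = sin (2 * pi * t)" and "c = cos (2 * pi * t)"
  have sc: "s\<^sup>2 = 1 - c\<^sup>2" by (simp add: s_def c_def sin_squared_eq)
  have "\<kappa>\<^sup>2 < 1" using assms by (simp add: power_less_one_iff abs_square_less_1)
  then have "(\<kappa> * s)\<^sup>2 < 1 - (\<kappa> * c)\<^sup>2"
    unfolding power_mult_distrib sc by (simp add: algebra_simps)
  then have "\<bar>\<kappa> * s\<bar> < sqrt (1 - (\<kappa> * c)\<^sup>2)"
    using real_sqrt_less_mono[of "(\<kappa> * s)\<^sup>2"] by simp
  moreover have "\<bar>angle_deriv \<kappa> t\<bar> = 2 * pi * (\<bar>\<kappa> * s\<bar> / \<bar>sqrt (1 - (\<kappa> * c)\<^sup>2)\<bar>)"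
    by (simp add: angle_deriv_def s_def c_def abs_mult)
  moreover have "\<bar>\<kappa> * s\<bar> / \<bar>sqrt (1 - (\<kappa> * c)\<^sup>2)\<bar> < 1"
    using calculation(1) by (subst divide_less_eq_1) linarith
  then have "2 * pi * (\<bar>\<kappa> * s\<bar> / \<bar>sqrt (1 - (\<kappa> * c)\<^sup>2)\<bar>) < 2 * pi * 1"
    by (intro mult_strict_left_mono) auto
  ultimately show ?thesis by linarith
qed

lemma angle_deriv_continuous:
  assumes "0 \<le> \<kappa>" "\<kappa> < 1"
  shows "continuous_on UNIV (angle_deriv \<kappa>)"
proof -
  have "1 - (\<kappa> * cos (2 * pi * t))\<^sup>2 > 0" for t
  proof -
    have "\<bar>\<kappa> * cos (2 * pi * t)\<bar> < 1" using kappa_cos_le[of \<kappa> "2 * pi * t"] assms by simp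
    then show ?thesis by (simp add: abs_square_less_1)
  qed
  then show ?thesis
    unfolding angle_deriv_def by (intro continuous_intros) (metis less_irrefl real_sqrt_eq_zero_cancel_iff)
qed

lemma ang_derivatives:
  assumes "0 \<le> \<kappa>" "\<kappa> < 1"
  shows "(ang1 \<kappa> has_field_derivative pi + angle_deriv \<kappa> t / 2) (at t)"
    and "(ang2 \<kappa> has_field_derivative pi - angle_deriv \<kappa> t / 2) (at t)"
  unfolding ang1_def ang2_def
  by (rule derivative_eq_intros angle_has_derivative[OF assms] refl | simp)+

lemma ang1_per: "ang1 \<kappa> (t + 1) = ang1 \<kappa> t + pi"
proof -
  have "angle \<kappa> (t + 1) = angle \<kappa> t" by (simp add: angle_def distrib_left)
  then show ?thesis by (simp add: ang1_def algebra_simps)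
qed

lemma sin_cos_ang:
  assumes "0 < \<delta>" "\<delta> < 1" "\<kappa> = (1 - \<delta>) / (1 + \<delta>)"
  shows "sin (ang1 \<kappa> t) * sin (ang2 \<kappa> t) = - \<delta> * (cos (ang1 \<kappa> t) * cos (ang2 \<kappa> t))"
proof -
  have \<kappa>: "0 \<le> \<kappa>" "\<kappa> \<le> 1" unfolding assms(3) using assms(1,2) by (simp_all add: divide_le_eq)
  have "\<bar>\<kappa> * cos (2 * pi * t)\<bar> \<le> 1" using kappa_cos_le[OF \<kappa>, of "2 * pi * t"] \<kappa> by linarith
  then have "cos (angle \<kappa> t) = \<kappa> * cos (2 * pi * t)"
    unfolding angle_def by (intro cos_arccos) linarith+
  moreover have "ang1 \<kappa> t - ang2 \<kappa> t = angle \<kappa> t" "ang1 \<kappa> t + ang2 \<kappa> t = 2 * pi * t"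
    by (simp_all add: ang1_def ang2_def)
  ultimately have e: "cos (ang1 \<kappa> t - ang2 \<kappa> t) = \<kappa> * cos (ang1 \<kappa> t + ang2 \<kappa> t)" by simp
  have "(1 + \<delta>) * \<kappa> = 1 - \<delta>" using assms by simp
  then have "(1 + \<delta>) * cos (ang1 \<kappa> t - ang2 \<kappa> t) = (1 - \<delta>) * cos (ang1 \<kappa> t + ang2 \<kappa> t)"
    using e by (metis mult.assoc)
  then show ?thesis unfolding cos_add cos_diff by (simp add: algebra_simps)
qed

text \<open>At \<kappa> = 1 the arccosine undoes the cosine and \<open>angle\<close> is a tent
  function, so one angle runs from 0 to pi while the other one rests, and then they change
  roles.\<close>

lemma ang_limit:
  "0 \<le> t \<Longrightarrow> t \<le> 1/2 \<Longrightarrow> ang1 1 t = 2 * pi * t \<and> ang2 1 t = 0"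
  "1/2 \<le> t \<Longrightarrow> t \<le> 1 \<Longrightarrow> ang1 1 t = pi \<and> ang2 1 t = pi * (2 * t - 1)"
proof -
  assume t: "0 \<le> t" "t \<le> 1/2"
  then have "angle 1 t = 2 * pi * t"
    by (auto simp: angle_def intro!: arccos_cos)
  then show "ang1 1 t = 2 * pi * t \<and> ang2 1 t = 0" by (simp add: ang1_def ang2_def)
next
  assume t: "1/2 \<le> t" "t \<le> 1"
  have "cos (2 * pi * t) = cos (2 * pi - 2 * pi * t)" by (simp add: cos_diff)
  moreover have "arccos (cos (2 * pi - 2 * pi * t)) = 2 * pi - 2 * pi * t"
    using t by (intro arccos_cos) (auto simp: field_simps)
  ultimately have "angle 1 t = 2 * pi - 2 * pi * t" by (simp add: angle_def)
  then show "ang1 1 t = pi \<and> ang2 1 t = pi * (2 * t - 1)" by (simp add: ang1_def ang2_def field_simps)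
qed

lemma angle_deriv_limit:
  "0 < t \<Longrightarrow> t < 1/2 \<Longrightarrow> angle_deriv 1 t = 2 * pi"
  "1/2 < t \<Longrightarrow> t < 1 \<Longrightarrow> angle_deriv 1 t = - 2 * pi"
proof -
  have sq: "sqrt (1 - (1 * cos (2 * pi * t))\<^sup>2) = \<bar>sin (2 * pi * t)\<bar>" for t
    by (simp flip: sin_squared_eq)
  show "angle_deriv 1 t = 2 * pi" if "0 < t" "t < 1/2"
  proof -
    have "sin (2 * pi * t) > 0" using that by (intro sin_gt_zero) (auto simp: field_simps)
    then show ?thesis unfolding angle_deriv_def sq by simp
  qed
  show "angle_deriv 1 t = - 2 * pi" if "1/2 < t" "t < 1"
  proof -
    have "sin (2 * pi * t) < 0" using that by (intro sin_lt_zero) (auto simp: field_simps)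
    then show ?thesis unfolding angle_deriv_def sq by simp
  qed
qed

lemma continuous_on_angle:
  "continuous_on ({0..1} \<times> S) (\<lambda>x. angle (fst x) (snd x))"
proof -
  have "\<bar>fst x * cos (2 * pi * snd x)\<bar> \<le> 1" if "x \<in> {0..1} \<times> S" for x
    using kappa_cos_le[of "fst x" "2 * pi * snd x"] that by auto
  then show ?thesis
    unfolding angle_def by (intro continuous_intros) (auto simp: abs_le_iff)
qed

text \<open>The denominator vanishes only for \<kappa> = 1 at multiples of 1/2, the instants at
  which the limit loop is at p.\<close>

lemma continuous_on_angle_deriv:
  assumes "\<And>t. t \<in> S \<Longrightarrow> sin (2 * pi * t) \<noteq> 0"
  shows "continuous_on ({0..1} \<times> S) (\<lambda>x. angle_deriv (fst x) (snd x))"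
proof -
  have "sqrt (1 - (fst x * cos (2 * pi * snd x))\<^sup>2) \<noteq> 0" if x: "x \<in> {0..1} \<times> S" for x
  proof -
    have "(cos (2 * pi * snd x))\<^sup>2 < 1"
      using assms[of "snd x"] x by (auto simp: cos_squared_eq)
    moreover have "(fst x)\<^sup>2 \<le> 1" using x by (auto simp: power_le_one)
    ultimately have "(fst x)\<^sup>2 * (cos (2 * pi * snd x))\<^sup>2 < 1"
      using mult_right_mono[of "(fst x)\<^sup>2" 1 "(cos (2 * pi * snd x))\<^sup>2"] by simp
    then show ?thesis by (simp add: power_mult_distrib)
  qed
  then show ?thesis
    unfolding angle_deriv_def by (intro continuous_intros) auto
qed

text \<open>The relation between the angles says that \<open>circ (ang2 \<kappa> t)\<close> and the
  swapped \<open>circ (ang1 \<kappa> t)\<close> are the same projective point, at which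
  \<open>k\<^sub>2\<close> is evaluated.\<close>

lemma knot_curve_glue:
  assumes k1: "real_rational_knot m k\<^sub>1" and k2: "real_rational_knot n k\<^sub>2" and p: "norm p = 1"
    and \<delta>: "0 < \<delta>" "\<delta> < 1" "\<kappa> = (1 - \<delta>) / (1 + \<delta>)"
  shows "knot_curve (m + n) (glue (projmul_coeff p) n k\<^sub>1 k\<^sub>2 (-\<delta>)) (ang1 \<kappa> t) =
    spmul p (knot_curve m k\<^sub>1 (ang1 \<kappa> t)) (knot_curve n k\<^sub>2 (ang2 \<kappa> t))"
proof -
  define v where "v = circ (ang1 \<kappa> t)"
  define u where "u = circ (ang2 \<kappa> t)"
  have deg: "degree (k\<^sub>1 $ i) \<le> m" "degree (curve_subst n (neck_swap (-\<delta>)) k\<^sub>2 $ i) \<le> n" for i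
    using k1 by (simp_all add: real_rational_knot_iff curve_subst_def degree_form_subst)
  have "brk (lin (neck_swap (-\<delta>)) v) u = 0"
    using sin_cos_ang[OF \<delta>, of t] by (simp add: brk_def lin_neck_swap v_def u_def circ_def)
  moreover have nz: "v \<noteq> 0" "u \<noteq> 0" by (simp_all add: v_def u_def circ_nonzero)
  moreover have "lin (neck_swap (-\<delta>)) v \<noteq> 0"
    using nz(1) \<delta>(1) by (auto simp: lin_neck_swap vec2_neq_0_iff)
  ultimately obtain c where c: "c \<noteq> 0" "lin (neck_swap (-\<delta>)) v = c *s u"
    using brk_eq_0[of "lin (neck_swap (-\<delta>)) v" u] by (auto simp: same_point_def)
  have "affine_point (curve_map (m + n) (glue (projmul_coeff p) n k\<^sub>1 k\<^sub>2 (-\<delta>)) v)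
      = affine_point (projmul p (curve_map m k\<^sub>1 v) (c ^ n *s curve_map n k\<^sub>2 u))"
    by (simp add: glue_def curve_map_bil[OF deg] curve_map_subst c(2) curve_map_scale bil_projmul[OF p])
  also have "\<dots> = spmul p (affine_point (curve_map m k\<^sub>1 v)) (affine_point (c ^ n *s curve_map n k\<^sub>2 u))"
    using curve_map_real_nonzero[OF k1 nz(1)] curve_map_real_nonzero[OF k2 nz(2)] c(1)
    by (intro affine_point_projmul[OF p]) auto
  also have "affine_point (c ^ n *s curve_map n k\<^sub>2 u) = affine_point (curve_map n k\<^sub>2 u)"
    using c(1) by (intro affine_point_scale) simp
  finally show ?thesis by (simp add: knot_curve_def v_def u_def)
qed

lemma glue_on_quadric:
  assumes k1: "real_rational_knot m k\<^sub>1" and k2: "real_rational_knot n k\<^sub>2" and p: "norm p = 1"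
  shows "on_quadric (curve_map (m + n) (glue (projmul_coeff p) n k\<^sub>1 k\<^sub>2 \<delta>) (v :: real^2))"
proof -
  have deg: "degree (k\<^sub>1 $ i) \<le> m" "degree (curve_subst n (neck_swap \<delta>) k\<^sub>2 $ i) \<le> n" for i
    using k1 by (simp_all add: real_rational_knot_iff curve_subst_def degree_form_subst)
  show ?thesis
    using k1 k2 unfolding real_rational_knot_iff
    by (simp add: glue_def curve_map_bil[OF deg] curve_map_subst bil_projmul[OF p] on_quadric_projmul[OF p])
qed

subsection \<open>The real picture near the node\<close>

text \<open>The mean value inequality for f(x) - x v. It compares two arbitrary parameters near 0,
  as injectivity requires, and not just one parameter with 0.\<close>

lemma strict_difference:
  fixes f :: "real \<Rightarrow> 'a::real_normed_vector"
  assumes f: "\<And>x. (f has_vector_derivative f' x) (at x)"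
    and e: "\<And>x. \<bar>x\<bar> \<le> \<eta> \<Longrightarrow> norm (f' x - v) \<le> e" "e \<ge> 0" and ab: "\<bar>a\<bar> \<le> \<eta>" "\<bar>b\<bar> \<le> \<eta>"
  shows "norm (f a - f b - (a - b) *\<^sub>R v) \<le> e * \<bar>a - b\<bar>"
proof -
  have "norm ((f a - a *\<^sub>R v) - (f b - b *\<^sub>R v)) \<le> e * norm (a - b)"
  proof (rule differentiable_bound[where S = "{-\<eta>..\<eta>}" and f' = "\<lambda>x h. h *\<^sub>R (f' x - v)"])
    fix x assume x: "x \<in> {-\<eta>..\<eta>}"
    have "((\<lambda>x. f x - x *\<^sub>R v) has_vector_derivative f' x - v) (at x)"
      by (auto intro!: derivative_eq_intros f)
    then show "((\<lambda>x. f x - x *\<^sub>R v) has_derivative (\<lambda>h. h *\<^sub>R (f' x - v))) (at x within {-\<eta>..\<eta>})"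
      using has_vector_derivative_def has_derivative_at_withinI by blast
    show "onorm (\<lambda>h. h *\<^sub>R (f' x - v)) \<le> e"
    proof (rule onorm_bound[OF e(2)])
      fix h :: real
      have "norm (f' x - v) \<le> e" using x by (intro e(1)) auto
      then show "norm (h *\<^sub>R (f' x - v)) \<le> e * norm h"
        by (simp add: mult.commute[of e] mult_left_mono)
    qed
  qed (use ab in auto)
  then show ?thesis by (simp add: algebra_simps)
qed

lemma noncollinear_bound:
  fixes v\<^sub>1 v\<^sub>2 :: "real ^ 4"
  assumes "\<not> collinear {0, v\<^sub>1, v\<^sub>2}"
  obtains c where "c > 0" "\<And>s t. c * (\<bar>s\<bar> + \<bar>t\<bar>) \<le> norm (s *\<^sub>R v\<^sub>1 + t *\<^sub>R v\<^sub>2)"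
proof -
  define f where "f x = fst x *\<^sub>R v\<^sub>1 + snd x *\<^sub>R v\<^sub>2" for x :: "real \<times> real"
  have lin: "linear f" by (rule linearI) (simp_all add: f_def algebra_simps)
  have "inj f"
    unfolding linear_injective_0[OF lin]
  proof (intro allI impI)
    fix x assume x: "f x = 0"
    obtain i j where ij: "v\<^sub>1 $ i * v\<^sub>2 $ j \<noteq> v\<^sub>1 $ j * v\<^sub>2 $ i" using noncollinear_minor[OF assms] .
    have e: "fst x * v\<^sub>1 $ l + snd x * v\<^sub>2 $ l = 0" for l
      using x by (simp add: f_def vec_eq_iff)
    have "fst x * (v\<^sub>1 $ i * v\<^sub>2 $ j - v\<^sub>1 $ j * v\<^sub>2 $ i) = 0" "snd x * (v\<^sub>1 $ i * v\<^sub>2 $ j - v\<^sub>1 $ j * v\<^sub>2 $ i) = 0"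
      using e[of i] e[of j] by algebra+
    then show "x = 0" using ij by (auto simp: prod_eq_iff)
  qed
  then obtain B where B: "B > 0" "\<And>x. B * norm x \<le> norm (f x)"
    using linear_inj_bounded_below_pos[OF lin] by blast
  show ?thesis
  proof (rule that[of "B / 2"])
    fix s t
    have "\<bar>s\<bar> + \<bar>t\<bar> \<le> 2 * norm (s, t)"
      using norm_fst_le[of s t] norm_snd_le[of t s] by simp
    then have "B / 2 * (\<bar>s\<bar> + \<bar>t\<bar>) \<le> B * norm (s, t)" using B(1) by simp
    then show "B / 2 * (\<bar>s\<bar> + \<bar>t\<bar>) \<le> norm (s *\<^sub>R v\<^sub>1 + t *\<^sub>R v\<^sub>2)"
      using B(2)[of "(s, t)"] by (simp add: f_def)
  qed (use B in simp)
qed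

definition node_injective :: "real ^ 4 \<Rightarrow> nat \<Rightarrow> nat \<Rightarrow> real poly ^ 5 \<Rightarrow> real poly ^ 5 \<Rightarrow> real ^ 4 \<Rightarrow> real ^ 4 \<Rightarrow> real \<Rightarrow> bool" where
  "node_injective p m n k\<^sub>1 k\<^sub>2 v\<^sub>1 v\<^sub>2 \<eta> \<longleftrightarrow>
    (\<forall>a a' b b'. \<bar>a\<bar> \<le> \<eta> \<longrightarrow> \<bar>a'\<bar> \<le> \<eta> \<longrightarrow> \<bar>b\<bar> \<le> \<eta> \<longrightarrow> \<bar>b'\<bar> \<le> \<eta> \<longrightarrow>
      spmul p (knot_curve m k\<^sub>1 a) (knot_curve n k\<^sub>2 b) \<bullet> v\<^sub>1 = spmul p (knot_curve m k\<^sub>1 a') (knot_curve n k\<^sub>2 b') \<bullet> v\<^sub>1 \<longrightarrow>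
      spmul p (knot_curve m k\<^sub>1 a) (knot_curve n k\<^sub>2 b) \<bullet> v\<^sub>2 = spmul p (knot_curve m k\<^sub>1 a') (knot_curve n k\<^sub>2 b') \<bullet> v\<^sub>2 \<longrightarrow>
      a = a' \<and> b = b')"

text \<open>Near the node the surface is to first order the plane of the two tangents, uniformly for
  all \<open>k\<^sub>2'\<close> close to \<open>k\<^sub>2\<close>. The projection directions stay
  those of \<open>k\<^sub>1\<close> and \<open>k\<^sub>2\<close>.\<close>

lemma node_projection:
  assumes k1: "real_rational_knot m k\<^sub>1" and k2: "real_rational_knot n k\<^sub>2"
    and base: "knot_curve m k\<^sub>1 0 = p" "knot_curve n k\<^sub>2 0 = p"
    and nc: "\<not> collinear {0, knot_deriv m k\<^sub>1 0, knot_deriv n k\<^sub>2 0}"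
  obtains \<eta> \<epsilon> where "0 < \<eta>" "\<eta> < 1" "0 < \<epsilon>"
    "\<And>k\<^sub>2'. real_rational_knot n k\<^sub>2' \<Longrightarrow> knot_close \<epsilon> n k\<^sub>2' k\<^sub>2 \<Longrightarrow>
       node_injective p m n k\<^sub>1 k\<^sub>2' (knot_deriv m k\<^sub>1 0) (knot_deriv n k\<^sub>2 0) \<eta>"
proof -
  have p: "norm p = 1" using knot_curve_sphere[OF k1, of 0] base(1) by simp
  interpret sp: bounded_bilinear "spmul p" by (rule bounded_bilinear_spmul[OF p])
  define v\<^sub>1 v\<^sub>2 where "v\<^sub>1 = knot_deriv m k\<^sub>1 0" and "v\<^sub>2 = knot_deriv n k\<^sub>2 0"
  obtain c where c: "c > 0" "\<And>s t. c * (\<bar>s\<bar> + \<bar>t\<bar>) \<le> norm (s *\<^sub>R v\<^sub>1 + t *\<^sub>R v\<^sub>2)"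
    using noncollinear_bound[OF nc] unfolding v\<^sub>1_def v\<^sub>2_def by blast
  \<comment> \<open>\<open>C\<close> exceeds the coefficients 2 |v1| + 3 and |v2| + 4 of the error
    estimate below, and \<open>e\<close> is chosen so that C e stays under the lower bound
    \<open>c\<close>.\<close>
  define C where "C = 2 * norm v\<^sub>1 + 2 * norm v\<^sub>2 + 10"
  define e where "e = min 1 (c / (2 * C))"
  have C: "C > 0" by (simp add: C_def add_nonneg_pos)
  then have e: "0 < e" "e \<le> 1" using c(1) by (simp_all add: e_def)
  have "C * e \<le> C * (c / (2 * C))" using C by (intro mult_left_mono) (simp_all add: e_def)
  then have Ce: "C * e < c" using C c(1) by simp
  have ct: "\<exists>\<eta>>0. \<forall>x. \<bar>x\<bar> \<le> \<eta> \<longrightarrow> dist (f x) (f 0) \<le> e" if "continuous_on UNIV (f :: real \<Rightarrow> real^4)" for f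
  proof -
    have "\<exists>d>0. \<forall>x\<in>UNIV. dist x 0 < d \<longrightarrow> dist (f x) (f 0) < e"
      using that e(1) unfolding continuous_on_iff by blast
    then obtain d where "d > 0" "\<And>x. \<bar>x\<bar> < d \<Longrightarrow> dist (f x) (f 0) < e" by auto
    then show ?thesis by (intro exI[of _ "d / 2"]) (auto intro!: less_imp_le)
  qed
  obtain \<eta>\<^sub>1 where h1: "\<eta>\<^sub>1 > 0" "\<And>x. \<bar>x\<bar> \<le> \<eta>\<^sub>1 \<Longrightarrow> dist (knot_curve m k\<^sub>1 x) p \<le> e"
    using ct[OF continuous_on_knot_curve[OF k1]] base by auto
  obtain \<eta>\<^sub>2 where h2: "\<eta>\<^sub>2 > 0" "\<And>x. \<bar>x\<bar> \<le> \<eta>\<^sub>2 \<Longrightarrow> dist (knot_curve n k\<^sub>2 x) p \<le> e"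
    using ct[OF continuous_on_knot_curve[OF k2]] base by auto
  obtain \<eta>\<^sub>3 where h3: "\<eta>\<^sub>3 > 0" "\<And>x. \<bar>x\<bar> \<le> \<eta>\<^sub>3 \<Longrightarrow> dist (knot_deriv m k\<^sub>1 x) v\<^sub>1 \<le> e"
    using ct[OF continuous_on_knot_deriv[OF k1]] unfolding v\<^sub>1_def by auto
  obtain \<eta>\<^sub>4 where h4: "\<eta>\<^sub>4 > 0" "\<And>x. \<bar>x\<bar> \<le> \<eta>\<^sub>4 \<Longrightarrow> dist (knot_deriv n k\<^sub>2 x) v\<^sub>2 \<le> e"
    using ct[OF continuous_on_knot_deriv[OF k2]] unfolding v\<^sub>2_def by auto
  define \<eta> where "\<eta> = min (1/2) (min (min \<eta>\<^sub>1 \<eta>\<^sub>2) (min \<eta>\<^sub>3 \<eta>\<^sub>4))"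
  have \<eta>: "0 < \<eta>" "\<eta> < 1" "\<eta> \<le> \<eta>\<^sub>1" "\<eta> \<le> \<eta>\<^sub>2" "\<eta> \<le> \<eta>\<^sub>3" "\<eta> \<le> \<eta>\<^sub>4"
    using h1(1) h2(1) h3(1) h4(1) by (auto simp: \<eta>_def)
  have "node_injective p m n k\<^sub>1 k' v\<^sub>1 v\<^sub>2 \<eta>" if k': "real_rational_knot n k'" and close: "knot_close e n k' k\<^sub>2" for k'
    unfolding node_injective_def
  proof (intro allI impI)
    fix a a' b b'
    define A where "A = knot_curve m k\<^sub>1"
    define B where "B = knot_curve n k'"
    assume ab: "\<bar>a\<bar> \<le> \<eta>" "\<bar>a'\<bar> \<le> \<eta>" "\<bar>b\<bar> \<le> \<eta>" "\<bar>b'\<bar> \<le> \<eta>"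
    assume "spmul p (knot_curve m k\<^sub>1 a) (knot_curve n k' b) \<bullet> v\<^sub>1 = spmul p (knot_curve m k\<^sub>1 a') (knot_curve n k' b') \<bullet> v\<^sub>1"
      "spmul p (knot_curve m k\<^sub>1 a) (knot_curve n k' b) \<bullet> v\<^sub>2 = spmul p (knot_curve m k\<^sub>1 a') (knot_curve n k' b') \<bullet> v\<^sub>2"
    then have eq: "(spmul p (A a) (B b) - spmul p (A a') (B b')) \<bullet> v\<^sub>1 = 0"
      "(spmul p (A a) (B b) - spmul p (A a') (B b')) \<bullet> v\<^sub>2 = 0"
      by (simp_all add: A_def B_def inner_diff_left)
    have cl: "dist (knot_curve n k' x) (knot_curve n k\<^sub>2 x) \<le> e" "dist (knot_deriv n k' x) (knot_deriv n k\<^sub>2 x) \<le> e"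
      if "\<bar>x\<bar> \<le> \<eta>" for x
    proof -
      have "x \<in> {-10..10}" using that \<eta>(2) by (simp, linarith)
      then show "dist (knot_curve n k' x) (knot_curve n k\<^sub>2 x) \<le> e" "dist (knot_deriv n k' x) (knot_deriv n k\<^sub>2 x) \<le> e"
        using close unfolding knot_close_def by blast+
    qed
    have Bp: "norm (B x - p) \<le> 2 * e" if "\<bar>x\<bar> \<le> \<eta>" for x
      using cl(1)[OF that] h2(2)[of x] that \<eta>(4) dist_triangle[of "B x" p "knot_curve n k\<^sub>2 x"]
      by (simp add: B_def dist_norm)
    have Bv: "norm (knot_deriv n k' x - v\<^sub>2) \<le> 2 * e" if "\<bar>x\<bar> \<le> \<eta>" for x
      using cl(2)[OF that] h4(2)[of x] that \<eta>(6) dist_triangle[of "knot_deriv n k' x" v\<^sub>2 "knot_deriv n k\<^sub>2 x"]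
      by (simp add: dist_norm)
    define X where "X = A a - A a'"
    define Y where "Y = B b - B b'"
    define s t where "s = a - a'" and "t = b - b'"
    have X: "norm (X - s *\<^sub>R v\<^sub>1) \<le> e * \<bar>s\<bar>"
      unfolding X_def s_def A_def
      by (rule strict_difference[OF knot_curve_has_derivative[OF k1], where \<eta> = \<eta>])
         (use h3(2) \<eta>(5) ab e in \<open>auto simp: dist_norm\<close>)
    have Y: "norm (Y - t *\<^sub>R v\<^sub>2) \<le> 2 * e * \<bar>t\<bar>"
      unfolding Y_def t_def B_def
      by (rule strict_difference[OF knot_curve_has_derivative[OF k'], where \<eta> = \<eta>])
         (use Bv ab e in auto)
    have nX: "norm X \<le> (norm v\<^sub>1 + 1) * \<bar>s\<bar>"
    proof -
      have "norm X \<le> norm (X - s *\<^sub>R v\<^sub>1) + norm (s *\<^sub>R v\<^sub>1)" by (metis diff_add_cancel norm_triangle_ineq)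
      also have "\<dots> \<le> 1 * \<bar>s\<bar> + norm v\<^sub>1 * \<bar>s\<bar>"
        using X mult_right_mono[OF e(2), of "\<bar>s\<bar>"] by (simp add: mult.commute)
      finally show ?thesis by (simp add: algebra_simps)
    qed
    have nY: "norm Y \<le> (norm v\<^sub>2 + 2) * \<bar>t\<bar>"
    proof -
      have "norm Y \<le> norm (Y - t *\<^sub>R v\<^sub>2) + norm (t *\<^sub>R v\<^sub>2)" by (metis diff_add_cancel norm_triangle_ineq)
      also have "\<dots> \<le> 2 * \<bar>t\<bar> + norm v\<^sub>2 * \<bar>t\<bar>"
      proof -
        have "2 * e * \<bar>t\<bar> \<le> 2 * \<bar>t\<bar>" using mult_right_mono[OF e(2), of "\<bar>t\<bar>"] by simp
        then have "norm (Y - t *\<^sub>R v\<^sub>2) \<le> 2 * \<bar>t\<bar>" using Y by linarith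
        then show ?thesis by (simp add: mult.commute[of "norm v\<^sub>2"])
      qed
      finally show ?thesis by (simp add: algebra_simps)
    qed
    define W where "W = spmul p (A a) (B b) - spmul p (A a') (B b')"
    define z where "z = s *\<^sub>R v\<^sub>1 + t *\<^sub>R v\<^sub>2"
    \<comment> \<open>The product is varied in one factor at a time, and since p is neutral the
      leading terms are the increments X and Y themselves.\<close>
    have Wz_eq: "W - z = spmul p X (B b - p) + (X - s *\<^sub>R v\<^sub>1) + spmul p (A a' - p) Y + (Y - t *\<^sub>R v\<^sub>2)"
      by (simp add: W_def z_def X_def Y_def sp.diff_left sp.diff_right spmul_unit[OF p])
    have "norm (W - z) \<le> norm X * norm (B b - p) + norm (X - s *\<^sub>R v\<^sub>1) + norm (A a' - p) * norm Y + norm (Y - t *\<^sub>R v\<^sub>2)"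
      unfolding Wz_eq by (intro norm_triangle_mono) (simp_all add: spmul_unit(3)[OF p])
    also have "norm X * norm (B b - p) \<le> ((norm v\<^sub>1 + 1) * \<bar>s\<bar>) * (2 * e)"
      by (intro mult_mono nX Bp ab) (auto intro: mult_nonneg_nonneg)
    also have "norm (A a' - p) * norm Y \<le> e * ((norm v\<^sub>2 + 2) * \<bar>t\<bar>)"
      using h1(2)[of a'] ab \<eta>(3) e by (intro mult_mono nY) (auto simp: A_def dist_norm)
    finally have "norm (W - z) \<le> (2 * norm v\<^sub>1 + 3) * (e * \<bar>s\<bar>) + (norm v\<^sub>2 + 4) * (e * \<bar>t\<bar>)"
      using X Y by (simp add: algebra_simps)
    also have "\<dots> \<le> C * (e * \<bar>s\<bar>) + C * (e * \<bar>t\<bar>)"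
      using e by (intro add_mono mult_right_mono) (auto simp: C_def)
    finally have Wz: "norm (W - z) \<le> C * e * (\<bar>s\<bar> + \<bar>t\<bar>)" by (simp add: algebra_simps)
    \<comment> \<open>\<open>z\<close> lies in the plane of the tangents, and equal projections make
      \<open>W\<close> orthogonal to it, so |z| \<le> |W - z|. The error bound allows this only for
      s = t = 0.\<close>
    have "W \<bullet> z = 0" using eq by (simp add: z_def W_def inner_add_right)
    then have "z \<bullet> z = (z - W) \<bullet> z" by (simp add: inner_diff_left)
    then have "norm z * norm z \<le> norm (z - W) * norm z"
      by (metis norm_cauchy_schwarz power2_eq_square power2_norm_eq_inner)
    then have "norm z \<le> norm (W - z)"
      by (cases "z = 0") (auto simp: norm_minus_commute)
    then have "c * (\<bar>s\<bar> + \<bar>t\<bar>) \<le> C * e * (\<bar>s\<bar> + \<bar>t\<bar>)" using Wz c(2)[of s t] unfolding z_def by linarith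
    then have "\<bar>s\<bar> + \<bar>t\<bar> \<le> 0" using Ce by (metis abs_ge_zero add_nonneg_nonneg mult_le_cancel_right not_less)
    then have "s = 0" "t = 0" by linarith+
    then show "a = a' \<and> b = b'" by (simp add: s_def t_def)
  qed
  then show ?thesis using that[OF \<eta>(1,2) e(1)] unfolding v\<^sub>1_def v\<^sub>2_def by blast
qed

text \<open>The arc of angles in [\<eta>, pi - \<eta>] is compact and misses p by injectivity, hence
  keeps a positive distance from it.\<close>

lemma away_from_node:
  assumes k: "real_rational_knot d k" and base: "knot_curve d k 0 = p" and \<eta>: "0 < \<eta>" "\<eta> < 1"
  obtains r where "r > 0" "\<And>x. 0 \<le> x \<Longrightarrow> x \<le> pi \<Longrightarrow> dist (knot_curve d k x) p < r \<Longrightarrow> x < \<eta> \<or> pi - x < \<eta>"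
proof -
  have "compact (knot_curve d k ` {\<eta>..pi - \<eta>})"
    by (intro compact_continuous_image continuous_on_knot_curve k compact_Icc)
  moreover have "p \<notin> knot_curve d k ` {\<eta>..pi - \<eta>}"
  proof
    assume "p \<in> knot_curve d k ` {\<eta>..pi - \<eta>}"
    then obtain x where "\<eta> \<le> x" "x \<le> pi - \<eta>" "knot_curve d k x = knot_curve d k 0" using base by auto
    then show False using sin_gt_zero[of x] knot_curve_eq_iff[OF k, of x 0] \<eta> by auto
  qed
  ultimately obtain r where r: "r > 0" "\<forall>x\<in>knot_curve d k ` {\<eta>..pi - \<eta>}. r \<le> dist p x"
    using separate_point_closed[OF compact_imp_closed] by blast
  show ?thesis
  proof (rule that[OF r(1)])
    fix x assume x: "0 \<le> x" "x \<le> pi" "dist (knot_curve d k x) p < r"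
    show "x < \<eta> \<or> pi - x < \<eta>"
    proof (rule ccontr)
      assume "\<not> ?thesis"
      then have "x \<in> {\<eta>..pi - \<eta>}" by auto
      then have "r \<le> dist p (knot_curve d k x)" using r(2) by blast
      then show False using x(3) by (simp add: dist_commute)
    qed
  qed
qed

subsection \<open>The glued knot\<close>

definition smooth_loop :: "real ^ 4 \<Rightarrow> nat \<Rightarrow> nat \<Rightarrow> real poly ^ 5 \<Rightarrow> real poly ^ 5 \<Rightarrow> real \<Rightarrow> real \<Rightarrow> real ^ 4" where
  "smooth_loop p m n k\<^sub>1 k\<^sub>2 \<kappa> t = spmul p (knot_curve m k\<^sub>1 (ang1 \<kappa> t)) (knot_curve n k\<^sub>2 (ang2 \<kappa> t))"

definition smooth_loop_deriv :: "real ^ 4 \<Rightarrow> nat \<Rightarrow> nat \<Rightarrow> real poly ^ 5 \<Rightarrow> real poly ^ 5 \<Rightarrow> real \<Rightarrow> real \<Rightarrow> real ^ 4" where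
  "smooth_loop_deriv p m n k\<^sub>1 k\<^sub>2 \<kappa> t =
     spmul p (knot_curve m k\<^sub>1 (ang1 \<kappa> t)) ((pi - angle_deriv \<kappa> t / 2) *\<^sub>R knot_deriv n k\<^sub>2 (ang2 \<kappa> t)) +
     spmul p ((pi + angle_deriv \<kappa> t / 2) *\<^sub>R knot_deriv m k\<^sub>1 (ang1 \<kappa> t)) (knot_curve n k\<^sub>2 (ang2 \<kappa> t))"

definition pinched_loop :: "nat \<Rightarrow> nat \<Rightarrow> real poly ^ 5 \<Rightarrow> real poly ^ 5 \<Rightarrow> real \<Rightarrow> real ^ 4" where
  "pinched_loop m n k\<^sub>1 k\<^sub>2 = (\<lambda>t. knot_curve m k\<^sub>1 (pi * t)) +++ (\<lambda>t. knot_curve n k\<^sub>2 (pi * t))"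

lemma knot_curve_has_derivative_linear:
  assumes "real_rational_knot d k"
  shows "((\<lambda>t. knot_curve d k (a * t + b)) has_vector_derivative a *\<^sub>R knot_deriv d k (a * t + b)) (at t)"
proof -
  have "((\<lambda>t. a * t + b) has_vector_derivative a) (at t)"
    by (auto intro!: derivative_eq_intros simp flip: has_real_derivative_iff_has_vector_derivative)
  from vector_diff_chain_at[OF this knot_curve_has_derivative[OF assms]] show ?thesis by (simp add: o_def)
qed

locale real_gluing =
  fixes m n :: nat and k\<^sub>1 k\<^sub>2 :: "real poly ^ 5" and p :: "real ^ 4"
  assumes k1: "real_rational_knot m k\<^sub>1" and k2: "real_rational_knot n k\<^sub>2"
    and base: "knot_curve m k\<^sub>1 0 = p" "knot_curve n k\<^sub>2 0 = p"
begin

lemma base_pi: "knot_curve m k\<^sub>1 pi = p" "knot_curve n k\<^sub>2 pi = p"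
  using knot_curve_periodic[of m k\<^sub>1 0] knot_curve_periodic[of n k\<^sub>2 0] base by simp_all

lemma norm_p: "norm p = 1"
  using knot_curve_sphere[OF k1, of 0] base(1) by simp

lemma pinched_loop_eq:
  "t \<le> 1/2 \<Longrightarrow> pinched_loop m n k\<^sub>1 k\<^sub>2 t = knot_curve m k\<^sub>1 (2 * pi * t)"
  "1/2 \<le> t \<Longrightarrow> pinched_loop m n k\<^sub>1 k\<^sub>2 t = knot_curve n k\<^sub>2 (pi * (2 * t - 1))"
proof -
  show "t \<le> 1/2 \<Longrightarrow> pinched_loop m n k\<^sub>1 k\<^sub>2 t = knot_curve m k\<^sub>1 (2 * pi * t)"
    by (simp add: pinched_loop_def joinpaths_def mult_ac)
  show "1/2 \<le> t \<Longrightarrow> pinched_loop m n k\<^sub>1 k\<^sub>2 t = knot_curve n k\<^sub>2 (pi * (2 * t - 1))"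
  proof (cases "t = 1/2")
    case True
    show ?thesis unfolding True using base base_pi by (simp add: pinched_loop_def joinpaths_def)
  qed (auto simp: pinched_loop_def joinpaths_def)
qed

lemma continuous_pinched_loop: "continuous_on {0..1} (pinched_loop m n k\<^sub>1 k\<^sub>2)"
proof -
  have "path (pinched_loop m n k\<^sub>1 k\<^sub>2)"
    unfolding pinched_loop_def
  proof (rule path_join_imp)
    show "path (\<lambda>t. knot_curve m k\<^sub>1 (pi * t))" "path (\<lambda>t. knot_curve n k\<^sub>2 (pi * t))"
      unfolding path_def
      by (auto intro!: continuous_intros continuous_on_compose2[OF continuous_on_knot_curve[OF k1, of UNIV]]
          continuous_on_compose2[OF continuous_on_knot_curve[OF k2, of UNIV]])
    show "pathfinish (\<lambda>t. knot_curve m k\<^sub>1 (pi * t)) = pathstart (\<lambda>t. knot_curve n k\<^sub>2 (pi * t))"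
      using base base_pi by (simp add: pathfinish_def pathstart_def)
  qed
  then show ?thesis by (simp add: path_def)
qed

lemma pinched_loop_deriv:
  "t < 1/2 \<Longrightarrow> vector_derivative (pinched_loop m n k\<^sub>1 k\<^sub>2) (at t) = (2 * pi) *\<^sub>R knot_deriv m k\<^sub>1 (2 * pi * t)"
  "1/2 < t \<Longrightarrow> vector_derivative (pinched_loop m n k\<^sub>1 k\<^sub>2) (at t) = (2 * pi) *\<^sub>R knot_deriv n k\<^sub>2 (pi * (2 * t - 1))"
proof -
  show "vector_derivative (pinched_loop m n k\<^sub>1 k\<^sub>2) (at t) = (2 * pi) *\<^sub>R knot_deriv m k\<^sub>1 (2 * pi * t)" if "t < 1/2"
  proof (rule vector_derivative_at, rule has_vector_derivative_transform_within_open[where S = "{..<1/2}"])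
    show "((\<lambda>t. knot_curve m k\<^sub>1 (2 * pi * t)) has_vector_derivative (2 * pi) *\<^sub>R knot_deriv m k\<^sub>1 (2 * pi * t)) (at t)"
      using knot_curve_has_derivative_linear[OF k1, of "2 * pi" 0] by simp
  qed (use that in \<open>auto simp: pinched_loop_eq\<close>)
  show "vector_derivative (pinched_loop m n k\<^sub>1 k\<^sub>2) (at t) = (2 * pi) *\<^sub>R knot_deriv n k\<^sub>2 (pi * (2 * t - 1))" if "1/2 < t"
  proof (rule vector_derivative_at, rule has_vector_derivative_transform_within_open[where S = "{1/2<..}"])
    show "((\<lambda>t. knot_curve n k\<^sub>2 (pi * (2 * t - 1))) has_vector_derivative (2 * pi) *\<^sub>R knot_deriv n k\<^sub>2 (pi * (2 * t - 1))) (at t)"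
    proof -
      have "pi * (2 * t - 1) = 2 * pi * t + - pi" for t by (simp add: algebra_simps)
      then show ?thesis using knot_curve_has_derivative_linear[OF k2, of "2 * pi" "- pi" t] by presburger
    qed
  qed (use that in \<open>auto simp: pinched_loop_eq\<close>)
qed

interpretation sp: bounded_bilinear "spmul p" by (rule bounded_bilinear_spmul[OF norm_p])

lemma smooth_loop_has_derivative:
  assumes "0 \<le> \<kappa>" "\<kappa> < 1"
  shows "(smooth_loop p m n k\<^sub>1 k\<^sub>2 \<kappa> has_vector_derivative smooth_loop_deriv p m n k\<^sub>1 k\<^sub>2 \<kappa> t) (at t)"
proof -
  have 1: "((\<lambda>t. knot_curve m k\<^sub>1 (ang1 \<kappa> t)) has_vector_derivative (pi + angle_deriv \<kappa> t / 2) *\<^sub>R knot_deriv m k\<^sub>1 (ang1 \<kappa> t)) (at t)"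
    using vector_diff_chain_at[OF _ knot_curve_has_derivative[OF k1]] ang_derivatives(1)[OF assms]
    by (simp add: has_real_derivative_iff_has_vector_derivative o_def)
  have 2: "((\<lambda>t. knot_curve n k\<^sub>2 (ang2 \<kappa> t)) has_vector_derivative (pi - angle_deriv \<kappa> t / 2) *\<^sub>R knot_deriv n k\<^sub>2 (ang2 \<kappa> t)) (at t)"
    using vector_diff_chain_at[OF _ knot_curve_has_derivative[OF k2]] ang_derivatives(2)[OF assms]
    by (simp add: has_real_derivative_iff_has_vector_derivative o_def)
  show ?thesis
    using sp.has_vector_derivative[OF 1 2] unfolding smooth_loop_def[abs_def] smooth_loop_deriv_def .
qed

text \<open>At \<kappa> = 1 one of the two angles is a multiple of pi at every time, so one factor
  is the neutral element and the product is a point of the other curve.\<close>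

lemma smooth_loop_limit:
  assumes "0 \<le> t" "t \<le> 1"
  shows "smooth_loop p m n k\<^sub>1 k\<^sub>2 1 t = pinched_loop m n k\<^sub>1 k\<^sub>2 t"
  using ang_limit[of t] assms base base_pi spmul_unit[OF norm_p]
  by (cases "t \<le> 1/2") (auto simp: smooth_loop_def pinched_loop_eq)

lemma smooth_loop_deriv_limit:
  assumes "0 < t" "t < 1" "t \<noteq> 1/2"
  shows "smooth_loop_deriv p m n k\<^sub>1 k\<^sub>2 1 t = vector_derivative (pinched_loop m n k\<^sub>1 k\<^sub>2) (at t)"
proof (cases "t < 1/2")
  case True
  then show ?thesis
    using ang_limit(1)[of t] angle_deriv_limit(1)[of t] assms base spmul_unit[OF norm_p]
    by (simp add: smooth_loop_deriv_def pinched_loop_deriv sp.zero_right)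
next
  case False
  then show ?thesis
    using ang_limit(2)[of t] angle_deriv_limit(2)[of t] assms base_pi spmul_unit[OF norm_p]
    by (simp add: smooth_loop_deriv_def pinched_loop_deriv sp.zero_left)
qed

lemma continuous_on_ang:
  "continuous_on ({0..1} \<times> S) (\<lambda>x. ang1 (fst x) (snd x))" "continuous_on ({0..1} \<times> S) (\<lambda>x. ang2 (fst x) (snd x))"
  unfolding ang1_def ang2_def by (intro continuous_intros continuous_on_angle; simp)+

lemma continuous_on_smooth_loop:
  "continuous_on ({0..1} \<times> S) (\<lambda>x. smooth_loop p m n k\<^sub>1 k\<^sub>2 (fst x) (snd x))"
  unfolding smooth_loop_def
  by (intro sp.continuous_on continuous_on_compose2[OF continuous_on_knot_curve[OF k1, of UNIV]]
      continuous_on_compose2[OF continuous_on_knot_curve[OF k2, of UNIV]] continuous_on_ang) auto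

lemma continuous_on_smooth_loop_deriv:
  assumes "\<And>t. t \<in> S \<Longrightarrow> sin (2 * pi * t) \<noteq> 0"
  shows "continuous_on ({0..1} \<times> S) (\<lambda>x. smooth_loop_deriv p m n k\<^sub>1 k\<^sub>2 (fst x) (snd x))"
  unfolding smooth_loop_deriv_def
  by (intro continuous_on_add sp.continuous_on continuous_on_scaleR continuous_on_diff continuous_on_const
      continuous_on_divide continuous_on_angle_deriv[OF assms]
      continuous_on_compose2[OF continuous_on_knot_curve[OF k1, of UNIV]]
      continuous_on_compose2[OF continuous_on_knot_curve[OF k2, of UNIV]]
      continuous_on_compose2[OF continuous_on_knot_deriv[OF k1, of UNIV]]
      continuous_on_compose2[OF continuous_on_knot_deriv[OF k2, of UNIV]] continuous_on_ang) auto

text \<open>Joint continuity up to \<kappa> = 1 and compactness of the time interval give uniform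
  estimates. For the derivatives \<open>C\<close> has to avoid 0, 1/2 and 1, where the limit loop
  may have corners.\<close>

lemma smooth_loop_close:
  assumes \<epsilon>: "\<epsilon> > 0" and C: "compact C" "C \<subseteq> {0..1}" "0 \<notin> C" "1 \<notin> C" "1/2 \<notin> C"
  obtains \<kappa>\<^sub>0 where "0 \<le> \<kappa>\<^sub>0" "\<kappa>\<^sub>0 < 1"
    "\<And>\<kappa> t. \<kappa>\<^sub>0 < \<kappa> \<Longrightarrow> \<kappa> < 1 \<Longrightarrow> t \<in> {0..1} \<Longrightarrow>
      dist (smooth_loop p m n k\<^sub>1 k\<^sub>2 \<kappa> t) (pinched_loop m n k\<^sub>1 k\<^sub>2 t) \<le> \<epsilon> \<and>
      \<bar>ang1 \<kappa> t - ang1 1 t\<bar> \<le> \<epsilon> \<and> \<bar>ang2 \<kappa> t - ang2 1 t\<bar> \<le> \<epsilon>"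
    "\<And>\<kappa> t. \<kappa>\<^sub>0 < \<kappa> \<Longrightarrow> \<kappa> < 1 \<Longrightarrow> t \<in> C \<Longrightarrow>
      dist (vector_derivative (smooth_loop p m n k\<^sub>1 k\<^sub>2 \<kappa>) (at t)) (vector_derivative (pinched_loop m n k\<^sub>1 k\<^sub>2) (at t)) \<le> \<epsilon>"
proof -
  have near: "\<exists>a. 0 \<le> a \<and> a < 1 \<and> (\<forall>\<kappa> t. a < \<kappa> \<longrightarrow> \<kappa> < 1 \<longrightarrow> t \<in> S \<longrightarrow> dist (f \<kappa> t) (f 1 t) \<le> \<epsilon>)"
    if cf: "continuous_on ({0..1} \<times> S) (\<lambda>x. f (fst x) (snd x))" and S: "compact S" for S and f :: "real \<Rightarrow> real \<Rightarrow> 'c::metric_space"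
  proof -
    obtain X where X: "1 \<in> X" "open X" "\<forall>\<kappa>\<in>X \<inter> {0..1}. \<forall>t\<in>S. dist (f (fst (\<kappa>, t)) (snd (\<kappa>, t))) (f (fst (1::real, t)) (snd (1::real, t))) \<le> \<epsilon>"
      using continuous_on_prod_compactE[OF cf S, of 1 \<epsilon>] \<epsilon> by auto
    obtain d where d: "d > 0" "ball 1 d \<subseteq> X" using X(1,2) openE by blast
    have "dist (f \<kappa> t) (f 1 t) \<le> \<epsilon>" if "max 0 (1 - d) < \<kappa>" "\<kappa> < 1" "t \<in> S" for \<kappa> t
    proof -
      have "\<kappa> \<in> X \<inter> {0..1}" using d(2) that by (auto simp: subset_iff dist_real_def)
      then show ?thesis using X(3) that(3) by auto
    qed
    then show ?thesis using d(1) by (intro exI[of _ "max 0 (1 - d)"]) auto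
  qed
  obtain a where a: "0 \<le> a" "a < 1" "\<And>\<kappa> t. a < \<kappa> \<Longrightarrow> \<kappa> < 1 \<Longrightarrow> t \<in> {0..1} \<Longrightarrow> dist (smooth_loop p m n k\<^sub>1 k\<^sub>2 \<kappa> t) (smooth_loop p m n k\<^sub>1 k\<^sub>2 1 t) \<le> \<epsilon>"
    using near[OF continuous_on_smooth_loop compact_Icc] by blast
  obtain b where b: "0 \<le> b" "b < 1" "\<And>\<kappa> t. b < \<kappa> \<Longrightarrow> \<kappa> < 1 \<Longrightarrow> t \<in> {0..1} \<Longrightarrow> dist (ang1 \<kappa> t) (ang1 1 t) \<le> \<epsilon>"
    using near[OF continuous_on_ang(1) compact_Icc] by blast
  obtain c where c: "0 \<le> c" "c < 1" "\<And>\<kappa> t. c < \<kappa> \<Longrightarrow> \<kappa> < 1 \<Longrightarrow> t \<in> {0..1} \<Longrightarrow> dist (ang2 \<kappa> t) (ang2 1 t) \<le> \<epsilon>"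
    using near[OF continuous_on_ang(2) compact_Icc] by blast
  have tC: "0 < t \<and> t < 1 \<and> t \<noteq> 1/2" if "t \<in> C" for t
  proof -
    have "0 \<le> t" "t \<le> 1" "t \<noteq> 0" "t \<noteq> 1" using C(2-4) that by auto
    moreover have "t \<noteq> 1/2" using C(5) that by blast
    ultimately show ?thesis by linarith
  qed
  have sinC: "sin (2 * pi * t) \<noteq> 0" if "t \<in> C" for t
  proof (cases "t < 1/2")
    case True
    then have "sin (2 * pi * t) > 0" using tC[OF that] by (intro sin_gt_zero) (auto simp: field_simps)
    then show ?thesis by simp
  next
    case False
    then have "sin (2 * pi * t) < 0" using tC[OF that] by (intro sin_lt_zero) (auto simp: field_simps)
    then show ?thesis by simp
  qed
  obtain d where d: "0 \<le> d" "d < 1" "\<And>\<kappa> t. d < \<kappa> \<Longrightarrow> \<kappa> < 1 \<Longrightarrow> t \<in> C \<Longrightarrow> dist (smooth_loop_deriv p m n k\<^sub>1 k\<^sub>2 \<kappa> t) (smooth_loop_deriv p m n k\<^sub>1 k\<^sub>2 1 t) \<le> \<epsilon>"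
    using near[OF continuous_on_smooth_loop_deriv[OF sinC] C(1)] by blast
  show ?thesis
  proof (rule that[of "max (max a b) (max c d)"])
    fix \<kappa> t assume \<kappa>: "max (max a b) (max c d) < \<kappa>" "\<kappa> < 1" and t: "t \<in> {0..1::real}"
    show "dist (smooth_loop p m n k\<^sub>1 k\<^sub>2 \<kappa> t) (pinched_loop m n k\<^sub>1 k\<^sub>2 t) \<le> \<epsilon> \<and>
      \<bar>ang1 \<kappa> t - ang1 1 t\<bar> \<le> \<epsilon> \<and> \<bar>ang2 \<kappa> t - ang2 1 t\<bar> \<le> \<epsilon>"
      using a(3)[of \<kappa> t] b(3)[of \<kappa> t] c(3)[of \<kappa> t] \<kappa> t smooth_loop_limit[of t] by (simp add: dist_real_def)
  next
    fix \<kappa> t assume \<kappa>: "max (max a b) (max c d) < \<kappa>" "\<kappa> < 1" and t: "t \<in> C"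
    have "0 \<le> \<kappa>" using \<kappa> a(1) by simp
    then show "dist (vector_derivative (smooth_loop p m n k\<^sub>1 k\<^sub>2 \<kappa>) (at t)) (vector_derivative (pinched_loop m n k\<^sub>1 k\<^sub>2) (at t)) \<le> \<epsilon>"
      using d(3)[of \<kappa> t] \<kappa> t vector_derivative_at[OF smooth_loop_has_derivative[of \<kappa> t]] smooth_loop_deriv_limit[of t] tC[OF t]
      by simp
  qed (use a b c d in auto)
qed

end

section \<open>Comparison with the loop through the original knots\<close>

definition standard_loop :: "nat \<Rightarrow> real poly ^ 5 \<Rightarrow> real \<Rightarrow> real ^ 4" where
  "standard_loop d k t = knot_curve d k (pi * t)"

lemma standard_loop:
  assumes "real_rational_knot d k"
  shows "C1_knot (standard_loop d k)" "range (standard_loop d k) = real_points d k"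
    "vector_derivative (standard_loop d k) (at 0) = pi *\<^sub>R knot_deriv d k 0"
proof -
  have \<phi>: "((\<lambda>t. pi * t) has_field_derivative pi) (at t)" "continuous_on UNIV (\<lambda>t::real. pi)" "pi * (t + 1) = pi * t + pi" for t
    by (auto intro!: derivative_eq_intros simp: algebra_simps)
  show "C1_knot (standard_loop d k)" "range (standard_loop d k) = real_points d k"
    using reparametrised_knot(1,2)[OF assms, of "\<lambda>t. pi * t" "\<lambda>t. pi"] \<phi> by (simp_all add: standard_loop_def[abs_def])
  show "vector_derivative (standard_loop d k) (at 0) = pi *\<^sub>R knot_deriv d k 0"
    using vector_derivative_at[OF knot_curve_has_derivative_linear[OF assms, of pi 0 0]] by (simp add: standard_loop_def[abs_def])
qed

lemma collinear_scale_iff: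
  fixes a b :: "'a::real_vector"
  assumes "c \<noteq> 0"
  shows "collinear {0, c *\<^sub>R a, c *\<^sub>R b} \<longleftrightarrow> collinear {0, a, b}"
proof -
  have "collinear {0, c *\<^sub>R a, c *\<^sub>R b}" if "collinear {0, a, b}" for a b :: 'a and c :: real
    using that unfolding collinear_lemma by (elim disjE exE) (auto simp: mult.commute intro: exI)
  from this[of a b c] this[of "c *\<^sub>R a" "c *\<^sub>R b" "inverse c"] show ?thesis using assms by auto
qed

context real_gluing
begin

lemma pinched_loop_standard: "pinched_loop m n k\<^sub>1 k\<^sub>2 = standard_loop m k\<^sub>1 +++ standard_loop n k\<^sub>2"
  by (simp add: pinched_loop_def standard_loop_def[abs_def])

text \<open>The radius below which the ball around the node only sees the two short arcs on which
  the projection is injective. It must not depend on the perturbation \<open>k'\<close> of \<open>k\<^sub>2\<close>.\<close>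

lemma node_radius:
  obtains r\<^sub>0 \<epsilon>\<^sub>0 \<eta> where "r\<^sub>0 > 0" "\<epsilon>\<^sub>0 > 0" "0 < \<eta>" "\<eta> < 1"
    "\<not> collinear {0, knot_deriv m k\<^sub>1 0, knot_deriv n k\<^sub>2 0} \<Longrightarrow>
      (\<forall>k'. real_rational_knot n k' \<longrightarrow> knot_close \<epsilon>\<^sub>0 n k' k\<^sub>2 \<longrightarrow>
         node_injective p m n k\<^sub>1 k' (knot_deriv m k\<^sub>1 0) (knot_deriv n k\<^sub>2 0) (2 * \<eta>))"
    "\<And>t. t \<in> {0..1} \<Longrightarrow> dist (pinched_loop m n k\<^sub>1 k\<^sub>2 t) p < 2 * r\<^sub>0 \<Longrightarrow>
      (\<exists>i\<in>{0,1}. \<exists>j\<in>{0,1}. \<bar>ang1 1 t - real i * pi\<bar> < \<eta> \<and> \<bar>ang2 1 t - real j * pi\<bar> < \<eta>)"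
proof -
  obtain \<eta> \<epsilon>\<^sub>0 where \<eta>: "0 < \<eta>" "\<eta> < 1" "\<epsilon>\<^sub>0 > 0" and inj: "\<not> collinear {0, knot_deriv m k\<^sub>1 0, knot_deriv n k\<^sub>2 0} \<Longrightarrow>
      (\<forall>k'. real_rational_knot n k' \<longrightarrow> knot_close \<epsilon>\<^sub>0 n k' k\<^sub>2 \<longrightarrow>
         node_injective p m n k\<^sub>1 k' (knot_deriv m k\<^sub>1 0) (knot_deriv n k\<^sub>2 0) (2 * \<eta>))"
  proof (cases "collinear {0, knot_deriv m k\<^sub>1 0, knot_deriv n k\<^sub>2 0}")
    case True
    \<comment> \<open>Nothing is claimed about the projection in this case, so any admissible
      constants serve.\<close>
    then show ?thesis using that[of "1/2" 1] by simp
  next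
    case False
    obtain \<eta> \<epsilon>\<^sub>0 where "0 < \<eta>" "\<eta> < 1" "0 < \<epsilon>\<^sub>0" "\<And>k'. real_rational_knot n k' \<Longrightarrow> knot_close \<epsilon>\<^sub>0 n k' k\<^sub>2 \<Longrightarrow>
       node_injective p m n k\<^sub>1 k' (knot_deriv m k\<^sub>1 0) (knot_deriv n k\<^sub>2 0) \<eta>"
      using node_projection[OF k1 k2 base False] by metis
    then show ?thesis using that[of "\<eta> / 2" \<epsilon>\<^sub>0] by simp
  qed
  obtain r\<^sub>1 where r1: "r\<^sub>1 > 0" "\<And>x. 0 \<le> x \<Longrightarrow> x \<le> pi \<Longrightarrow> dist (knot_curve m k\<^sub>1 x) p < r\<^sub>1 \<Longrightarrow> x < \<eta> \<or> pi - x < \<eta>"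
    using away_from_node[OF k1 base(1) \<eta>(1,2)] by metis
  obtain r\<^sub>2 where r2: "r\<^sub>2 > 0" "\<And>x. 0 \<le> x \<Longrightarrow> x \<le> pi \<Longrightarrow> dist (knot_curve n k\<^sub>2 x) p < r\<^sub>2 \<Longrightarrow> x < \<eta> \<or> pi - x < \<eta>"
    using away_from_node[OF k2 base(2) \<eta>(1,2)] by metis
  show ?thesis
  \<comment> \<open>The halving matches the radius \<open>2 * r\<^sub>0\<close> in the claim. The
    factors 2 at the radius and at \<eta> leave room for replacing the pinched loop by a smoothed
    one close to it.\<close>
  proof (rule that[of "min r\<^sub>1 r\<^sub>2 / 2" \<epsilon>\<^sub>0 \<eta>])
    fix t :: real assume t: "t \<in> {0..1}" and d: "dist (pinched_loop m n k\<^sub>1 k\<^sub>2 t) p < 2 * (min r\<^sub>1 r\<^sub>2 / 2)"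
    show "\<exists>i\<in>{0,1}. \<exists>j\<in>{0,1}. \<bar>ang1 1 t - real i * pi\<bar> < \<eta> \<and> \<bar>ang2 1 t - real j * pi\<bar> < \<eta>"
    proof (cases "t \<le> 1/2")
      case True
      then have a: "ang1 1 t = 2 * pi * t" "ang2 1 t = 0" using ang_limit(1)[of t] t by auto
      have "2 * pi * t < \<eta> \<or> pi - 2 * pi * t < \<eta>"
        using d pinched_loop_eq(1)[OF True] True t by (intro r1(2)) (auto simp: field_simps)
      moreover have "0 \<le> 2 * pi * t" "2 * pi * t \<le> pi" using True t by (auto simp: field_simps)
      ultimately show ?thesis using \<eta>(1) unfolding a by auto
    next
      case False
      then have a: "ang1 1 t = pi" "ang2 1 t = pi * (2 * t - 1)" using ang_limit(2)[of t] t by auto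
      have "pi * (2 * t - 1) < \<eta> \<or> pi - pi * (2 * t - 1) < \<eta>"
        using d pinched_loop_eq(2)[of t] False t by (intro r2(2)) (auto simp: field_simps)
      moreover have "0 \<le> pi * (2 * t - 1)" "pi * (2 * t - 1) \<le> pi" using False t by (auto simp: field_simps)
      ultimately show ?thesis using \<eta>(1) unfolding a by auto
    qed
  qed (use r1 r2 \<eta> inj in auto)
qed

text \<open>The loops agree on the first half. On the second the angle is run through at speed 2 pi,
  which is the factor in the derivative bound; at time 1/2 there may be a corner.\<close>

lemma pinched_loop_close:
  assumes close: "knot_close \<epsilon> n k' k\<^sub>2" and base': "knot_curve n k' 0 = p" and k': "real_rational_knot n k'"
    and t: "t \<in> {0..1}"
  shows "dist (pinched_loop m n k\<^sub>1 k' t) (pinched_loop m n k\<^sub>1 k\<^sub>2 t) \<le> \<epsilon>"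
    and "t \<noteq> 1/2 \<Longrightarrow> dist (vector_derivative (pinched_loop m n k\<^sub>1 k') (at t)) (vector_derivative (pinched_loop m n k\<^sub>1 k\<^sub>2) (at t)) \<le> 2 * pi * \<epsilon>"
proof -
  interpret P': real_gluing m n k\<^sub>1 k' p by standard (use k1 k' base base' in auto)
  have "0 \<in> {-10..10::real}" by simp
  then have \<epsilon>: "0 \<le> \<epsilon>" using close zero_le_dist order_trans unfolding knot_close_def by blast
  have r: "pi * (2 * t - 1) \<in> {-10..10}" if "1/2 \<le> t"
  proof -
    have "0 \<le> pi * (2 * t - 1)" using that by simp
    moreover have "pi * (2 * t - 1) \<le> pi * 1" using t by (intro mult_left_mono) auto
    ultimately show ?thesis unfolding atLeastAtMost_iff using pi_less_4 by (intro conjI; linarith)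
  qed
  show "dist (pinched_loop m n k\<^sub>1 k' t) (pinched_loop m n k\<^sub>1 k\<^sub>2 t) \<le> \<epsilon>"
  proof (cases "t \<le> 1/2")
    case True
    then show ?thesis using \<epsilon> by (simp add: pinched_loop_eq P'.pinched_loop_eq)
  next
    case False
    then show ?thesis using r close by (simp add: pinched_loop_eq P'.pinched_loop_eq knot_close_def)
  qed
  assume h: "t \<noteq> 1/2"
  show "dist (vector_derivative (pinched_loop m n k\<^sub>1 k') (at t)) (vector_derivative (pinched_loop m n k\<^sub>1 k\<^sub>2) (at t)) \<le> 2 * pi * \<epsilon>"
  proof (cases "t < 1/2")
    case True
    then show ?thesis using \<epsilon> by (simp add: pinched_loop_deriv P'.pinched_loop_deriv)
  next
    case False
    then have "dist (knot_deriv n k' (pi * (2 * t - 1))) (knot_deriv n k\<^sub>2 (pi * (2 * t - 1))) \<le> \<epsilon>"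
      using r close by (simp add: knot_close_def)
    then have "2 * pi * dist (knot_deriv n k' (pi * (2 * t - 1))) (knot_deriv n k\<^sub>2 (pi * (2 * t - 1))) \<le> 2 * pi * \<epsilon>"
      by (intro mult_left_mono) auto
    then have "dist ((2 * pi) *\<^sub>R knot_deriv n k' (pi * (2 * t - 1))) ((2 * pi) *\<^sub>R knot_deriv n k\<^sub>2 (pi * (2 * t - 1))) \<le> 2 * pi * \<epsilon>"
      by (simp only: dist_norm flip: scaleR_diff_right) simp
    then show ?thesis using False h by (simp add: pinched_loop_deriv P'.pinched_loop_deriv)
  qed
qed

text \<open>Inside the ball both angles are near multiples of pi. Periodicity moves all these
  passages to parameters near (0, 0) of one surface, so injectivity there also separates points on
  different arcs.\<close>

lemma smooth_loop_projection:
  assumes inj: "node_injective p m n k\<^sub>1 k' v\<^sub>1 v\<^sub>2 (2 * \<eta>)"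
    and near: "\<And>t. t \<in> {0..1} \<Longrightarrow> smooth_loop p m n k\<^sub>1 k' \<kappa> t \<in> ball p r \<Longrightarrow>
      (\<exists>i\<in>{0,1}. \<exists>j\<in>{0,1}. \<bar>ang1 \<kappa> t - real i * pi\<bar> \<le> 2 * \<eta> \<and> \<bar>ang2 \<kappa> t - real j * pi\<bar> \<le> 2 * \<eta>)"
    and L: "L = smooth_loop p m n k\<^sub>1 k' \<kappa> ` {0..1}"
  shows "inj_on (\<lambda>x. (x \<bullet> (pi *\<^sub>R v\<^sub>1), x \<bullet> (pi *\<^sub>R v\<^sub>2))) (L \<inter> ball p r)"
proof (rule inj_onI)
  fix x y assume x: "x \<in> L \<inter> ball p r" and y: "y \<in> L \<inter> ball p r"
    and eq: "(x \<bullet> (pi *\<^sub>R v\<^sub>1), x \<bullet> (pi *\<^sub>R v\<^sub>2)) = (y \<bullet> (pi *\<^sub>R v\<^sub>1), y \<bullet> (pi *\<^sub>R v\<^sub>2))"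
  have ex: "\<exists>a b. \<bar>a\<bar> \<le> 2 * \<eta> \<and> \<bar>b\<bar> \<le> 2 * \<eta> \<and> x = spmul p (knot_curve m k\<^sub>1 a) (knot_curve n k' b)"
    if x: "x \<in> L \<inter> ball p r" for x
  proof -
    obtain t where t: "t \<in> {0..1}" "x = smooth_loop p m n k\<^sub>1 k' \<kappa> t" using x L by auto
    obtain i j :: nat where ij: "\<bar>ang1 \<kappa> t - real i * pi\<bar> \<le> 2 * \<eta>" "\<bar>ang2 \<kappa> t - real j * pi\<bar> \<le> 2 * \<eta>"
      using near[OF t(1)] x t(2) by blast
    have per: "knot_curve d k (a - real i * pi) = knot_curve d k a" for d k a i
      using knot_curve_periodic_int[of d k "a - real i * pi" "int i"] by simp
    show ?thesis
      by (rule exI[of _ "ang1 \<kappa> t - real i * pi"], rule exI[of _ "ang2 \<kappa> t - real j * pi"])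
        (use ij t(2) in \<open>simp add: per smooth_loop_def\<close>)
  qed
  obtain a b where ab: "\<bar>a\<bar> \<le> 2 * \<eta>" "\<bar>b\<bar> \<le> 2 * \<eta>" "x = spmul p (knot_curve m k\<^sub>1 a) (knot_curve n k' b)"
    using ex[OF x] by blast
  obtain a' b' where ab': "\<bar>a'\<bar> \<le> 2 * \<eta>" "\<bar>b'\<bar> \<le> 2 * \<eta>" "y = spmul p (knot_curve m k\<^sub>1 a') (knot_curve n k' b')"
    using ex[OF y] by blast
  have "x \<bullet> v\<^sub>1 = y \<bullet> v\<^sub>1" "x \<bullet> v\<^sub>2 = y \<bullet> v\<^sub>2" using eq by simp_all
  then have "a = a' \<and> b = b'"
    using inj ab ab' unfolding node_injective_def by blast
  then show "x = y" using ab ab' by simp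
qed

end

text \<open>The radius is fixed before \<epsilon>, hence before the perturbation of
  \<open>k\<^sub>2\<close> is known; this is why the node estimates were made uniform over nearby
  knots.\<close>

theorem glue_normalised_knots:
  assumes k1: "real_rational_knot m k\<^sub>1" and k2: "real_rational_knot n k\<^sub>2"
    and base: "curve_map m k\<^sub>1 (vector [0, 1] :: real^2) = hom_point p"
      "curve_map n k\<^sub>2 (vector [0, 1] :: real^2) = hom_point p"
  shows "\<exists>r\<^sub>0>0. \<forall>r \<epsilon>. 0 < r \<and> r < r\<^sub>0 \<and> 0 < \<epsilon> \<longrightarrow>
    (\<exists>k. real_rational_knot (m + n) k \<and>
       small_perturbation (real_points m k\<^sub>1) (real_points n k\<^sub>2) p r \<epsilon> (real_points (m + n) k))"
proof -
  interpret R: real_gluing m n k\<^sub>1 k\<^sub>2 p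
    by standard (use k1 k2 base_real base in auto)
  obtain r\<^sub>0 \<epsilon>\<^sub>0 \<eta> where r0: "r\<^sub>0 > 0" and \<epsilon>0: "\<epsilon>\<^sub>0 > 0" and \<eta>: "0 < \<eta>" "\<eta> < 1"
    and inj: "\<not> collinear {0, knot_deriv m k\<^sub>1 0, knot_deriv n k\<^sub>2 0} \<Longrightarrow>
      (\<forall>k'. real_rational_knot n k' \<longrightarrow> knot_close \<epsilon>\<^sub>0 n k' k\<^sub>2 \<longrightarrow>
         node_injective p m n k\<^sub>1 k' (knot_deriv m k\<^sub>1 0) (knot_deriv n k\<^sub>2 0) (2 * \<eta>))"
    and near: "\<And>t. t \<in> {0..1} \<Longrightarrow> dist (pinched_loop m n k\<^sub>1 k\<^sub>2 t) p < 2 * r\<^sub>0 \<Longrightarrow>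
      (\<exists>i\<in>{0,1}. \<exists>j\<in>{0,1}. \<bar>ang1 1 t - real i * pi\<bar> < \<eta> \<and> \<bar>ang2 1 t - real j * pi\<bar> < \<eta>)"
    using R.node_radius by metis
  have "\<exists>k. real_rational_knot (m + n) k \<and>
       small_perturbation (real_points m k\<^sub>1) (real_points n k\<^sub>2) p r \<epsilon> (real_points (m + n) k)"
    if r: "0 < r" "r < r\<^sub>0" and \<epsilon>: "0 < \<epsilon>" for r \<epsilon>
  proof -
    \<comment> \<open>The tangent error is at most 2 pi times this, so at most 8 * (\<epsilon> / 16)
      = \<epsilon> / 2. The bound by \<open>\<epsilon>\<^sub>0\<close> keeps the node estimates
      valid, and half of the amount is granted to each of the two perturbations.\<close>
    define \<epsilon>\<^sub>1 where "\<epsilon>\<^sub>1 = min \<epsilon>\<^sub>0 (min (\<epsilon> / 16) (r\<^sub>0 / 4))"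
    have \<epsilon>1: "\<epsilon>\<^sub>1 > 0" "\<epsilon>\<^sub>1 \<le> \<epsilon>\<^sub>0" "\<epsilon>\<^sub>1 \<le> \<epsilon> / 16" "\<epsilon>\<^sub>1 \<le> r\<^sub>0 / 4" using \<epsilon>0 \<epsilon> r0 by (auto simp: \<epsilon>\<^sub>1_def)
    obtain k' where k': "real_rational_knot n k'" "curve_map n k' (vector [0, 1] :: real^2) = hom_point p"
      "knot_close (\<epsilon>\<^sub>1 / 2) n k' k\<^sub>2" "\<not> collinear {0, knot_deriv m k\<^sub>1 0, knot_deriv n k' 0}"
      using independent_tangents[OF k1 k2 base, of "\<epsilon>\<^sub>1 / 2"] \<epsilon>1(1) by auto
    \<comment> \<open>Disjointness is arranged second, since this step preserves the tangent at p
      exactly and with it the independence just achieved.\<close>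
    obtain h where h: "real_rational_knot n h" "curve_map n h (vector [0, 1] :: real^2) = hom_point p"
      "knot_close (\<epsilon>\<^sub>1 / 2) n h k'" "knot_deriv n h 0 = knot_deriv n k' 0"
      and disj: "\<And>v w :: complex^2. v \<noteq> 0 \<Longrightarrow> w \<noteq> 0 \<Longrightarrow>
      same_point (curve_map m k\<^sub>1 v) (curve_map n h w) \<Longrightarrow> same_point (curve_map m k\<^sub>1 v) (of_real_vec (hom_point p))"
      using disjoint_perturbation[OF k1 k'(1) base(1) k'(2), of "\<epsilon>\<^sub>1 / 2"] \<epsilon>1(1) by (metis half_gt_zero)
    have close: "knot_close \<epsilon>\<^sub>1 n h k\<^sub>2"
      using knot_close_trans[OF h(3) k'(3)] by simp
    have close0: "knot_close \<epsilon>\<^sub>0 n h k\<^sub>2" using close \<epsilon>1(2) unfolding knot_close_def by (meson order_trans)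
    have base_h: "knot_curve n h 0 = p" using base_real[OF h(2)] by simp
    interpret H: real_gluing m n k\<^sub>1 h p
      by standard (use k1 h R.base base_h in auto)
    have cbase: "curve_map d k (vector [0, 1] :: complex^2) = of_real_vec (hom_point p)"
      if "curve_map d k (vector [0, 1] :: real^2) = hom_point p" for d k
    proof -
      have "(vector [0, 1] :: complex^2) = of_real_vec (vector [0, 1])" by (simp add: vec2_eq_iff)
      then show ?thesis using curve_map_of_real[of d k "vector [0, 1]", where 'a=complex] that by simp
    qed
    interpret C: gluing "projmul_coeff p" m n k\<^sub>1 h "hom_point p"
      by standard (use k1 h disj cbase base bil_projmul_unit[OF H.norm_p] in auto)
    obtain i j where "knot_deriv m k\<^sub>1 0 $ i * knot_deriv n h 0 $ j \<noteq> knot_deriv m k\<^sub>1 0 $ j * knot_deriv n h 0 $ i"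
      using noncollinear_minor[OF k'(4)] h(4) by metis
    then obtain \<delta>\<^sub>0 where \<delta>0: "\<delta>\<^sub>0 > 0" "\<And>\<delta> v w. \<delta> \<noteq> 0 \<Longrightarrow> \<bar>\<delta>\<bar> < \<delta>\<^sub>0 \<Longrightarrow> (v :: complex^2) \<noteq> 0 \<Longrightarrow> (w :: complex^2) \<noteq> 0 \<Longrightarrow> separates (m + n) (C.k \<delta>) v w"
      using C.separates_glue[of "inc i" "inc j"] base h(2) by (auto simp: knot_deriv_base)
    define c where "c = pinched_loop m n k\<^sub>1 k\<^sub>2"
    \<comment> \<open>The times at which the original loop is outside the ball: a compact set
      without 0, 1/2 and 1, because the loop is at p then.\<close>
    define D where "D = {0..1} \<inter> c -` (- ball p r)"
    have c0: "c 0 = p" "c 1 = p" "c (1/2) = p"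
      using R.base R.base_pi R.pinched_loop_eq(1)[of 0] R.pinched_loop_eq(2)[of 1] R.pinched_loop_eq(1)[of "1/2"] by (simp_all add: c_def)
    have "closed D" unfolding D_def c_def
      by (intro continuous_closed_preimage R.continuous_pinched_loop) auto
    then have D: "compact D" "D \<subseteq> {0..1}" "0 \<notin> D" "1 \<notin> D" "1/2 \<notin> D"
      using r(1) c0 by (auto simp: D_def compact_eq_bounded_closed intro: bounded_subset[OF bounded_closed_interval])
    define \<epsilon>\<^sub>2 where "\<epsilon>\<^sub>2 = min (\<epsilon> / 4) (min (r\<^sub>0 / 4) \<eta>)"
    have \<epsilon>2: "\<epsilon>\<^sub>2 > 0" "\<epsilon>\<^sub>2 \<le> \<epsilon> / 4" "\<epsilon>\<^sub>2 \<le> r\<^sub>0 / 4" "\<epsilon>\<^sub>2 \<le> \<eta>" using \<epsilon> r0 \<eta> by (auto simp: \<epsilon>\<^sub>2_def)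
    obtain \<kappa>\<^sub>0 where \<kappa>0: "0 \<le> \<kappa>\<^sub>0" "\<kappa>\<^sub>0 < 1"
      "\<And>\<kappa> t. \<kappa>\<^sub>0 < \<kappa> \<Longrightarrow> \<kappa> < 1 \<Longrightarrow> t \<in> {0..1} \<Longrightarrow>
        dist (smooth_loop p m n k\<^sub>1 h \<kappa> t) (pinched_loop m n k\<^sub>1 h t) \<le> \<epsilon>\<^sub>2 \<and>
        \<bar>ang1 \<kappa> t - ang1 1 t\<bar> \<le> \<epsilon>\<^sub>2 \<and> \<bar>ang2 \<kappa> t - ang2 1 t\<bar> \<le> \<epsilon>\<^sub>2"
      "\<And>\<kappa> t. \<kappa>\<^sub>0 < \<kappa> \<Longrightarrow> \<kappa> < 1 \<Longrightarrow> t \<in> D \<Longrightarrow>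
        dist (vector_derivative (smooth_loop p m n k\<^sub>1 h \<kappa>) (at t)) (vector_derivative (pinched_loop m n k\<^sub>1 h) (at t)) \<le> \<epsilon>\<^sub>2"
      using H.smooth_loop_close[OF \<epsilon>2(1) D] by metis
    \<comment> \<open>Since (1 - \<delta>) / (1 + \<delta>) > 1 - 2 \<delta>, the last bound puts
      \<kappa> above \<open>\<kappa>\<^sub>0\<close>; the middle one keeps the glued curve
      separating.\<close>
    define \<delta> where "\<delta> = min (1/2) (min (\<delta>\<^sub>0 / 2) ((1 - \<kappa>\<^sub>0) / 4))"
    have \<delta>: "0 < \<delta>" "\<delta> < 1" "\<delta> < \<delta>\<^sub>0" "\<delta> \<le> (1 - \<kappa>\<^sub>0) / 4" 
      using \<delta>0(1) \<kappa>0(2) min.cobounded2[of "1/2" "min (\<delta>\<^sub>0 / 2) ((1 - \<kappa>\<^sub>0) / 4)"]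
        min.cobounded2[of "\<delta>\<^sub>0 / 2" "(1 - \<kappa>\<^sub>0) / 4"] unfolding \<delta>_def by (auto simp del: min.cobounded2)
    define \<kappa> where "\<kappa> = (1 - \<delta>) / (1 + \<delta>)"
    have "1 - 2 * \<delta> < \<kappa>" unfolding \<kappa>_def using \<delta>(1) by (simp add: less_divide_eq algebra_simps)
    then have \<kappa>: "\<kappa>\<^sub>0 < \<kappa>" "\<kappa> < 1" "0 \<le> \<kappa>"
      using \<delta> \<kappa>0 unfolding \<kappa>_def by (auto simp: divide_less_eq)
    \<comment> \<open>The minus sign matches the hyperbola on which \<open>ang1\<close> and
      \<open>ang2\<close> live.\<close>
    define k where "k = C.k (- \<delta>)"
    have k: "real_rational_knot (m + n) k"
      unfolding real_rational_knot_iff k_def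
      using C.degree_glue glue_on_quadric[OF k1 h(1) H.norm_p] \<delta>0(2)[of "- \<delta>"] \<delta> by auto
    define \<gamma> where "\<gamma> = smooth_loop p m n k\<^sub>1 h \<kappa>"
    have \<gamma>: "\<gamma> = (\<lambda>t. knot_curve (m + n) k (ang1 \<kappa> t))"
      unfolding \<gamma>_def k_def smooth_loop_def[abs_def]
      using knot_curve_glue[OF k1 h(1) H.norm_p \<delta>(1,2) \<kappa>_def] by simp
    have pos: "0 < pi + angle_deriv \<kappa> t / 2" for t
      using abs_angle_deriv[OF \<kappa>(3,2), of t] by linarith
    have cont: "continuous_on UNIV (\<lambda>t. pi + angle_deriv \<kappa> t / 2)"
      by (intro continuous_intros angle_deriv_continuous[OF \<kappa>(3,2)]) auto
    have knot_\<gamma>: "C1_knot \<gamma>" and range_\<gamma>: "range \<gamma> = real_points (m + n) k"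
      using reparametrised_knot(1,2)[OF k ang_derivatives(1)[OF \<kappa>(3,2)] cont pos ang1_per] unfolding \<gamma> by blast+
    have L: "real_points (m + n) k = \<gamma> ` {0..1}"
    proof -
      have "\<gamma> t \<in> \<gamma> ` {0..1}" for t
      proof -
        have per: "\<gamma> (s + 1) = \<gamma> s" for s using knot_\<gamma> by (simp add: C1_knot_def)
        have pern: "\<gamma> (s + of_int N) = \<gamma> s" for s N
        proof (induction N rule: int_induct[where k = 0])
          case (step1 i)
          then show ?case using per[of "s + of_int i"] by (simp add: algebra_simps)
        next
          case (step2 i)
          then show ?case using per[of "s + of_int (i - 1)"] by (simp add: algebra_simps)
        qed simp
        have "\<gamma> (frac t) = \<gamma> t" using pern[of "frac t" "\<lfloor>t\<rfloor>"] by (simp add: frac_def)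
        moreover have "frac t \<in> {0..1}" using frac_ge_0[of t] frac_lt_1[of t] by simp
        ultimately show ?thesis by (metis imageI)
      qed
      then show ?thesis unfolding range_\<gamma>[symmetric] by blast
    qed
    have d: "dist (\<gamma> t) (c t) \<le> \<epsilon>\<^sub>1 + \<epsilon>\<^sub>2" if t: "t \<in> {0..1}" for t
      using \<kappa>0(3)[OF \<kappa>(1,2) t] R.pinched_loop_close(1)[OF close base_h h(1) t] dist_triangle[of "\<gamma> t" "c t" "pinched_loop m n k\<^sub>1 h t"]
      by (simp add: \<gamma>_def c_def)
    have "small_perturbation (real_points m k\<^sub>1) (real_points n k\<^sub>2) p r \<epsilon> (real_points (m + n) k)"
      unfolding small_perturbation_def
    proof (rule exI[of _ "standard_loop m k\<^sub>1"], rule exI[of _ "standard_loop n k\<^sub>2"], rule exI[of _ \<gamma>],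
        intro conjI ballI impI standard_loop[OF k1] standard_loop[OF k2] knot_\<gamma> range_\<gamma>;
        (unfold R.pinched_loop_standard[symmetric] c_def[symmetric])?)
      show "standard_loop m k\<^sub>1 0 = p" "standard_loop n k\<^sub>2 0 = p"
        using R.base by (simp_all add: standard_loop_def)
      show "dist (\<gamma> t) (c t) < \<epsilon>" if "t \<in> {0..1}" for t
        using d[OF that] \<epsilon>1(3) \<epsilon>2(2) \<epsilon> by linarith
      show "dist (vector_derivative \<gamma> (at t)) (vector_derivative c (at t)) < \<epsilon>" if t: "t \<in> {0..1}" "c t \<notin> ball p r" for t
      proof -
        have tD: "t \<in> D" using t by (simp add: D_def)
        then have "t \<noteq> 1/2" using D(5) by blast
        then have "dist (vector_derivative (pinched_loop m n k\<^sub>1 h) (at t)) (vector_derivative c (at t)) \<le> 2 * pi * \<epsilon>\<^sub>1"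
          unfolding c_def by (rule R.pinched_loop_close(2)[OF close base_h h(1) t(1)])
        also have "\<dots> \<le> 8 * (\<epsilon> / 16)" using pi_less_4 \<epsilon>1 by (intro mult_mono) auto
        finally show ?thesis
          using \<kappa>0(4)[OF \<kappa>(1,2) tD] \<epsilon>2(2) \<epsilon> dist_triangle[of "vector_derivative \<gamma> (at t)" "vector_derivative c (at t)" "vector_derivative (pinched_loop m n k\<^sub>1 h) (at t)"]
          unfolding \<gamma>_def by linarith
      qed
      show "let v\<^sub>1 = vector_derivative (standard_loop m k\<^sub>1) (at 0); v\<^sub>2 = vector_derivative (standard_loop n k\<^sub>2) (at 0) in
           \<not> collinear {0, v\<^sub>1, v\<^sub>2} \<longrightarrow> inj_on (\<lambda>x. (x \<bullet> v\<^sub>1, x \<bullet> v\<^sub>2)) (real_points (m + n) k \<inter> ball p r)"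
        unfolding Let_def standard_loop(3)[OF k1] standard_loop(3)[OF k2]
      proof
        assume "\<not> collinear {0, pi *\<^sub>R knot_deriv m k\<^sub>1 0, pi *\<^sub>R knot_deriv n k\<^sub>2 0}"
        then have "\<not> collinear {0, knot_deriv m k\<^sub>1 0, knot_deriv n k\<^sub>2 0}" by (simp add: collinear_scale_iff)
        then have "node_injective p m n k\<^sub>1 h (knot_deriv m k\<^sub>1 0) (knot_deriv n k\<^sub>2 0) (2 * \<eta>)"
          using inj h(1) close0 by blast
        then show "inj_on (\<lambda>x. (x \<bullet> pi *\<^sub>R knot_deriv m k\<^sub>1 0, x \<bullet> pi *\<^sub>R knot_deriv n k\<^sub>2 0)) (real_points (m + n) k \<inter> ball p r)"
        proof (rule R.smooth_loop_projection[OF _ _ L[unfolded \<gamma>_def]])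
          fix t :: real assume t: "t \<in> {0..1}" "smooth_loop p m n k\<^sub>1 h \<kappa> t \<in> ball p r"
          \<comment> \<open>The loops are within
            \<open>\<epsilon>\<^sub>1 + \<epsilon>\<^sub>2\<close>, at most half of
            \<open>r\<^sub>0\<close>, of each other, and r < \<open>r\<^sub>0\<close>; so the
            original loop is still inside the doubled radius.\<close>
          have "dist (c t) p < 2 * r\<^sub>0"
            using d[OF t(1)] t(2) \<epsilon>1(4) \<epsilon>2(3) r dist_triangle[of "c t" p "\<gamma> t"]
            by (simp add: \<gamma>_def dist_commute)
          then obtain i j :: nat where ij: "i \<in> {0,1}" "j \<in> {0,1}" "\<bar>ang1 1 t - real i * pi\<bar> < \<eta>" "\<bar>ang2 1 t - real j * pi\<bar> < \<eta>"
            using near[OF t(1)] unfolding c_def by blast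
          moreover have "\<bar>ang1 \<kappa> t - real i * pi\<bar> \<le> 2 * \<eta>" "\<bar>ang2 \<kappa> t - real j * pi\<bar> \<le> 2 * \<eta>"
            using \<kappa>0(3)[OF \<kappa>(1,2) t(1)] ij(3,4) \<epsilon>2(4) by linarith+
          ultimately show "\<exists>i\<in>{0,1}. \<exists>j\<in>{0,1}. \<bar>ang1 \<kappa> t - real i * pi\<bar> \<le> 2 * \<eta> \<and> \<bar>ang2 \<kappa> t - real j * pi\<bar> \<le> 2 * \<eta>"
            by blast
        qed
      qed
    qed
    then show ?thesis using k by blast
  qed
  then show ?thesis using r0 by blast
qed

lemma isotopic_in_S3_refl: "isotopic_in_S3 K K"
  unfolding isotopic_in_S3_def
proof (intro exI[of _ snd] conjI ballI)
  show "continuous_on ({0..1} \<times> S3) snd" by (intro continuous_intros)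
  show "\<exists>g. homeomorphism S3 S3 (\<lambda>x. snd (t, x)) g" for t :: real
    by (intro exI[of _ "\<lambda>x. x"]) (simp add: homeomorphism_ident)
qed auto

theorem theorem41:
  fixes m n :: nat and k\<^sub>1 k\<^sub>2 :: "real poly ^ 5" and p :: "real ^ 4"
  assumes "real_rational_knot m k\<^sub>1"
    and "real_rational_knot n k\<^sub>2"
    and "real_points m k\<^sub>1 \<inter> real_points n k\<^sub>2 = {p}"
  shows "\<exists>r\<^sub>0>0. \<forall>r \<epsilon>. 0 < r \<and> r < r\<^sub>0 \<and> 0 < \<epsilon> \<longrightarrow>
    (\<exists>k L. real_rational_knot (m + n) k \<and>
       small_perturbation (real_points m k\<^sub>1) (real_points n k\<^sub>2) p r \<epsilon> L \<and>
       isotopic_in_S3 (real_points (m + n) k) L)"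
proof -
  have p: "p \<in> real_points m k\<^sub>1" "p \<in> real_points n k\<^sub>2" using assms(3) by auto
  obtain h\<^sub>1 where h1: "real_rational_knot m h\<^sub>1" "real_points m h\<^sub>1 = real_points m k\<^sub>1"
    "curve_map m h\<^sub>1 (vector [0, 1] :: real^2) = hom_point p"
    using base_point_normalisation[OF assms(1) p(1), where 'a = real] by auto
  obtain h\<^sub>2 where h2: "real_rational_knot n h\<^sub>2" "real_points n h\<^sub>2 = real_points n k\<^sub>2"
    "curve_map n h\<^sub>2 (vector [0, 1] :: real^2) = hom_point p"
    using base_point_normalisation[OF assms(2) p(2), where 'a = real] by auto
  show ?thesis
    using glue_normalised_knots[OF h1(1) h2(1) h1(3) h2(3)] isotopic_in_S3_refl unfolding h1(2) h2(2) by blast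
qed

end
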